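(* Let $p$ be a prime and let $k$ be a field of characteristic $p$. Let $J=\{\mathbf a\in\mathbf W_{\mathbf Z_p^2}(k): a_T=0 \text{ for every cyclic } T\}$, an ideal of the Witt–Burnside ring $\mathbf W_{\mathbf Z_p^2}(k)$, and let $R=\mathbf W_{\mathbf Z_p^2}(k)/J$. Then the ring $R$ is isomorphic to the ring $\mathrm{Lip}_{p^{-1}}(\mathbf P^1(\mathbf Q_p),\mathbf W(k))$ (with pointwise addition and multiplication).
   Context: Witt–Burnside rings. For a profinite group $G$, let $\mathcal F(G)$ be the set of isomorphism classes of finite discrete transitive $G$-sets (each is $G/H$, $H$ open). Write $U\le T$ if there is a $G$-map $T\to U$, and let $\varphi_T(U)$ be the number of $G$-maps $T\to U$. The $T$-th Witt polynomial is $W_T(\underline X)=\sum_{U\le T}\varphi_T(U)X_U^{\#T/\#U}$. By Dress–Siebeneicher there are unique polynomials $S_T,M_T\in\mathbf Z[\underline X,\underline Y]$ with $W_T(\underline X)+W_T(\underline Y)=W_T(\underline S)$ and $W_T(\underline X)W_T(\underline Y)=W_T(\underline M)$ for all $T$. For a commutative ring $A$, $\mathbf W_G(A)$ is the set $\prod_{T\in\mathcal F(G)}A$ with $\mathbf a+\mathbf b=(S_T(\mathbf a,\mathbf b))_T$ and $\mathbf a\mathbf b=(M_T(\mathbf a,\mathbf b))_T$; it is a commutative ring. $\mathbf W(k)=\mathbf W_{\mathbf Z_p}(k)$ is the ring of $p$-typical Witt vectors. Cyclic sets and the tree. A $\mathbf Z_p^2$-set $\mathbf Z_p^2/H$ is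 cyclic if the group $\mathbf Z_p^2/H$ is cyclic. The cyclic elements of $\mathcal F(\mathbf Z_p^2)$ are the vertices of a tree $\mathcal T$ rooted at $T_0=\mathbf Z_p^2/\mathbf Z_p^2$, with an edge between $U$ and $T$ when $U\le T$ and $\#T=p\,\#U$; this is the tree of $\mathbf Z_p$-lattices in $\mathbf Q_p^2$ up to $\mathbf Q_p^\times$-scaling ($(p+1)$-regular). Elements of $R$ are identified with families $(a_T)_{T\in\mathcal T}$, $a_T\in k$. Boundary. $\mathbf P^1(\mathbf Q_p)$ is identified with the set of infinite non-backtracking paths $T_0,T_1,T_2,\dots$ in $\mathcal T$ starting at the root, with metric $d(x,y)=p^{-n}$ for $x\ne y$, where $n$ is the number of edges the paths $x,y$ have in common (and $d(x,x)=0$). Norm and Lipschitz functions. For nonzero $w=(w_0,w_1,\dots)\in\mathbf W(k)$, $\|w\|_{\mathbf W(k)}=p^{-n}$ where $n$ is the least index with $w_n\ne0$; $\|0\|_{\mathbf W(k)}=0$. $\mathrm{Lip}_{\alpha}(\mathbf P^1(\mathbf Q_p),\mathbf W(k))$ is the set of $f:\mathbf P^1(\mathbf Q_p)\to\mathbf W(k)$ with $\|f(x)-f(y)\|_{\mathbf W(k)}\le\alpha\, d(x,y)$ for all $x,y$. *)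

theory Defs
  imports
    "HOL-Algebra.QuotRing"
    "HOL-Algebra.Left_Coset"
    "HOL-Algebra.Elementary_Groups"
    "HOL-Algebra.Product_Groups"
    "HOL-Analysis.Function_Topology"
    "HOL-Analysis.Product_Topology"
    "HOL-Library.Poly_Mapping"
    "HOL-Computational_Algebra.Primes"
begin

section \<open>Transitive G-sets\<close>

text \<open>
  A profinite group is given by a group \<open>G\<close> together with a topology \<open>\<tau>\<close> on its carrier.
  A finite discrete transitive \<open>G\<close>-set is isomorphic to a coset space \<open>G/H\<close> with \<open>H\<close> open.
  We only need commutative \<open>G\<close>; then non-equal \<open>H\<close> give non-isomorphic \<open>G/H\<close>
  (lemma \<open>G_set_iso_iff\<close> below), so the isomorphism classes are indexed
  by the open subgroups themselves, and \<open>H\<close> stands for the \<open>G\<close>-set \<open>G/H\<close> throughout.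
\<close>

definition open_subgroups :: "('g, 'm) monoid_scheme \<Rightarrow> 'g topology \<Rightarrow> 'g set set" where
  "open_subgroups G \<tau> = {H. subgroup H G \<and> openin \<tau> H}"

definition G_maps :: "('g, 'm) monoid_scheme \<Rightarrow> 'g set \<Rightarrow> 'g set \<Rightarrow> ('g set \<Rightarrow> 'g set) set" where
  "G_maps G T U = {f \<in> lcosets\<^bsub>G\<^esub> T \<rightarrow>\<^sub>E lcosets\<^bsub>G\<^esub> U.
     \<forall>g\<in>carrier G. \<forall>A\<in>lcosets\<^bsub>G\<^esub> T. f (g <#\<^bsub>G\<^esub> A) = g <#\<^bsub>G\<^esub> f A}"

definition G_set_le :: "('g, 'm) monoid_scheme \<Rightarrow> 'g set \<Rightarrow> 'g set \<Rightarrow> bool" where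
  "G_set_le G U T \<longleftrightarrow> G_maps G T U \<noteq> {}"

definition G_set_card :: "('g, 'm) monoid_scheme \<Rightarrow> 'g set \<Rightarrow> nat" where
  "G_set_card G T = card (lcosets\<^bsub>G\<^esub> T)"

lemma G_set_iso_iff:
  assumes "comm_group G" and H: "subgroup H G" and K: "subgroup K G"
  shows "(\<exists>f\<in>G_maps G H K. bij_betw f (lcosets\<^bsub>G\<^esub> H) (lcosets\<^bsub>G\<^esub> K)) \<longleftrightarrow> H = K"
proof
  interpret comm_group G by fact
  have Hc: "H \<in> lcosets\<^bsub>G\<^esub> H"
    using H unfolding LCOSETS_def
    by (metis (no_types, lifting) UN_iff lcos_mult_one one_closed singletonI subgroup.subset)
  have stab: "g <#\<^bsub>G\<^esub> (a <#\<^bsub>G\<^esub> L) = a <#\<^bsub>G\<^esub> L \<longleftrightarrow> g \<in> L"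
    if "subgroup L G" "a \<in> carrier G" "g \<in> carrier G" for L a g
  proof -
    have L: "L \<subseteq> carrier G" using that subgroup.subset by blast
    have "g <#\<^bsub>G\<^esub> (a <#\<^bsub>G\<^esub> L) = a <#\<^bsub>G\<^esub> (g <#\<^bsub>G\<^esub> L)"
      using that L by (simp add: lcos_m_assoc m_comm)
    moreover have "a <#\<^bsub>G\<^esub> (g <#\<^bsub>G\<^esub> L) = a <#\<^bsub>G\<^esub> L \<longleftrightarrow> g <#\<^bsub>G\<^esub> L = L"
    proof
      assume *: "a <#\<^bsub>G\<^esub> (g <#\<^bsub>G\<^esub> L) = a <#\<^bsub>G\<^esub> L"
      have "inv\<^bsub>G\<^esub> a <#\<^bsub>G\<^esub> (a <#\<^bsub>G\<^esub> (g <#\<^bsub>G\<^esub> L)) = inv\<^bsub>G\<^esub> a <#\<^bsub>G\<^esub> (a <#\<^bsub>G\<^esub> L)"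
        using * by simp
      then show "g <#\<^bsub>G\<^esub> L = L"
        using that L by (simp add: lcos_m_assoc l_coset_subset_G lcos_mult_one m_assoc [symmetric])
    qed simp
    moreover have "g <#\<^bsub>G\<^esub> L = L \<longleftrightarrow> g \<in> L"
      using that by (metis coset_join3 lcos_self)
    ultimately show ?thesis by simp
  qed
  have sub: "h \<in> H \<longleftrightarrow> h \<in> K"
    if f: "f \<in> G_maps G H K" "bij_betw f (lcosets\<^bsub>G\<^esub> H) (lcosets\<^bsub>G\<^esub> K)"
      and h: "h \<in> carrier G" for f h
  proof -
    have "f H \<in> lcosets\<^bsub>G\<^esub> K" using f Hc by (auto simp: G_maps_def)
    then obtain a where a: "a \<in> carrier G" "f H = a <#\<^bsub>G\<^esub> K" by (auto simp: LCOSETS_def)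
    have hH: "h <#\<^bsub>G\<^esub> H \<in> lcosets\<^bsub>G\<^esub> H" using h by (auto simp: LCOSETS_def)
    have eq: "f (h <#\<^bsub>G\<^esub> H) = h <#\<^bsub>G\<^esub> f H" using f h Hc by (auto simp: G_maps_def)
    have "h \<in> H \<longleftrightarrow> h <#\<^bsub>G\<^esub> H = H"
      using h H by (metis coset_join3 lcos_self)
    also have "\<dots> \<longleftrightarrow> f (h <#\<^bsub>G\<^esub> H) = f H"
      using f(2) hH Hc by (metis bij_betw_imp_inj_on inj_on_eq_iff)
    also have "\<dots> \<longleftrightarrow> h \<in> K"
      using stab[OF K a(1) h] a eq by simp
    finally show ?thesis .
  qed
  show "H = K" if "\<exists>f\<in>G_maps G H K. bij_betw f (lcosets\<^bsub>G\<^esub> H) (lcosets\<^bsub>G\<^esub> K)"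
    using that sub subgroup.subset[OF H] subgroup.subset[OF K] by blast
  show "\<exists>f\<in>G_maps G H K. bij_betw f (lcosets\<^bsub>G\<^esub> H) (lcosets\<^bsub>G\<^esub> K)" if "H = K"
  proof (rule bexI)
    have "g <#\<^bsub>G\<^esub> A \<in> lcosets\<^bsub>G\<^esub> H" if "g \<in> carrier G" "A \<in> lcosets\<^bsub>G\<^esub> H" for g A
      using that H by (auto simp: LCOSETS_def lcos_m_assoc subgroup.subset)
    then show "restrict id (lcosets\<^bsub>G\<^esub> H) \<in> G_maps G H K"
      using \<open>H = K\<close> by (auto simp: G_maps_def)
    show "bij_betw (restrict id (lcosets\<^bsub>G\<^esub> H)) (lcosets\<^bsub>G\<^esub> H) (lcosets\<^bsub>G\<^esub> K)"
      using \<open>H = K\<close> by (auto simp: bij_betw_def inj_on_def)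
  qed
qed


section \<open>Polynomials with integer coefficients\<close>

text \<open>The polynomial ring over the integers in variables indexed by \<open>'v\<close>.\<close>

type_synonym 'v int_mpoly = "('v \<Rightarrow>\<^sub>0 nat) \<Rightarrow>\<^sub>0 int"

definition mpoly_var :: "'v \<Rightarrow> 'v int_mpoly" where
  "mpoly_var v = Poly_Mapping.single (Poly_Mapping.single v 1) 1"

definition mpoly_eval :: "('v \<Rightarrow> 'a::comm_ring_1) \<Rightarrow> 'v int_mpoly \<Rightarrow> 'a" where
  "mpoly_eval a P = (\<Sum>m\<in>Poly_Mapping.keys P.
     of_int (Poly_Mapping.lookup P m) *
     (\<Prod>v\<in>Poly_Mapping.keys m. a v ^ Poly_Mapping.lookup m v))"


section \<open>Witt-Burnside rings\<close>

text \<open>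
  \<open>witt_poly G \<tau> T x\<close> is the value of the \<open>T\<close>-th Witt polynomial at a family \<open>x\<close> in any
  commutative ring; the polynomial itself is the value at a family of variables.
\<close>

definition witt_poly ::
  "('g, 'm) monoid_scheme \<Rightarrow> 'g topology \<Rightarrow> 'g set \<Rightarrow> ('g set \<Rightarrow> 'a::comm_ring_1) \<Rightarrow> 'a" where
  "witt_poly G \<tau> T x = (\<Sum>U\<in>{U \<in> open_subgroups G \<tau>. G_set_le G U T}.
     of_nat (card (G_maps G T U)) * x U ^ (G_set_card G T div G_set_card G U))"

text \<open>
  The sum and product polynomials of Dress and Siebeneicher. The variables \<open>X\<^sub>T\<close> and \<open>Y\<^sub>T\<close>
  are \<open>Inl T\<close> and \<open>Inr T\<close>. The equations determine \<open>S T\<close> and \<open>M T\<close> uniquely for every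
  open subgroup \<open>T\<close>; the values at other arguments are never used.
\<close>

definition witt_sum_polys ::
  "('g, 'm) monoid_scheme \<Rightarrow> 'g topology \<Rightarrow> 'g set \<Rightarrow> ('g set + 'g set) int_mpoly" where
  "witt_sum_polys G \<tau> = (SOME S. \<forall>T\<in>open_subgroups G \<tau>.
     witt_poly G \<tau> T (\<lambda>U. mpoly_var (Inl U)) + witt_poly G \<tau> T (\<lambda>U. mpoly_var (Inr U))
       = witt_poly G \<tau> T S)"

definition witt_prod_polys ::
  "('g, 'm) monoid_scheme \<Rightarrow> 'g topology \<Rightarrow> 'g set \<Rightarrow> ('g set + 'g set) int_mpoly" where
  "witt_prod_polys G \<tau> = (SOME M. \<forall>T\<in>open_subgroups G \<tau>.
     witt_poly G \<tau> T (\<lambda>U. mpoly_var (Inl U)) * witt_poly G \<tau> T (\<lambda>U. mpoly_var (Inr U))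
       = witt_poly G \<tau> T M)"

text \<open>
  The neutral elements are the families on which all Witt polynomials take the value 0,
  respectively 1; in the latter, only the coordinate of the one-point \<open>G\<close>-set \<open>G/G\<close> is nonzero.
\<close>

definition witt_burnside_ring ::
  "('g, 'm) monoid_scheme \<Rightarrow> 'g topology \<Rightarrow> ('g set \<Rightarrow> 'a::comm_ring_1) ring" where
  "witt_burnside_ring G \<tau> =
     \<lparr>carrier = open_subgroups G \<tau> \<rightarrow>\<^sub>E UNIV,
      monoid.mult = (\<lambda>a b. \<lambda>T\<in>open_subgroups G \<tau>.
        mpoly_eval (case_sum a b) (witt_prod_polys G \<tau> T)),
      one = (\<lambda>T\<in>open_subgroups G \<tau>. if T = carrier G then 1 else 0),
      zero = (\<lambda>T\<in>open_subgroups G \<tau>. 0),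
      add = (\<lambda>a b. \<lambda>T\<in>open_subgroups G \<tau>.
        mpoly_eval (case_sum a b) (witt_sum_polys G \<tau> T))\<rparr>"


section \<open>The p-adic integers and their square\<close>

text \<open>The inverse limit of the groups of integers modulo \<open>p ^ n\<close>, as a topological group.\<close>

definition Zp :: "nat \<Rightarrow> (nat \<Rightarrow> int) monoid" where
  "Zp p = (let P = product_group UNIV (\<lambda>n. integer_mod_group (p ^ n)) in
     P\<lparr>carrier := {x \<in> carrier P. \<forall>n. x (Suc n) mod int (p ^ n) = x n}\<rparr>)"

definition Zp_topology :: "nat \<Rightarrow> (nat \<Rightarrow> int) topology" where
  "Zp_topology p = subtopology
     (product_topology (\<lambda>n. discrete_topology (carrier (integer_mod_group (p ^ n)))) UNIV)
     (carrier (Zp p))"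

definition Zp2 :: "nat \<Rightarrow> ((nat \<Rightarrow> int) \<times> (nat \<Rightarrow> int)) monoid" where
  "Zp2 p = Zp p \<times>\<times> Zp p"

definition Zp2_topology :: "nat \<Rightarrow> ((nat \<Rightarrow> int) \<times> (nat \<Rightarrow> int)) topology" where
  "Zp2_topology p = prod_topology (Zp_topology p) (Zp_topology p)"

type_synonym zp2_subgroup = "((nat \<Rightarrow> int) \<times> (nat \<Rightarrow> int)) set"


section \<open>p-typical Witt vectors\<close>

definition witt_vectors :: "nat \<Rightarrow> ((nat \<Rightarrow> int) set \<Rightarrow> 'k::comm_ring_1) ring" where
  "witt_vectors p = witt_burnside_ring (Zp p) (Zp_topology p)"

definition pn_Zp :: "nat \<Rightarrow> nat \<Rightarrow> (nat \<Rightarrow> int) set" where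
  "pn_Zp p n = (\<lambda>x. x [^]\<^bsub>Zp p\<^esub> (p ^ n)) ` carrier (Zp p)"

text \<open>The \<open>n\<close>-th component of a Witt vector is its coordinate at \<open>\<int>\<^sub>p / p\<^sup>n \<int>\<^sub>p\<close>.\<close>

definition witt_norm :: "nat \<Rightarrow> ((nat \<Rightarrow> int) set \<Rightarrow> 'k::comm_ring_1) \<Rightarrow> real" where
  "witt_norm p w = (if w = \<zero>\<^bsub>witt_vectors p\<^esub> then 0
     else 1 / real p ^ (LEAST n. w (pn_Zp p n) \<noteq> 0))"


section \<open>The tree and its boundary\<close>

definition tree_vertices :: "nat \<Rightarrow> zp2_subgroup set" where
  "tree_vertices p =
     {H \<in> open_subgroups (Zp2 p) (Zp2_topology p). cyclic_group (Zp2 p Mod H)}"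

definition tree_adj :: "nat \<Rightarrow> zp2_subgroup \<Rightarrow> zp2_subgroup \<Rightarrow> bool" where
  "tree_adj p U T \<longleftrightarrow> U \<in> tree_vertices p \<and> T \<in> tree_vertices p \<and>
     (G_set_le (Zp2 p) U T \<and> G_set_card (Zp2 p) T = p * G_set_card (Zp2 p) U \<or>
      G_set_le (Zp2 p) T U \<and> G_set_card (Zp2 p) U = p * G_set_card (Zp2 p) T)"

text \<open>
  \<open>\<^bold>P\<^sup>1(\<rat>\<^sub>p)\<close> as the set of infinite non-backtracking paths from the root; the root is the
  one-point set \<open>\<int>\<^sub>p\<^sup>2 / \<int>\<^sub>p\<^sup>2\<close>.
\<close>

definition P1_Qp :: "nat \<Rightarrow> (nat \<Rightarrow> zp2_subgroup) set" where
  "P1_Qp p = {x. x 0 = carrier (Zp2 p) \<and>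
     (\<forall>i. tree_adj p (x i) (x (Suc i))) \<and> (\<forall>i. x (Suc (Suc i)) \<noteq> x i)}"

definition path_edges :: "(nat \<Rightarrow> zp2_subgroup) \<Rightarrow> zp2_subgroup set set" where
  "path_edges x = (\<lambda>i. {x i, x (Suc i)}) ` UNIV"

definition P1_dist :: "nat \<Rightarrow> (nat \<Rightarrow> zp2_subgroup) \<Rightarrow> (nat \<Rightarrow> zp2_subgroup) \<Rightarrow> real" where
  "P1_dist p x y = (if x = y then 0 else 1 / real p ^ card (path_edges x \<inter> path_edges y))"


section \<open>The two rings\<close>

definition Lip_ring ::
  "nat \<Rightarrow> real \<Rightarrow> ((nat \<Rightarrow> zp2_subgroup) \<Rightarrow> (nat \<Rightarrow> int) set \<Rightarrow> 'k::comm_ring_1) ring" where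
  "Lip_ring p \<alpha> =
     \<lparr>carrier = {f \<in> P1_Qp p \<rightarrow>\<^sub>E carrier (witt_vectors p).
        \<forall>x\<in>P1_Qp p. \<forall>y\<in>P1_Qp p.
          witt_norm p (f x \<ominus>\<^bsub>witt_vectors p\<^esub> f y) \<le> \<alpha> * P1_dist p x y},
      monoid.mult = (\<lambda>f g. \<lambda>x\<in>P1_Qp p. f x \<otimes>\<^bsub>witt_vectors p\<^esub> g x),
      one = (\<lambda>x\<in>P1_Qp p. \<one>\<^bsub>witt_vectors p\<^esub>),
      zero = (\<lambda>x\<in>P1_Qp p. \<zero>\<^bsub>witt_vectors p\<^esub>),
      add = (\<lambda>f g. \<lambda>x\<in>P1_Qp p. f x \<oplus>\<^bsub>witt_vectors p\<^esub> g x)\<rparr>"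

definition W_Zp2 :: "nat \<Rightarrow> (zp2_subgroup \<Rightarrow> 'k::comm_ring_1) ring" where
  "W_Zp2 p = witt_burnside_ring (Zp2 p) (Zp2_topology p)"

definition cyclic_vanishing :: "nat \<Rightarrow> (zp2_subgroup \<Rightarrow> 'k::comm_ring_1) set" where
  "cyclic_vanishing p = {a \<in> carrier (W_Zp2 p). \<forall>T\<in>tree_vertices p. a T = 0}"

end

theory Submission
  imports Defs "HOL-Algebra.Multiplicative_Group"
begin

text \<open>
  Let \<open>G\<close> be an abelian pro-\<open>p\<close> group such as \<open>\<int>\<^sub>p\<^sup>2\<close>, and let the open subgroup \<open>H\<close> stand for the \<open>G\<close>-set \<open>G/H\<close>. There is a \<open>G\<close>-map from
  \<open>G/H\<close> to \<open>G/K\<close> exactly when \<open>H \<subseteq> K\<close>, and then there are \<open>[G:K]\<close> of them. So the Witt polynomial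
  of \<open>H\<close> is the sum over all \<open>K \<supseteq> H\<close> of \<open>[G:K] * X K ^ [K:H]\<close> (\<open>witt_poly_eq_ghost\<close>).

  If \<open>G/H\<close> is cyclic of order \<open>p ^ n\<close>, the subgroups above \<open>H\<close> form a single chain
  \<open>G = H 0 \<supset> ... \<supset> H n = H\<close> with \<open>[G : H i] = p ^ i\<close>, and the Witt polynomial of \<open>H\<close> is the classical
  one, the sum of \<open>p ^ i * X (H i) ^ (p ^ (n - i))\<close>. Therefore reading off the coordinates of
  \<open>a \<in> W\<^sub>G(k)\<close> along an infinite path \<open>x 0, x 1, ...\<close> of the tree gives a ring homomorphism to \<open>W(k)\<close>
  (\<open>wadd_pullback\<close>, \<open>pullback_on_path\<close>). All paths together give the ring homomorphism
  \<open>boundary_map\<close> from \<open>W\<^sub>G(k)\<close> to the functions from the boundary to \<open>W(k)\<close>.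

  Its kernel is \<open>J\<close>, because every vertex lies on a path (\<open>vertex_on_path\<close>): a cyclic quotient of
  \<open>\<int>\<^sub>p\<^sup>2\<close> of order \<open>p ^ n\<close> is cut out by one congruence \<open>a * x + b * y = 0\<close> modulo \<open>p ^ n\<close> with
  \<open>a\<close>, \<open>b\<close> not both divisible by \<open>p\<close>, and the same congruence modulo all powers of \<open>p\<close> is a path.
  Its image consists of the functions whose \<open>n\<close>-th Witt component at \<open>x\<close> depends on \<open>x n\<close> only. This
  is the Lipschitz condition with constant \<open>1/p\<close> (\<open>Lip_ring_carrier_iff\<close>): two paths with exactly
  \<open>n\<close> common edges agree in the vertices \<open>0, ..., n\<close> and in no other, and a difference of Witt
  vectors vanishes in the components \<open>0, ..., n\<close> exactly when the two vectors agree there.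

  The larger part of the work is to know that \<open>W\<^sub>G(A)\<close> is a ring at all, that is, that the sum and
  product polynomials with integer coefficients exist. This follows the method of Dwork. The ring of
  integer polynomials carries the endomorphism \<open>\<phi>\<close> that raises every variable to the \<open>p\<close>-th power and
  lifts the Frobenius map. A family \<open>w\<close> of polynomials is the family of Witt polynomials at some
  integral point as soon as, for all \<open>H\<close>, the index \<open>[G:H]\<close> divides the sum over \<open>C \<in> G/H\<close> of
  \<open>\<phi> ^^ e (w L)\<close>, where \<open>L/H\<close> is the cyclic group generated by \<open>C\<close> and \<open>p ^ e\<close> is its order
  (\<open>dwork\<close>). These congruences, which twist the orbit counting congruences of the Burnside ring by
  the powers of \<open>\<phi>\<close>, hold for values of Witt polynomials, for their sums and negatives, and for their
  products (\<open>dwork_cong_ghost_mult\<close>). Over a torsion-free ring a point is determined by the values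
  of its Witt polynomials, so every ring axiom holds for generic coordinates, and specializing the
  variables gives it over every ring.
\<close>

section \<open>Evaluation of integer polynomials\<close>

locale ring_1_hom =
  fixes h :: "'a::comm_ring_1 \<Rightarrow> 'b::comm_ring_1"
  assumes hom_add: "h (x + y) = h x + h y"
    and hom_mult: "h (x * y) = h x * h y"
    and hom_one: "h 1 = 1"
begin

lemma hom_zero: "h 0 = 0"
  using hom_add[of 0 0] by simp

lemma hom_uminus: "h (- x) = - h x"
  using hom_add[of x "- x"] hom_zero by (simp add: eq_neg_iff_add_eq_0 add.commute)

lemma hom_sum: "h (sum f A) = (\<Sum>x\<in>A. h (f x))"
  by (induction A rule: infinite_finite_induct) (auto simp: hom_zero hom_add)

lemma hom_prod: "h (prod f A) = (\<Prod>x\<in>A. h (f x))"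
  by (induction A rule: infinite_finite_induct) (auto simp: hom_one hom_mult)

lemma hom_power: "h (x ^ n) = h x ^ n"
  by (induction n) (auto simp: hom_one hom_mult)

lemma hom_of_nat: "h (of_nat n) = of_nat n"
  by (induction n) (auto simp: hom_zero hom_add hom_one)

lemma hom_of_int: "h (of_int n) = of_int n"
  by (cases n rule: int_cases2) (auto simp: hom_of_nat hom_uminus)

end

lemma finite_exponents_eval:
  assumes "finite A" "Poly_Mapping.keys m \<subseteq> A"
  shows "(\<Prod>v\<in>Poly_Mapping.keys m. a v ^ Poly_Mapping.lookup m v)
       = (\<Prod>v\<in>A. a v ^ Poly_Mapping.lookup m v :: 'a::comm_ring_1)"
  using assms by (intro prod.mono_neutral_left) (auto simp: in_keys_iff)

lemma finite_terms_eval: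
  assumes "finite A" "Poly_Mapping.keys P \<subseteq> A"
  shows "mpoly_eval a P = (\<Sum>m\<in>A. of_int (Poly_Mapping.lookup P m) *
           (\<Prod>v\<in>Poly_Mapping.keys m. a v ^ Poly_Mapping.lookup m v))"
  unfolding mpoly_eval_def using assms by (intro sum.mono_neutral_left) (auto simp: in_keys_iff)

lemma mpoly_eval_single:
  "mpoly_eval a (Poly_Mapping.single m c)
     = of_int c * (\<Prod>v\<in>Poly_Mapping.keys m. a v ^ Poly_Mapping.lookup m v)"
  by (subst finite_terms_eval[where A = "{m}"]) auto

lemma mpoly_eval_add: "mpoly_eval a (P + Q) = mpoly_eval a P + mpoly_eval a Q"
proof -
  let ?A = "Poly_Mapping.keys P \<union> Poly_Mapping.keys Q"
  have "finite ?A" "Poly_Mapping.keys (P + Q) \<subseteq> ?A"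
    using Poly_Mapping.keys_add[of P Q] by auto
  then show ?thesis
    by (simp add: finite_terms_eval[where A = ?A] lookup_add algebra_simps sum.distrib)
qed

lemma mpoly_eval_zero: "mpoly_eval a 0 = 0"
  by (simp add: mpoly_eval_def)

lemma mpoly_eval_sum: "mpoly_eval a (sum f A) = (\<Sum>x\<in>A. mpoly_eval a (f x))"
  by (induction A rule: infinite_finite_induct) (auto simp: mpoly_eval_zero mpoly_eval_add)

lemma sum_single_eq: "(\<Sum>m\<in>Poly_Mapping.keys P. Poly_Mapping.single m (Poly_Mapping.lookup P m)) = P"
  by (rule poly_mapping_eqI)
     (auto simp: lookup_sum lookup_single when_def in_keys_iff sum.delta)

lemma mpoly_eval_single_mult:
  "mpoly_eval a (Poly_Mapping.single m c * Poly_Mapping.single n d)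
     = mpoly_eval a (Poly_Mapping.single m c) * mpoly_eval a (Poly_Mapping.single n d)"
proof -
  let ?A = "Poly_Mapping.keys m \<union> Poly_Mapping.keys n"
  let ?p = "\<lambda>A m. \<Prod>v\<in>A. a v ^ Poly_Mapping.lookup m v"
  have "finite ?A" "Poly_Mapping.keys (m + n) \<subseteq> ?A"
    using Poly_Mapping.keys_add[of m n] by auto
  then have "?p (Poly_Mapping.keys (m + n)) (m + n) = ?p ?A (m + n)"
    "?p (Poly_Mapping.keys m) m = ?p ?A m" "?p (Poly_Mapping.keys n) n = ?p ?A n"
    by (intro finite_exponents_eval; auto)+
  moreover have "?p ?A (m + n) = ?p ?A m * ?p ?A n"
    by (simp add: lookup_add power_add prod.distrib)
  ultimately have "?p (Poly_Mapping.keys (m + n)) (m + n)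
      = ?p (Poly_Mapping.keys m) m * ?p (Poly_Mapping.keys n) n"
    by simp
  then show ?thesis
    by (simp add: mult_single mpoly_eval_single mult_ac)
qed

lemma mpoly_eval_mult: "mpoly_eval a (P * Q) = mpoly_eval a P * mpoly_eval a Q"
proof -
  let ?s = "\<lambda>P m. Poly_Mapping.single m (Poly_Mapping.lookup P m)"
  have "mpoly_eval a ((\<Sum>m\<in>Poly_Mapping.keys P. ?s P m) * (\<Sum>n\<in>Poly_Mapping.keys Q. ?s Q n))
    = mpoly_eval a (\<Sum>m\<in>Poly_Mapping.keys P. ?s P m) * mpoly_eval a (\<Sum>n\<in>Poly_Mapping.keys Q. ?s Q n)"
    by (simp add: sum_product mpoly_eval_sum mpoly_eval_single_mult)
  then show ?thesis
    by (simp add: sum_single_eq)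
qed

lemma mpoly_eval_hom: "ring_1_hom (mpoly_eval a)"
proof
  show "mpoly_eval a 1 = 1"
    using mpoly_eval_single[of a 0 1] by (simp flip: single_one)
qed (auto simp: mpoly_eval_add mpoly_eval_mult)

lemma mpoly_eval_var [simp]: "mpoly_eval a (mpoly_var v) = a v"
  by (simp add: mpoly_var_def mpoly_eval_single)

lemma monomial_eq_prod_vars:
  "Poly_Mapping.single m c =
     of_int c * (\<Prod>v\<in>Poly_Mapping.keys m. mpoly_var v ^ Poly_Mapping.lookup m v)"
proof -
  have pow: "mpoly_var v ^ n = Poly_Mapping.single (Poly_Mapping.single v n) 1" for v :: 'a and n
    by (induction n) (auto simp: mpoly_var_def mult_single simp flip: single_add single_one)
  have prod: "(\<Prod>v\<in>A. Poly_Mapping.single (f v) 1) = (Poly_Mapping.single (sum f A) 1 :: 'a int_mpoly)"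
    for A :: "'a set" and f
    by (induction A rule: infinite_finite_induct) (auto simp: mult_single)
  have c: "of_int c = (Poly_Mapping.single 0 c :: 'a int_mpoly)"
    by (rule poly_mapping_eqI) (simp add: lookup_of_int lookup_single)
  show ?thesis
    by (simp add: pow prod sum_single_eq c mult_single)
qed

text \<open>
  Properties closed under the ring operations need to be checked on the constants and variables only;
  this is how the Frobenius congruence is proved for all polynomials.
\<close>

lemma int_mpoly_induct [case_names const var add mult]:
  fixes Q :: "'v int_mpoly \<Rightarrow> bool"
  assumes "\<And>c. Q (of_int c)" "\<And>v. Q (mpoly_var v)"
    and add: "\<And>P P'. Q P \<Longrightarrow> Q P' \<Longrightarrow> Q (P + P')"
    and mult: "\<And>P P'. Q P \<Longrightarrow> Q P' \<Longrightarrow> Q (P * P')"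
  shows "Q P"
proof -
  have Q01: "Q 0" "Q 1" using assms(1)[of 0] assms(1)[of 1] by auto
  have sums: "Q (sum f A)" if "\<And>x. Q (f x)" for f :: "('v \<Rightarrow>\<^sub>0 nat) \<Rightarrow> _" and A
    using that Q01 by (induction A rule: infinite_finite_induct) (auto intro: add)
  have pow: "Q (f ^ n)" if "Q f" for f n
    using that Q01 by (induction n) (auto intro: mult)
  have prods: "Q (prod f A)" if "\<And>x. Q (f x)" for f :: "'v \<Rightarrow> _" and A
    using that Q01 by (induction A rule: infinite_finite_induct) (auto intro: mult)
  have "Q (Poly_Mapping.single m c)" for m c
    unfolding monomial_eq_prod_vars by (intro mult prods pow assms)
  then show ?thesis
    using sums[of "\<lambda>m. Poly_Mapping.single m (Poly_Mapping.lookup P m)" "Poly_Mapping.keys P"]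
    by (simp add: sum_single_eq)
qed

text \<open>
  A predicate on types rather than a type class: the polynomial rings over arbitrary sets of variables
  do not belong to any class of rings without zero divisors, and only integer multiples matter here.
\<close>

definition nat_torsion_free :: "'a::comm_ring_1 itself \<Rightarrow> bool" where
  "nat_torsion_free _ \<longleftrightarrow> (\<forall>n (x::'a). n > 0 \<longrightarrow> of_nat n * x = 0 \<longrightarrow> x = 0)"

lemma nat_torsion_free_int_mpoly: "nat_torsion_free TYPE('v int_mpoly)"
proof -
  have "Poly_Mapping.lookup (of_nat n * x) m = int n * Poly_Mapping.lookup x m" for n and x :: "'v int_mpoly" and m
    by (induction n) (auto simp: algebra_simps lookup_add)
  then show ?thesis
    unfolding nat_torsion_free_def
    by (metis lookup_zero mult_eq_0_iff of_nat_eq_0_iff not_gr_zero poly_mapping_eqI)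
qed


section \<open>Lifts of the Frobenius map\<close>

lemma of_nat_dvd_of_nat: "m dvd n \<Longrightarrow> of_nat m dvd (of_nat n :: 'a::comm_ring_1)"
  by (auto elim!: dvdE)

lemma dvd_freshman:
  fixes a b :: "'a::comm_ring_1"
  assumes "prime p"
  shows "of_nat p dvd (a + b) ^ p - (a ^ p + b ^ p)"
proof -
  have p: "p > 1" using assms prime_gt_1_nat by blast
  have "(a + b) ^ p = (\<Sum>k\<le>p. of_nat (p choose k) * a ^ k * b ^ (p - k))"
    by (rule binomial_ring)
  also have "{..p} = insert 0 (insert p {0<..<p})"
    using p by auto
  also have "(\<Sum>k\<in>\<dots>. of_nat (p choose k) * a ^ k * b ^ (p - k))
    = b ^ p + a ^ p + (\<Sum>k\<in>{0<..<p}. of_nat (p choose k) * a ^ k * b ^ (p - k))"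
    using p by simp
  finally have *: "(a + b) ^ p - (a ^ p + b ^ p) = (\<Sum>k\<in>{0<..<p}. of_nat (p choose k) * a ^ k * b ^ (p - k))"
    by simp
  show ?thesis
    unfolding * using assms
    by (intro dvd_sum dvd_mult2 of_nat_dvd_of_nat) (auto intro!: dvd_choose_prime)
qed

text \<open>
  With \<open>d = a - b\<close>, the quotient \<open>(a ^ p - b ^ p) / d\<close> is a sum of \<open>p\<close> terms that are all congruent to
  \<open>b ^ (p - 1)\<close> modulo \<open>d\<close>. Since \<open>p\<close> divides \<open>d\<close>, it divides this sum, which gives one more factor \<open>p\<close>.
\<close>

lemma dvd_power_diff_step:
  fixes a b :: "'a::comm_ring_1"
  assumes dvd: "of_nat (p ^ Suc j) dvd a - b"
  shows "of_nat (p ^ Suc (Suc j)) dvd a ^ p - b ^ p"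
proof -
  have p: "of_nat p dvd a - b"
    using dvd by (rule dvd_trans[rotated]) (simp add: of_nat_dvd_of_nat)
  have "of_nat p dvd (\<Sum>i<p. b ^ (p - Suc i) * a ^ i)"
  proof -
    have "of_nat p dvd (\<Sum>i<p. b ^ (p - Suc i) * (a ^ i - b ^ i))"
    proof (intro dvd_sum dvd_mult)
      fix i
      have "a - b dvd a ^ i - b ^ i"
        by (simp add: power_diff_sumr2)
      then show "of_nat p dvd a ^ i - b ^ i"
        using p dvd_trans by blast
    qed
    moreover have "(\<Sum>i<p. b ^ (p - Suc i) * b ^ i) = (\<Sum>i<p. b ^ (p - 1))"
      by (intro sum.cong) (auto simp flip: power_add)
    then have "of_nat p dvd (\<Sum>i<p. b ^ (p - Suc i) * b ^ i)"
      by simp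
    ultimately have "of_nat p dvd (\<Sum>i<p. b ^ (p - Suc i) * (a ^ i - b ^ i))
       + (\<Sum>i<p. b ^ (p - Suc i) * b ^ i)"
      by (rule dvd_add)
    then show ?thesis
      by (simp flip: sum.distrib add: right_diff_distrib)
  qed
  then have "of_nat (p ^ Suc j) * of_nat p dvd (a - b) * (\<Sum>i<p. b ^ (p - Suc i) * a ^ i)"
    using dvd by (rule mult_dvd_mono[rotated])
  then show ?thesis
    by (simp add: power_diff_sumr2 mult.commute mult.left_commute)
qed

locale frobenius_lift = ring_1_hom \<phi> for \<phi> :: "'a::comm_ring_1 \<Rightarrow> 'a" +
  fixes p :: nat
  assumes prime_p: "prime p"
    and frobenius_cong: "of_nat p dvd \<phi> x - x ^ p"
begin

lemma funpow_hom: "ring_1_hom (\<phi> ^^ n)"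
proof (induction n)
  case (Suc n)
  then interpret f: ring_1_hom "\<phi> ^^ n" .
  show ?case
    by standard (auto simp: hom_add hom_mult hom_one f.hom_add f.hom_mult f.hom_one)
qed (standard, auto)

lemma frobenius_power_cong:
  "of_nat (p ^ Suc j) dvd \<phi> x ^ (p ^ j) - x ^ (p ^ Suc j)"
proof (induction j)
  case 0
  then show ?case using frobenius_cong by simp
next
  case (Suc j)
  have "of_nat (p ^ Suc (Suc j)) dvd (\<phi> x ^ (p ^ j)) ^ p - (x ^ (p ^ Suc j)) ^ p"
    using Suc by (rule dvd_power_diff_step)
  then show ?case
    by (simp flip: power_mult add: mult.commute)
qed

end

lemma frobenius_lift_int_mpoly:
  assumes p: "prime p"
  shows "frobenius_lift (mpoly_eval (\<lambda>v. mpoly_var v ^ p)) p"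
proof -
  let ?\<phi> = "mpoly_eval (\<lambda>v::'a. mpoly_var v ^ p)"
  interpret \<phi>: ring_1_hom ?\<phi> by (rule mpoly_eval_hom)
  define D where "D P \<longleftrightarrow> of_nat p dvd ?\<phi> P - P ^ p" for P
  have p0: "p > 0" using p prime_gt_0_nat by blast
  have add: "D (P + Q)" if "D P" "D Q" for P Q
  proof -
    have "of_nat p dvd (?\<phi> P - P ^ p) + (?\<phi> Q - Q ^ p) - ((P + Q) ^ p - (P ^ p + Q ^ p))"
      using that unfolding D_def by (rule dvd_diff[OF dvd_add dvd_freshman[OF p]])
    then show ?thesis by (simp add: D_def \<phi>.hom_add algebra_simps)
  qed
  have mult: "D (P * Q)" if "D P" "D Q" for P Q
  proof -
    have "of_nat p dvd (?\<phi> P - P ^ p) * ?\<phi> Q + P ^ p * (?\<phi> Q - Q ^ p)"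
      using that unfolding D_def by (intro dvd_add dvd_mult2 dvd_mult) auto
    then show ?thesis by (simp add: D_def \<phi>.hom_mult algebra_simps power_mult_distrib)
  qed
  have one: "D 1" "D 0" using p0 by (auto simp: D_def \<phi>.hom_one \<phi>.hom_zero power_0_left)
  have \<phi>1: "?\<phi> (- 1) = - 1"
    by (simp only: \<phi>.hom_one \<phi>.hom_uminus)
  \<comment> \<open>For \<open>p = 2\<close> the two sides differ by a sign, which is harmless modulo 2.\<close>
  have minus_one: "D (- 1)"
  proof (cases "p = 2")
    case False
    then have "odd p" using p primes_dvd_imp_eq two_is_prime_nat by blast
    then show ?thesis by (simp add: D_def \<phi>1)
  next
    case True
    then have "(2 :: 'a int_mpoly) dvd - 1 - (- 1) ^ p" by simp
    then show ?thesis unfolding D_def \<phi>1 using True by simp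
  qed
  have nat: "D (of_nat n)" for n
    by (induction n) (auto intro: one add)
  have "D (of_int c)" for c
  proof (cases c rule: int_cases2)
    case (nonpos n)
    then show ?thesis using mult[OF minus_one nat[of n]] by simp
  qed (simp add: nat)
  moreover have "D (mpoly_var v)" for v by (simp add: D_def)
  ultimately have "D P" for P
    by (induction P rule: int_mpoly_induct) (auto intro: add mult)
  then show ?thesis
    using p by unfold_locales (auto simp: D_def)
qed

section \<open>Sums over finite abelian p-groups\<close>

text \<open>
  The \<open>p ^ m\<close>-torsion of \<open>S\<close> is a subgroup, so its order is some \<open>p ^ j\<close>. If \<open>j < m\<close>, its exponent
  divides \<open>p ^ j\<close>; hence \<open>S\<close> has no element of order \<open>p ^ Suc j\<close>, so none of larger order either,
  and \<open>S\<close> itself is this torsion subgroup, of order \<open>p ^ N\<close>.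
\<close>

lemma (in comm_group) prime_power_torsion_dvd:
  assumes S: "subgroup S G" "card S = p ^ N" and p: "prime p" and m: "m \<le> N"
  shows "p ^ m dvd card {x \<in> S. x [^] (p ^ m) = \<one>}"
proof -
  have p1: "p > 1" using p prime_gt_1_nat by blast
  then have fin: "finite S" using S by (intro card_ge_0_finite) simp
  have SG: "S \<subseteq> carrier G" using S subgroup.subset by blast
  let ?T = "\<lambda>m. {x \<in> S. x [^] (p ^ m) = \<one>}"
  have T: "subgroup (?T m) G" for m
  proof (rule subgroupI)
    show "?T m \<subseteq> carrier G" using SG by auto
    show "?T m \<noteq> {}" using subgroup.one_closed[OF S(1)] by auto
    show "inv a \<in> ?T m" if "a \<in> ?T m" for a
      using that SG subgroup.m_inv_closed[OF S(1)] by (auto simp: nat_pow_inv)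
    show "a \<otimes> b \<in> ?T m" if "a \<in> ?T m" "b \<in> ?T m" for a b
      using that SG subgroup.m_closed[OF S(1)] by (auto simp: nat_pow_distrib subset_iff)
  qed
  have lag: "card A dvd card B" if "subgroup A G" "subgroup B G" "A \<subseteq> B" for A B
  proof -
    interpret B: group "G\<lparr>carrier := B\<rparr>" using that subgroup.subgroup_is_group is_group by blast
    have "subgroup A (G\<lparr>carrier := B\<rparr>)" using that subgroup_incl by blast
    then show ?thesis using B.lagrange by (metis dvd_triv_right order_def partial_object.select_convs(1) partial_object.update_convs(1) partial_object.surjective)
  qed
  have pw: "x [^] card B = \<one>" if "subgroup B G" "x \<in> B" for B x
  proof -
    interpret B: group "G\<lparr>carrier := B\<rparr>" using that subgroup.subgroup_is_group is_group by blast
    show ?thesis using B.pow_order_eq_1[of x] that by (simp add: order_def flip: nat_pow_consistent)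
  qed
  have "card (?T m) dvd p ^ N" using lag[OF T S(1)] S(2) by auto
  then obtain j where j: "j \<le> N" "card (?T m) = p ^ j"
    using divides_primepow_nat[OF p] by blast
  show ?thesis
  proof (cases "m \<le> j")
    case False
    \<comment> \<open>Otherwise an element of order \<open>p ^ Suc j\<close> would lie in a group of order \<open>p ^ j\<close>.\<close>
    have "x [^] (p ^ j) = \<one>" if x: "x \<in> S" for x
    proof (rule ccontr)
      assume nx: "x [^] (p ^ j) \<noteq> \<one>"
      have xG: "x \<in> carrier G" using x SG by auto
      have "x [^] (p ^ N) = \<one>" using pw[OF S(1) x] S(2) by simp
      then have ex: "\<exists>s. x [^] (p ^ s) = \<one>" by blast
      define s where "s = (LEAST s. x [^] (p ^ s) = \<one>)"
      have s: "x [^] (p ^ s) = \<one>" unfolding s_def using ex by (rule LeastI_ex)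
      have smin: "x [^] (p ^ t) \<noteq> \<one>" if "t < s" for t
        using that not_less_Least unfolding s_def by blast
      have "s > j"
      proof (rule ccontr)
        assume "\<not> s > j"
        then have "p ^ j = p ^ s * p ^ (j - s)" by (simp flip: power_add)
        then show False using nx s xG by (metis nat_pow_one nat_pow_pow)
      qed
      define y where "y = x [^] (p ^ (s - Suc j))"
      have yS: "y \<in> S" unfolding y_def using S x
        by (metis subgroup.subgroup_is_group group.is_monoid is_group monoid.nat_pow_closed nat_pow_consistent partial_object.select_convs(1) partial_object.update_convs(1) partial_object.surjective)
      have ypow: "y [^] (p ^ i) = x [^] (p ^ (s - Suc j + i))" for i
        using xG by (simp add: y_def nat_pow_pow power_add)
      have "y [^] (p ^ m) = \<one>"
      proof -
        have "p ^ (s - Suc j + m) = p ^ s * p ^ (m - Suc j)"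
          using False \<open>s > j\<close> by (simp flip: power_add)
        then show ?thesis using s xG by (metis ypow nat_pow_one nat_pow_pow)
      qed
      then have "y \<in> ?T m" using yS by simp
      then have "y [^] (p ^ j) = \<one>" using pw[OF T[of m], of y] j by simp
      then show False using ypow[of j] smin[of "s - Suc j + j"] \<open>s > j\<close> by simp
    qed
    then have "S \<subseteq> ?T j" by auto
    moreover have "?T j \<subseteq> ?T m"
    proof safe
      fix x assume x: "x \<in> S" "x [^] (p ^ j) = \<one>"
      have "p ^ m = p ^ j * p ^ (m - j)" using False by (simp flip: power_add)
      then show "x [^] (p ^ m) = \<one>" using x SG by (metis nat_pow_one nat_pow_pow subsetD)
    qed
    ultimately have "?T m = S" by auto
    then have "card (?T m) = p ^ N" using S by simp
    then show ?thesis using m by (simp add: le_imp_power_dvd)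
  qed (simp add: j le_imp_power_dvd)
qed


text \<open>
  Abel summation over the orders \<open>p ^ m\<close>. The summand \<open>f m\<close> belonging to order \<open>p ^ m\<close> changes by a
  multiple of \<open>p ^ (N - m)\<close> when \<open>m\<close> increases by one, and this change is taken once for each
  element of order at most \<open>p ^ m\<close>, the number of which is a multiple of \<open>p ^ m\<close>.
\<close>

lemma (in frobenius_lift) sum_frobenius_powers_dvd:
  fixes Q (structure)
  assumes Q: "comm_group Q" and S: "subgroup S Q" "card S = p ^ N"
  shows "of_nat (p ^ N) dvd
    (\<Sum>C\<in>S. (\<phi> ^^ multiplicity p (group.ord Q C)) z ^ (p ^ N div group.ord Q C))"
proof -
  interpret Q: comm_group Q by (rule Q)
  have p1: "p > 1" using prime_p prime_gt_1_nat by blast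
  then have fin: "finite S" using S by (intro card_ge_0_finite) simp
  have SQ: "S \<subseteq> carrier Q" using S subgroup.subset by blast
  define e where "e C = multiplicity p (Q.ord C)" for C
  have ord: "Q.ord C = p ^ e C" "e C \<le> N" if C: "C \<in> S" for C
  proof -
    interpret S: group "Q\<lparr>carrier := S\<rparr>" using S(1) subgroup.subgroup_is_group Q.is_group by blast
    have "C [^] (p ^ N) = \<one>"
      using S.pow_order_eq_1[of C] C S(2) by (simp add: order_def flip: Q.nat_pow_consistent)
    then have "Q.ord C dvd p ^ N" using C SQ Q.pow_eq_id by blast
    then obtain j where "j \<le> N" "Q.ord C = p ^ j"
      using divides_primepow_nat[OF prime_p] by blast
    then show "Q.ord C = p ^ e C" "e C \<le> N"
      using p1 by (auto simp: e_def multiplicity_same_power)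
  qed
  define f where "f m = (\<phi> ^^ m) z ^ (p ^ (N - m))" for m
  \<comment> \<open>\<open>f m\<close> is the summand that belongs to an element of order \<open>p ^ m\<close>.\<close>
  define g where "g m = f m - f (Suc m)" for m
  have g: "of_nat (p ^ (N - m)) dvd g m" if "m < N" for m
  proof -
    have N: "N - m = Suc (N - Suc m)" using that by simp
    have "of_nat (p ^ (N - m)) dvd f (Suc m) - f m"
      unfolding f_def N using frobenius_power_cong[of "N - Suc m" "(\<phi> ^^ m) z"] by simp
    then show ?thesis unfolding g_def by (metis dvd_minus_iff minus_diff_eq)
  qed
  have fe: "f (e C) = f N + (\<Sum>m<N. if e C \<le> m then g m else 0)" if "C \<in> S" for C
  proof -
    have "(\<Sum>m<N. if e C \<le> m then g m else 0) = (\<Sum>m\<in>{e C..<N}. g m)"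
      by (rule sum.mono_neutral_cong_right) auto
    also have "\<dots> = - (\<Sum>m\<in>{e C..<N}. f (Suc m) - f m)"
      by (simp add: g_def flip: sum_negf)
    also have "\<dots> = f (e C) - f N"
      using ord[OF that] by (simp add: sum_Suc_diff')
    finally show ?thesis by simp
  qed
  have "(\<Sum>C\<in>S. (\<phi> ^^ multiplicity p (Q.ord C)) z ^ (p ^ N div Q.ord C)) = (\<Sum>C\<in>S. f (e C))"
  proof (rule sum.cong)
    fix C assume "C \<in> S"
    from ord[OF this] p1 show "(\<phi> ^^ multiplicity p (Q.ord C)) z ^ (p ^ N div Q.ord C) = f (e C)"
      by (simp add: f_def multiplicity_same_power flip: power_diff)
  qed simp
  also have "\<dots> = of_nat (p ^ N) * f N + (\<Sum>C\<in>S. \<Sum>m<N. if e C \<le> m then g m else 0)"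
    using S(2) by (simp add: fe sum.distrib)
  also have "(\<Sum>C\<in>S. \<Sum>m<N. if e C \<le> m then g m else 0)
      = (\<Sum>m<N. of_nat (card {C \<in> S. C [^] (p ^ m) = \<one>}) * g m)"
  proof (subst sum.swap, rule sum.cong)
    fix m assume "m \<in> {..<N}"
    have "C [^] (p ^ m) = \<one> \<longleftrightarrow> e C \<le> m" if "C \<in> S" for C
      using Q.pow_eq_id[of C "p ^ m"] ord[OF that] that SQ p1
      by (auto simp: dvd_power_iff_le)
    then have "{C \<in> S. C [^] (p ^ m) = \<one>} = {C \<in> S. e C \<le> m}" by auto
    then show "(\<Sum>C\<in>S. if e C \<le> m then g m else 0) = of_nat (card {C \<in> S. C [^] (p ^ m) = \<one>}) * g m"
      using fin by (simp flip: sum.inter_filter)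
  qed simp
  also have "of_nat (p ^ N) dvd of_nat (p ^ N) * f N + \<dots>"
  proof (intro dvd_add dvd_triv_left dvd_sum)
    fix m assume "m \<in> {..<N}"
    then have m: "m < N" by simp
    have "p ^ m dvd card {C \<in> S. C [^] (p ^ m) = \<one>}"
      using Q.prime_power_torsion_dvd[OF S prime_p] m by simp
    then have "(of_nat (p ^ m) :: 'a) * of_nat (p ^ (N - m))
        dvd of_nat (card {C \<in> S. C [^] (p ^ m) = \<one>}) * g m"
      by (intro mult_dvd_mono g m of_nat_dvd_of_nat)
    moreover have "(of_nat (p ^ m) :: 'a) * of_nat (p ^ (N - m)) = of_nat (p ^ N)"
      using m by (simp flip: of_nat_mult power_add)
    ultimately show "of_nat (p ^ N) dvd of_nat (card {C \<in> S. C [^] (p ^ m) = \<one>}) * g m"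
      by simp
  qed
  finally show ?thesis .
qed

section \<open>Subgroups above a given one in an abelian group\<close>

context comm_group
begin

definition index :: "'a set \<Rightarrow> nat" where
  "index H = card (rcosets H)"

text \<open>
  For \<open>H \<subseteq> K\<close> this is the subgroup \<open>K/H\<close> of \<open>G/H\<close>.
\<close>

definition cosets_within :: "'a set \<Rightarrow> 'a set \<Rightarrow> 'a set set" where
  "cosets_within H K = {C \<in> rcosets H. C \<subseteq> K}"

text \<open>
  The subgroup of \<open>G\<close> that contains \<open>H\<close> and corresponds to the cyclic subgroup of \<open>G/H\<close> generated by \<open>C\<close>.
\<close>

definition cyclic_over :: "'a set \<Rightarrow> 'a set \<Rightarrow> 'a set" where
  "cyclic_over H C = \<Union>(generate (G Mod H) {C})"

lemma set_mult_rcoset: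
  assumes H: "subgroup H G" and K: "subgroup K G" and "H \<subseteq> K" and x: "x \<in> carrier G"
  shows "K <#> (H #> x) = K #> x"
proof -
  have "K <#> H = K"
    using assms by (intro set_mult_subgroup_idem subgroup_incl) auto
  then show ?thesis
    using assms by (simp add: setmult_rcos_assoc subgroup.subset)
qed

lemma rcoset_subset_iff:
  assumes H: "subgroup H G" and K: "subgroup K G" and "H \<subseteq> K" and x: "x \<in> carrier G"
  shows "H #> x \<subseteq> K \<longleftrightarrow> x \<in> K"
proof
  show "x \<in> K" if "H #> x \<subseteq> K"
    using that rcos_self[OF x H] by blast
  show "H #> x \<subseteq> K" if "x \<in> K"
    using that \<open>H \<subseteq> K\<close> subgroup.m_closed[OF K] by (auto simp: r_coset_def)
qed

lemma comm_group_Mod: "subgroup H G \<Longrightarrow> comm_group (G Mod H)"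
  by (rule abelian_FactGroup)

lemma Mod_hom:
  assumes H: "subgroup H G" and K: "subgroup K G" and HK: "H \<subseteq> K"
  shows "group_hom (G Mod H) (G Mod K) (\<lambda>C. K <#> C)"
    and "(\<lambda>C. K <#> C) ` carrier (G Mod H) = carrier (G Mod K)"
    and "kernel (G Mod H) (G Mod K) (\<lambda>C. K <#> C) = cosets_within H K"
proof -
  interpret Q: comm_group "G Mod H" using H by (rule comm_group_Mod)
  interpret Q': comm_group "G Mod K" using K by (rule comm_group_Mod)
  interpret H: normal H G using H by (rule subgroup_imp_normal)
  interpret K: normal K G using K by (rule subgroup_imp_normal)
  show "group_hom (G Mod H) (G Mod K) (\<lambda>C. K <#> C)"
  proof (unfold_locales, rule homI)
    fix C assume "C \<in> carrier (G Mod H)"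
    then show "K <#> C \<in> carrier (G Mod K)"
      using assms by (auto simp: carrier_FactGroup set_mult_rcoset)
    fix D assume "D \<in> carrier (G Mod H)"
    then show "K <#> (C \<otimes>\<^bsub>G Mod H\<^esub> D) = (K <#> C) \<otimes>\<^bsub>G Mod K\<^esub> (K <#> D)"
      using assms \<open>C \<in> carrier (G Mod H)\<close>
      by (auto simp: carrier_FactGroup set_mult_rcoset H.rcos_sum K.rcos_sum)
  qed
  show "(\<lambda>C. K <#> C) ` carrier (G Mod H) = carrier (G Mod K)"
    using assms by (auto simp: carrier_FactGroup set_mult_rcoset image_image)
  show "kernel (G Mod H) (G Mod K) (\<lambda>C. K <#> C) = cosets_within H K"
  proof -
    have "K <#> C = K \<longleftrightarrow> C \<subseteq> K" if C: "C \<in> rcosets H" for C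
    proof -
      obtain x where x: "x \<in> carrier G" "C = H #> x" using C by (auto simp: RCOSETS_def)
      then show ?thesis
        using rcoset_subset_iff[OF assms x(1)] coset_join1[of K x] coset_join2[of x K] K
          set_mult_rcoset[OF assms x(1)] by (auto simp only: subgroup.subset)
    qed
    then show ?thesis
      by (auto simp: kernel_def cosets_within_def FactGroup_def)
  qed
qed

lemma cosets_within_subgroup:
  assumes "subgroup H G" "subgroup K G" "H \<subseteq> K"
  shows "subgroup (cosets_within H K) (G Mod H)"
  using group_hom.subgroup_kernel[OF Mod_hom(1)[OF assms]] Mod_hom(3)[OF assms] by simp

text \<open>
  The projection from \<open>G/H\<close> to \<open>G/K\<close> identifies \<open>G/K\<close> with the quotient of \<open>G/H\<close> by \<open>K/H\<close>, to which Lagrange's theorem applies.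
\<close>

lemma index_mult:
  assumes "subgroup H G" "subgroup K G" "H \<subseteq> K"
  shows "index H = index K * card (cosets_within H K)"
proof -
  interpret Q: comm_group "G Mod H" using assms by (intro comm_group_Mod)
  note iso = group_hom.FactGroup_iso_set[OF Mod_hom(1,2)[OF assms], unfolded Mod_hom(3)[OF assms]]
  have "card (rcosets\<^bsub>G Mod H\<^esub> (cosets_within H K)) = index K"
    using iso by (auto simp: iso_def index_def FactGroup_def dest: bij_betw_same_card)
  then show ?thesis
    using Q.lagrange[OF cosets_within_subgroup[OF assms]]
    by (simp add: order_def index_def FactGroup_def)
qed

lemma Union_cosets_within:
  assumes "subgroup H G" "subgroup K G" "H \<subseteq> K"
  shows "\<Union>(cosets_within H K) = K"
proof
  show "K \<subseteq> \<Union>(cosets_within H K)"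
  proof
    fix x assume "x \<in> K"
    moreover from this have x: "x \<in> carrier G" using assms subgroup.subset by blast
    ultimately show "x \<in> \<Union>(cosets_within H K)"
      using rcoset_subset_iff[OF assms x] rcos_self[OF x assms(1)]
        rcosetsI[OF subgroup.subset[OF assms(1)] x]
      unfolding cosets_within_def by blast
  qed
qed (auto simp: cosets_within_def)

lemma rcosets_one: "subgroup H G \<Longrightarrow> H \<in> rcosets H"
  by (intro subgroup.subgroup_in_rcosets is_group)

lemma finite_subgroups_above:
  assumes "subgroup H G" "finite (rcosets H)"
  shows "finite {K. subgroup K G \<and> H \<subseteq> K}"
proof (rule inj_on_finite)
  show "inj_on (cosets_within H) {K. subgroup K G \<and> H \<subseteq> K}"
    by (rule inj_on_inverseI[where g = Union]) (use Union_cosets_within[OF assms(1)] in auto)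
  show "cosets_within H ` {K. subgroup K G \<and> H \<subseteq> K} \<subseteq> Pow (rcosets H)"
    by (auto simp: cosets_within_def)
qed (use assms in simp)

lemma index_antisym:
  assumes "subgroup H G" "subgroup K G" "H \<subseteq> K" "index H = index K" "index H \<noteq> 0"
  shows "H = K"
proof -
  have "card (cosets_within H K) = 1"
    using index_mult[OF assms(1-3)] assms by simp
  moreover have "H \<in> cosets_within H K"
    using assms rcosets_one by (auto simp: cosets_within_def)
  ultimately have "cosets_within H K = {H}"
    by (metis card_1_singletonE singletonD)
  then show ?thesis
    using Union_cosets_within[OF assms(1-3)] by simp
qed

lemma cyclic_over:
  assumes H: "subgroup H G" and C: "C \<in> rcosets H"
  shows "subgroup (cyclic_over H C) G" "H \<subseteq> cyclic_over H C"
    and "cosets_within H (cyclic_over H C) = generate (G Mod H) {C}"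
    and "\<And>K. subgroup K G \<Longrightarrow> H \<subseteq> K \<Longrightarrow> cyclic_over H C \<subseteq> K \<longleftrightarrow> C \<subseteq> K"
proof -
  interpret Q: comm_group "G Mod H" using H by (rule comm_group_Mod)
  interpret H: normal H G using H by (rule subgroup_imp_normal)
  have cQ: "carrier (G Mod H) = rcosets H" by (simp add: FactGroup_def)
  have gen: "subgroup (generate (G Mod H) {C}) (G Mod H)"
    using C by (intro Q.generate_is_subgroup) (auto simp: cQ)
  show "subgroup (cyclic_over H C) G"
    unfolding cyclic_over_def by (rule H.factgroup_subgroup_union_subgroup[OF gen])
  show "H \<subseteq> cyclic_over H C"
    using subgroup.one_closed[OF gen] by (auto simp: cyclic_over_def)
  show "cosets_within H (cyclic_over H C) = generate (G Mod H) {C}"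
  proof -
    have "D \<in> generate (G Mod H) {C}" if D: "D \<in> rcosets H" "D \<subseteq> cyclic_over H C" for D
    proof -
      obtain x where x: "x \<in> carrier G" "D = H #> x" using D by (auto simp: RCOSETS_def)
      then have "x \<in> cyclic_over H C" using D rcos_self[OF _ H] by blast
      then show ?thesis
        unfolding cyclic_over_def H.factgroup_subgroup_union_char[OF gen] using x by simp
    qed
    then show ?thesis
      using subgroup.subset[OF gen] by (auto simp: cosets_within_def cQ cyclic_over_def)
  qed
  show "cyclic_over H C \<subseteq> K \<longleftrightarrow> C \<subseteq> K" if K: "subgroup K G" "H \<subseteq> K" for K
  proof
    show "C \<subseteq> K" if "cyclic_over H C \<subseteq> K"
      using that generate.incl[of C "{C}"] by (auto simp: cyclic_over_def)
    assume "C \<subseteq> K"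
    then have "generate (G Mod H) {C} \<subseteq> cosets_within H K"
      using C cosets_within_subgroup[OF H K]
      by (intro Q.generate_subgroup_incl) (auto simp: cosets_within_def)
    then show "cyclic_over H C \<subseteq> K"
      by (auto simp: cyclic_over_def cosets_within_def)
  qed
qed

lemma index_cyclic_over:
  assumes H: "subgroup H G" and C: "C \<in> rcosets H"
  shows "index H = index (cyclic_over H C) * group.ord (G Mod H) C"
proof -
  interpret Q: comm_group "G Mod H" using H by (rule comm_group_Mod)
  have "Q.ord C = card (generate (G Mod H) {C})"
    using C by (intro Q.generate_pow_card) (simp add: FactGroup_def)
  then show ?thesis
    using index_mult[OF H cyclic_over(1,2)[OF assms]] cyclic_over(3)[OF assms] by simp
qed

lemma cyclic_over_self:
  assumes H: "subgroup H G"
  shows "cyclic_over H H = H"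
  using cyclic_over(4)[OF H rcosets_one[OF H] H] cyclic_over(2)[OF H rcosets_one[OF H]] by auto

lemma cyclic_over_eq_self:
  assumes H: "subgroup H G" and C: "C \<in> rcosets H" and "cyclic_over H C = H"
  shows "C = H"
proof -
  obtain x where x: "x \<in> carrier G" "C = H #> x" using C by (auto simp: RCOSETS_def)
  have "C \<subseteq> H" using cyclic_over(4)[OF H C H] assms by simp
  then have "x \<in> H" using rcoset_subset_iff[OF H H _ x(1)] x by simp
  then show ?thesis using x coset_join2[OF x(1) H] by simp
qed

text \<open>
  The map from \<open>G/(L \<inter> L')\<close> to \<open>G/L \<times> G/L'\<close> is injective.
\<close>

lemma index_Int_le:
  assumes L: "subgroup L G" and L': "subgroup L' G"
    and fin: "finite (rcosets L)" "finite (rcosets L')"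
  shows "index (L \<inter> L') \<le> index L * index L'"
proof -
  have LL: "subgroup (L \<inter> L') G" using L L' by (rule subgroups_Inter_pair)
  let ?f = "\<lambda>C. (L <#> C, L' <#> C)"
  have "card (rcosets (L \<inter> L')) \<le> card ((rcosets L) \<times> (rcosets L'))"
  proof (rule card_inj_on_le)
    show "inj_on ?f (rcosets (L \<inter> L'))"
    proof (rule inj_onI)
      fix C D assume "C \<in> rcosets (L \<inter> L')" "D \<in> rcosets (L \<inter> L')" and eq: "?f C = ?f D"
      then obtain x y where x: "x \<in> carrier G" "C = (L \<inter> L') #> x"
        and y: "y \<in> carrier G" "D = (L \<inter> L') #> y" by (auto simp: RCOSETS_def)
      have *: "L #> x = L #> y" "L' #> x = L' #> y"
        using eq x y set_mult_rcoset[OF LL L] set_mult_rcoset[OF LL L'] by auto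
      have "x \<in> L #> y" "x \<in> L' #> y"
        using * x rcos_self[OF x(1)] L L' by auto
      then have "x \<in> (L \<inter> L') #> y"
        using subgroup.rcos_module[OF LL is_group y(1) x(1)] subgroup.rcos_module[OF L is_group y(1) x(1)]
          subgroup.rcos_module[OF L' is_group y(1) x(1)] by auto
      then show "C = D" using x y repr_independence[OF _ _ LL] by auto
    qed
    show "?f ` (rcosets (L \<inter> L')) \<subseteq> (rcosets L) \<times> (rcosets L')"
      using set_mult_rcoset[OF LL L] set_mult_rcoset[OF LL L'] by (auto simp: RCOSETS_def)
  qed (use fin in simp)
  then show ?thesis by (simp add: index_def card_cartesian_product)
qed

section \<open>Equivariant maps between coset spaces\<close>

lemma lcosets_eq_rcosets: "subgroup H G \<Longrightarrow> lcosets H = rcosets H"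
  using subgroup.subset[of H G]
  by (auto simp: LCOSETS_def RCOSETS_def l_coset_def r_coset_def m_comm subset_iff)

lemma G_set_card_eq_index: "subgroup H G \<Longrightarrow> G_set_card G H = index H"
  by (simp add: G_set_card_def index_def lcosets_eq_rcosets)

lemma lcosets_self: "subgroup H G \<Longrightarrow> H \<in> lcosets H"
  by (simp add: lcosets_eq_rcosets rcosets_one)

lemma G_map_apply:
  assumes "f \<in> G_maps G T U" "subgroup T G" "g \<in> carrier G"
  shows "f (g <# T) = g <# f T"
  using assms lcosets_self[of T] by (auto simp: G_maps_def)

text \<open>
  Elements of \<open>T\<close> fix the coset \<open>T\<close>, so they fix its image \<open>a <# U\<close>, whose stabilizer is \<open>U\<close>.
\<close>

lemma G_maps_subset:
  assumes f: "f \<in> G_maps G T U" and T: "subgroup T G" and U: "subgroup U G"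
  shows "T \<subseteq> U"
proof
  fix t assume t: "t \<in> T"
  then have tG: "t \<in> carrier G" using T subgroup.subset by blast
  have "f T \<in> lcosets U" using f lcosets_self[OF T] by (auto simp: G_maps_def)
  then obtain a where a: "a \<in> carrier G" "f T = a <# U" by (auto simp: LCOSETS_def)
  have "t <# T = T" using t tG T by (metis coset_join3)
  then have "t <# (a <# U) = a <# U" using G_map_apply[OF f T tG] a by simp
  then have "(t \<otimes> a) <# U = a <# U"
    using a tG U by (simp add: lcos_m_assoc subgroup.subset)
  then have "a \<otimes> t \<in> a <# U"
    using lcos_self[of "a \<otimes> t" U] a tG U by (simp add: m_comm)
  then obtain u where "u \<in> U" "a \<otimes> t = a \<otimes> u" by (auto simp: l_coset_def)
  then show "t \<in> U" using a tG U subgroup.subset using Units_l_cancel[of a t u] by (auto simp: subset_iff)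
qed

text \<open>
  An equivariant map is determined by the image \<open>D\<close> of the coset \<open>T\<close>. Every \<open>D\<close> occurs: since
  \<open>T <#> D = D\<close>, multiplication of cosets by \<open>D\<close> is a map that sends \<open>T\<close> to \<open>D\<close>.
\<close>

lemma bij_betw_G_maps:
  assumes T: "subgroup T G" and U: "subgroup U G" and TU: "T \<subseteq> U"
  shows "bij_betw (\<lambda>f. f T) (G_maps G T U) (lcosets U)"
proof (rule bij_betwI')
  fix f f' assume f: "f \<in> G_maps G T U" "f' \<in> G_maps G T U"
  show "f T = f' T \<longleftrightarrow> f = f'"
  proof
    assume eq: "f T = f' T"
    have "f A = f' A" if A: "A \<in> lcosets T" for A
    proof -
      obtain g where "g \<in> carrier G" "A = g <# T" using A by (auto simp: LCOSETS_def)
      then show ?thesis using G_map_apply[OF f(1) T] G_map_apply[OF f(2) T] eq by simp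
    qed
    moreover have "f \<in> extensional (lcosets T)" "f' \<in> extensional (lcosets T)"
      using f by (auto simp: G_maps_def PiE_def)
    ultimately show "f = f'" by (intro extensionalityI)
  qed simp
next
  fix f assume "f \<in> G_maps G T U"
  then show "f T \<in> lcosets U" using lcosets_self[OF T] by (auto simp: G_maps_def)
next
  fix D assume D: "D \<in> lcosets U"
  then obtain a where a: "a \<in> carrier G" "D = a <# U" by (auto simp: LCOSETS_def)
  have DG: "D \<subseteq> carrier G" using a U by (simp add: l_coset_subset_G subgroup.subset)
  have TG: "T \<subseteq> carrier G" using T subgroup.subset by blast
  have TUU: "T <#> U = U"
    using TU subgroup.one_closed[OF T] subgroup.m_closed[OF U] subgroup.subset[OF U]
    by (force simp: set_mult_def subset_iff)
  have TD: "T <#> D = D"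
  proof -
    have "D = U #> a" using a U subgroup.subset[OF U] by (auto simp: l_coset_def r_coset_def m_comm subset_iff)
    then show ?thesis using a U TG TUU by (simp add: setmult_rcos_assoc subgroup.subset)
  qed
  have smul: "(g <# A) <#> D = g <# (A <#> D)" if "g \<in> carrier G" "A \<subseteq> carrier G" for g A
    using that DG by (simp add: l_coset_eq_set_mult set_mult_assoc)
  have sub: "A \<subseteq> carrier G" if "A \<in> lcosets T" for A
    using that T by (metis subgroup.lcosets_carrier is_group)
  let ?f = "\<lambda>A\<in>lcosets T. A <#> D"
  have "?f \<in> G_maps G T U"
  proof -
    have "A <#> D \<in> lcosets U" if A: "A \<in> lcosets T" for A
    proof -
      obtain g where g: "g \<in> carrier G" "A = g <# T" using A by (auto simp: LCOSETS_def)
      then have "A <#> D = g <# D" using smul TG TD by simp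
      also have "\<dots> = (g \<otimes> a) <# U" using a g U by (simp add: lcos_m_assoc subgroup.subset)
      finally show ?thesis using a g by (auto simp: LCOSETS_def)
    qed
    moreover have "g <# A \<in> lcosets T" if "g \<in> carrier G" "A \<in> lcosets T" for g A
      using that TG by (auto simp: LCOSETS_def lcos_m_assoc)
    ultimately show ?thesis
      using sub smul by (auto simp: G_maps_def)
  qed
  moreover have "D = ?f T" using TD lcosets_self[OF T] by simp
  ultimately show "\<exists>f\<in>G_maps G T U. D = f T" by blast
qed

lemma G_set_le_iff:
  assumes "subgroup T G" "subgroup U G"
  shows "G_set_le G U T \<longleftrightarrow> T \<subseteq> U"
proof
  show "T \<subseteq> U" if "G_set_le G U T"
    using that G_maps_subset assms by (auto simp: G_set_le_def)
  assume "T \<subseteq> U"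
  then show "G_set_le G U T"
    using bij_betw_G_maps[OF assms] lcosets_self[OF assms(2)]
    by (auto simp: G_set_le_def bij_betw_def)
qed

lemma card_G_maps:
  assumes "subgroup T G" "subgroup U G" "T \<subseteq> U"
  shows "card (G_maps G T U) = index U"
  using bij_betw_same_card[OF bij_betw_G_maps[OF assms]] assms
  by (simp add: lcosets_eq_rcosets index_def)

end

section \<open>Witt polynomials and the congruences of Dwork\<close>

text \<open>
  The properties of an abelian pro-\<open>p\<close> group on which its Witt-Burnside rings rest; compactness takes the
  form that open subgroups have finite index.
\<close>

locale abelian_pro_p = comm_group G for G (structure) +
  fixes \<tau> :: "'a topology" and p :: nat
  assumes prime_p: "prime p"
    and carrier_open: "openin \<tau> (carrier G)"
    and open_above: "H \<in> open_subgroups G \<tau> \<Longrightarrow> subgroup K G \<Longrightarrow> H \<subseteq> K \<Longrightarrow> openin \<tau> K"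
    and index_prime_power: "H \<in> open_subgroups G \<tau> \<Longrightarrow> \<exists>n. index H = p ^ n"
begin

abbreviation "\<O> \<equiv> open_subgroups G \<tau>"

definition above :: "'a set \<Rightarrow> 'a set set" where
  "above T = {K \<in> \<O>. T \<subseteq> K}"

lemma open_subgroupD: "H \<in> \<O> \<Longrightarrow> subgroup H G"
  by (simp add: open_subgroups_def)

lemma carrier_mem: "carrier G \<in> \<O>"
  by (simp add: open_subgroups_def carrier_open subgroup_self)

lemma aboveI: "T \<in> \<O> \<Longrightarrow> subgroup K G \<Longrightarrow> T \<subseteq> K \<Longrightarrow> K \<in> above T"
  using open_above[of T K] by (simp add: above_def open_subgroups_def)

lemma aboveD: "K \<in> above T \<Longrightarrow> K \<in> \<O>" "K \<in> above T \<Longrightarrow> T \<subseteq> K" "K \<in> above T \<Longrightarrow> subgroup K G"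
  by (auto simp: above_def open_subgroupD)

lemma above_self: "T \<in> \<O> \<Longrightarrow> T \<in> above T"
  by (simp add: above_def)

lemma above_mono: "K \<in> above T \<Longrightarrow> L \<in> above K \<Longrightarrow> L \<in> above T"
  by (auto simp: above_def)

lemma p_gt_1: "p > 1"
  using prime_p prime_gt_1_nat by blast

lemma index_pos: "H \<in> \<O> \<Longrightarrow> index H > 0"
  using index_prime_power p_gt_1 by fastforce

lemma finite_rcosets: "H \<in> \<O> \<Longrightarrow> finite (rcosets H)"
  using index_pos[of H] card_ge_0_finite by (auto simp: index_def)

lemma finite_above: "T \<in> \<O> \<Longrightarrow> finite (above T)"
  by (rule finite_subset[OF _ finite_subgroups_above[of T]])
     (auto simp: open_subgroupD finite_rcosets above_def)

lemma index_above:
  assumes "T \<in> \<O>" "K \<in> above T"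
  shows "index T = index K * card (cosets_within T K)"
    and "index T div index K = card (cosets_within T K)"
    and "card (cosets_within T K) > 0"
proof -
  show *: "index T = index K * card (cosets_within T K)"
    using assms by (intro index_mult) (auto simp: open_subgroupD aboveD)
  then show "index T div index K = card (cosets_within T K)"
    using index_pos[of K] assms aboveD by simp
  show "card (cosets_within T K) > 0"
    using * index_pos[OF assms(1)] by (metis mult_0_right not_gr_zero)
qed

lemma index_dvd: "T \<in> \<O> \<Longrightarrow> K \<in> above T \<Longrightarrow> index K dvd index T"
  using index_above(1)[of T K] by simp

lemma index_less:
  assumes "T \<in> \<O>" "K \<in> above T" "K \<noteq> T"
  shows "index K < index T"
proof -
  have "index K \<noteq> index T"
    using index_antisym[of T K] assms index_pos open_subgroupD aboveD by fastforce
  moreover have "index K dvd index T" using index_above(1)[OF assms(1,2)] by simp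
  ultimately show ?thesis
    using index_pos[OF assms(1)] by (metis dvd_imp_le le_neq_implies_less)
qed

lemma wf_above: "wf {(K, T). T \<in> \<O> \<and> K \<in> above T \<and> K \<noteq> T}"
  by (rule wf_subset[OF wf_measure[of index]]) (auto intro!: index_less)

text \<open>
  The value of the \<open>T\<close>-th Witt polynomial at \<open>x\<close>, traditionally called a ghost component.
\<close>

definition ghost :: "'a set \<Rightarrow> ('a set \<Rightarrow> 'c::comm_ring_1) \<Rightarrow> 'c" where
  "ghost T x = (\<Sum>K\<in>above T. of_nat (index K) * x K ^ (index T div index K))"

lemma witt_poly_eq_ghost:
  assumes T: "T \<in> \<O>"
  shows "witt_poly G \<tau> T x = ghost T x"
proof -
  have "{U \<in> \<O>. G_set_le G U T} = above T"
    using T by (auto simp: above_def G_set_le_iff open_subgroupD)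
  then show ?thesis
    unfolding witt_poly_def ghost_def using T
    by (intro sum.cong)
       (auto simp: above_def card_G_maps G_set_card_eq_index open_subgroupD)
qed

lemma ghost_cong: "(\<And>K. K \<in> above T \<Longrightarrow> x K = y K) \<Longrightarrow> ghost T x = ghost T y"
  by (simp add: ghost_def)

lemma ghost_hom:
  assumes "ring_1_hom h"
  shows "h (ghost T x) = ghost T (\<lambda>K. h (x K))"
proof -
  interpret ring_1_hom h by fact
  show ?thesis by (simp add: ghost_def hom_sum hom_mult hom_power hom_of_nat)
qed

lemma ghost_leading:
  assumes "T \<in> \<O>"
  shows "ghost T x = of_nat (index T) * x T
    + (\<Sum>K\<in>above T - {T}. of_nat (index K) * x K ^ (index T div index K))"
  unfolding ghost_def
  using assms index_pos[OF assms] by (subst sum.remove[OF finite_above above_self]) auto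

text \<open>
  The component \<open>ghost T x\<close> is \<open>index T * x T\<close> plus terms that involve the coordinates at strictly
  larger subgroups only, so the coordinates can be recovered by recursion on the index.
\<close>

lemma ghost_inj:
  assumes tf: "nat_torsion_free TYPE('c::comm_ring_1)"
    and T: "T \<in> \<O>" and eq: "\<And>K. K \<in> above T \<Longrightarrow> ghost K x = ghost K (y :: 'a set \<Rightarrow> 'c)"
  shows "x T = y T"
  using T eq
proof (induction T rule: wf_induct_rule[OF wf_above])
  case (1 T)
  have "x K = y K" if "K \<in> above T - {T}" for K
    using that 1 by (intro 1(1)) (auto intro: above_mono dest: aboveD)
  then have "of_nat (index T) * x T = of_nat (index T) * y T"
    using 1(3)[OF above_self[OF 1(2)]] by (simp add: ghost_leading[OF 1(2)])
  then have "of_nat (index T) * (x T - y T) = 0"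
    by (simp add: algebra_simps)
  then show ?case
    using tf index_pos[OF 1(2)] unfolding nat_torsion_free_def by (metis right_minus_eq)
qed

text \<open>
  For \<open>\<phi> = id\<close> this is one of the congruences that characterize the image of the Burnside ring under
  the mark homomorphism: by orbit counting on a set with an action of \<open>G/H\<close>, the numbers of fixed points
  of the elements of \<open>G/H\<close> add up to a multiple of \<open>[G:H]\<close>.
  The exponent \<open>multiplicity p (ord C)\<close> is the \<open>e\<close> with \<open>ord C = p ^ e\<close>.
\<close>

definition dwork_cong :: "('c::comm_ring_1 \<Rightarrow> 'c) \<Rightarrow> ('a set \<Rightarrow> 'c) \<Rightarrow> 'a set \<Rightarrow> bool" where
  "dwork_cong \<phi> w H \<longleftrightarrow> of_nat (index H) dvd
     (\<Sum>C\<in>rcosets H. (\<phi> ^^ multiplicity p (group.ord (G Mod H) C)) (w (cyclic_over H C)))"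

lemma cyclic_over_above: "H \<in> \<O> \<Longrightarrow> C \<in> rcosets H \<Longrightarrow> cyclic_over H C \<in> above H"
  using cyclic_over(1,2)[of H C] by (intro aboveI) (auto simp: open_subgroupD)

lemma dwork_cong_cong:
  assumes "H \<in> \<O>" "\<And>K. K \<in> above H \<Longrightarrow> w K = w' K"
  shows "dwork_cong \<phi> w H = dwork_cong \<phi> w' H"
  using assms by (simp add: dwork_cong_def cyclic_over_above cong: sum.cong)

context
  fixes \<phi> :: "'c::comm_ring_1 \<Rightarrow> 'c"
  assumes frob: "frobenius_lift \<phi> p"
begin

interpretation frobenius_lift \<phi> p by (rule frob)

lemma dwork_cong_zero: "dwork_cong \<phi> (\<lambda>_. 0) H"
  using ring_1_hom.hom_zero[OF funpow_hom] by (simp add: dwork_cong_def)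

lemma dwork_cong_add:
  "dwork_cong \<phi> w H \<Longrightarrow> dwork_cong \<phi> w' H \<Longrightarrow> dwork_cong \<phi> (\<lambda>K. w K + w' K) H"
  by (simp add: dwork_cong_def ring_1_hom.hom_add[OF funpow_hom] sum.distrib)

lemma dwork_cong_uminus:
  "dwork_cong \<phi> w H \<Longrightarrow> dwork_cong \<phi> (\<lambda>K. - w K) H"
  by (simp add: dwork_cong_def ring_1_hom.hom_uminus[OF funpow_hom] sum_negf)

lemma dwork_cong_sum:
  "(\<And>i. i \<in> I \<Longrightarrow> dwork_cong \<phi> (w i) H) \<Longrightarrow> dwork_cong \<phi> (\<lambda>K. \<Sum>i\<in>I. w i K) H"
  by (induction I rule: infinite_finite_induct) (auto simp: dwork_cong_zero dwork_cong_add)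

text \<open>
  These families are the building blocks of all values of Witt polynomials and of their products. The
  cosets that contribute are those in the finite \<open>p\<close>-group \<open>L/H\<close>, so \<open>sum_frobenius_powers_dvd\<close> gives
  the factor \<open>[L:H]\<close>, and the coefficient gives the remaining factor \<open>[G:L]\<close>.
\<close>

lemma dwork_cong_induced_monomial:
  assumes H: "H \<in> \<O>" and L: "L \<in> above H" and c: "index L dvd c"
  shows "dwork_cong \<phi> (\<lambda>K. if K \<subseteq> L then of_nat c * z ^ (index K div index L) else 0) H"
proof -
  have Hs: "subgroup H G" and Ls: "subgroup L G" "H \<subseteq> L" "L \<in> \<O>"
    using H L by (auto simp: open_subgroupD aboveD)
  define q where "q = card (cosets_within H L)"
  have q: "index H = index L * q" using index_above(1)[OF H L] by (simp add: q_def)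
  obtain n where "index H = p ^ n" using index_prime_power H by blast
  then have "q dvd p ^ n" using q by (metis dvd_triv_right)
  then obtain N where N: "q = p ^ N" using divides_primepow_nat[OF prime_p] by blast
  define e where "e C = multiplicity p (group.ord (G Mod H) C)" for C
  have hom: "ring_1_hom (\<phi> ^^ e C)" for C by (rule funpow_hom)
  have expo: "index (cyclic_over H C) div index L = q div group.ord (G Mod H) C"
    if C: "C \<in> cosets_within H L" for C
  proof -
    have CH: "C \<in> rcosets H" "C \<subseteq> L" using C by (auto simp: cosets_within_def)
    have A: "cyclic_over H C \<in> above H" using cyclic_over_above[OF H CH(1)] .
    have "L \<in> above (cyclic_over H C)"
      using cyclic_over(4)[OF Hs CH(1) Ls(1,2)] CH(2) Ls by (simp add: above_def)
    then obtain m where m: "index (cyclic_over H C) = index L * m"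
      using index_above(1) aboveD(1)[OF A] by blast
    then have "q = m * group.ord (G Mod H) C"
      using index_cyclic_over[OF Hs CH(1)] q index_pos[OF Ls(3)] by (simp add: mult.assoc)
    moreover have "q > 0" using N p_gt_1 by simp
    ultimately show ?thesis
      using m index_pos[OF Ls(3)] by auto
  qed
  have "(\<Sum>C\<in>rcosets H. (\<phi> ^^ e C) (if cyclic_over H C \<subseteq> L
        then of_nat c * z ^ (index (cyclic_over H C) div index L) else 0))
    = (\<Sum>C\<in>cosets_within H L. of_nat c * (\<phi> ^^ e C) z ^ (q div group.ord (G Mod H) C))"
  proof (rule sum.mono_neutral_cong_right)
    show "finite (rcosets H)" using H by (rule finite_rcosets)
  next
    show "cosets_within H L \<subseteq> rcosets H" by (auto simp: cosets_within_def)
  next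
    show "\<forall>C\<in>rcosets H - cosets_within H L. (\<phi> ^^ e C) (if cyclic_over H C \<subseteq> L
        then of_nat c * z ^ (index (cyclic_over H C) div index L) else 0) = 0"
      using cyclic_over(4)[OF Hs _ Ls(1,2)]
      by (auto simp: cosets_within_def ring_1_hom.hom_zero[OF hom])
  next
    fix C assume C: "C \<in> cosets_within H L"
    then have "cyclic_over H C \<subseteq> L"
      using cyclic_over(4)[OF Hs _ Ls(1,2)] by (auto simp: cosets_within_def)
    then show "(\<phi> ^^ e C) (if cyclic_over H C \<subseteq> L
        then of_nat c * z ^ (index (cyclic_over H C) div index L) else 0)
      = of_nat c * (\<phi> ^^ e C) z ^ (q div group.ord (G Mod H) C)"
      by (simp add: expo[OF C] ring_1_hom.hom_mult[OF hom] ring_1_hom.hom_power[OF hom]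
          ring_1_hom.hom_of_nat[OF hom])
  qed
  also have "\<dots> = of_nat c * (\<Sum>C\<in>cosets_within H L. (\<phi> ^^ e C) z ^ (q div group.ord (G Mod H) C))"
    by (simp add: sum_distrib_left)
  also have "of_nat (index L) * of_nat q dvd \<dots>"
    using sum_frobenius_powers_dvd[OF comm_group_Mod[OF Hs] cosets_within_subgroup[OF Hs Ls(1,2)], of N z] c
    by (intro mult_dvd_mono of_nat_dvd_of_nat) (auto simp: q_def[symmetric] N e_def)
  finally show ?thesis
    by (simp add: dwork_cong_def e_def q)
qed

lemma ghost_eq_sum_above:
  assumes "K \<in> above H"
  shows "finite (above H) \<Longrightarrow> ghost K x
    = (\<Sum>L\<in>above H. if K \<subseteq> L then of_nat (index L) * x L ^ (index K div index L) else 0)"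
  unfolding ghost_def
  by (rule sum.mono_neutral_cong_left) (use assms in \<open>auto simp: above_def\<close>)

lemma dwork_cong_ghost:
  assumes H: "H \<in> \<O>"
  shows "dwork_cong \<phi> (\<lambda>K. ghost K x) H"
proof -
  let ?w = "\<lambda>K. \<Sum>L\<in>above H. if K \<subseteq> L
      then of_nat (index L) * x L ^ (index K div index L) else 0"
  have "dwork_cong \<phi> ?w H"
    by (intro dwork_cong_sum dwork_cong_induced_monomial H) auto
  moreover have "dwork_cong \<phi> (\<lambda>K. ghost K x) H = dwork_cong \<phi> ?w H"
    by (intro dwork_cong_cong H ghost_eq_sum_above finite_above)
  ultimately show ?thesis by simp
qed

text \<open>
  All indices are powers of \<open>p\<close>, so the inequality \<open>index_Int_le\<close> is already a divisibility.
\<close>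

lemma index_Int_dvd:
  assumes "H \<in> \<O>" "L \<in> above H" "L' \<in> above H"
  shows "L \<inter> L' \<in> above H" "index (L \<inter> L') dvd index L * index L'"
proof -
  show LL: "L \<inter> L' \<in> above H"
    using assms aboveD by (intro aboveI subgroups_Inter_pair) auto
  obtain i j k where ijk: "index L = p ^ i" "index L' = p ^ j" "index (L \<inter> L') = p ^ k"
    using assms LL aboveD(1) index_prime_power by metis
  have "index (L \<inter> L') \<le> index L * index L'"
    using assms aboveD by (intro index_Int_le finite_rcosets) auto
  then have "k \<le> i + j"
    using p_gt_1 by (simp add: ijk flip: power_add)
  then show "index (L \<inter> L') dvd index L * index L'"
    by (simp add: ijk le_imp_power_dvd flip: power_add)
qed

text \<open>
  Expanding the product gives one term for each pair \<open>L\<close>, \<open>L'\<close>. It is nonzero at \<open>K\<close> only for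
  \<open>K \<subseteq> L \<inter> L'\<close>, and there it is a constant times a power \<open>z ^ [L \<inter> L' : K]\<close>. So it is again an
  induced monomial, and its constant \<open>[G:L] * [G:L']\<close> is a multiple of \<open>[G : L \<inter> L']\<close>.
\<close>

lemma dwork_cong_ghost_mult:
  assumes H: "H \<in> \<O>"
  shows "dwork_cong \<phi> (\<lambda>K. ghost K x * ghost K y) H"
proof -
  \<comment> \<open>\<open>z L L'\<close> is the product of the two coordinates, each raised to the power that makes it a monomial at \<open>L \<inter> L'\<close>.\<close>
  define z where "z L L' = x L ^ (index (L \<inter> L') div index L) * y L' ^ (index (L \<inter> L') div index L')" for L L'
  let ?w = "\<lambda>K. \<Sum>L\<in>above H. \<Sum>L'\<in>above H. if K \<subseteq> L \<inter> L'
      then of_nat (index L * index L') * z L L' ^ (index K div index (L \<inter> L')) else 0"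
  have "dwork_cong \<phi> ?w H"
    using index_Int_dvd[OF H] by (intro dwork_cong_sum dwork_cong_induced_monomial H) auto
  moreover have "ghost K x * ghost K y = ?w K"
    if K: "K \<in> above H" for K
  proof -
    have expo: "index K div index L = (index (L \<inter> L') div index L) * (index K div index (L \<inter> L'))"
      "index K div index L' = (index (L \<inter> L') div index L') * (index K div index (L \<inter> L'))"
      if "L \<in> above H" "L' \<in> above H" "K \<subseteq> L" "K \<subseteq> L'" for L L'
    proof -
      have LL: "L \<inter> L' \<in> above H" using index_Int_dvd[OF H] that by blast
      have "index (L \<inter> L') dvd index K" "index L dvd index (L \<inter> L')" "index L' dvd index (L \<inter> L')"
        using index_dvd[OF aboveD(1)[OF K], of "L \<inter> L'"]
          index_dvd[OF aboveD(1)[OF LL], of L] index_dvd[OF aboveD(1)[OF LL], of L']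
          aboveD(1)[OF LL] aboveD(1)[OF that(1)] aboveD(1)[OF that(2)] that(3,4)
        by (simp_all add: above_def)
      then show "index K div index L = (index (L \<inter> L') div index L) * (index K div index (L \<inter> L'))"
        "index K div index L' = (index (L \<inter> L') div index L') * (index K div index (L \<inter> L'))"
        using index_pos[OF aboveD(1)[OF LL]] by (simp_all add: div_mult_div_if_dvd)
    qed
    show ?thesis
      unfolding ghost_eq_sum_above[OF K finite_above[OF H]] sum_product
    proof (intro sum.cong refl)
      fix L L' assume L: "L \<in> above H" "L' \<in> above H"
      show "(if K \<subseteq> L then of_nat (index L) * x L ^ (index K div index L) else 0)
          * (if K \<subseteq> L' then of_nat (index L') * y L' ^ (index K div index L') else 0)
        = (if K \<subseteq> L \<inter> L'
           then of_nat (index L * index L') * z L L' ^ (index K div index (L \<inter> L')) else 0)"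
      proof (cases "K \<subseteq> L \<and> K \<subseteq> L'")
        case True
        define j where "j = index K div index (L \<inter> L')"
        show ?thesis
          using True expo[OF L] unfolding z_def j_def[symmetric]
          by (simp add: power_mult_distrib mult_ac flip: power_mult)
      qed auto
    qed
  qed
  then have "dwork_cong \<phi> (\<lambda>K. ghost K x * ghost K y) H = dwork_cong \<phi> ?w H"
    by (intro dwork_cong_cong H)
  ultimately show ?thesis by simp
qed

text \<open>
  The coordinate at \<open>H\<close> is constructed from those at larger subgroups. With value 0 at \<open>H\<close> (this is \<open>f'\<close>),
  they give a point whose Witt polynomials agree with \<open>w\<close> strictly above \<open>H\<close>. Both families
  satisfy the congruence at \<open>H\<close>; in the difference of the two sums only the term of the trivial coset
  survives, so \<open>index H\<close> divides \<open>w H - ghost H f'\<close>, and the quotient is the coordinate sought.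
\<close>

lemma dwork:
  assumes w: "\<And>H. H \<in> \<O> \<Longrightarrow> dwork_cong \<phi> w H"
  shows "\<exists>x. \<forall>H\<in>\<O>. ghost H x = w H"
proof -
  let ?P = "\<lambda>f H r. H \<in> \<O> \<longrightarrow> of_nat (index H) * r
     + (\<Sum>K\<in>above H - {H}. of_nat (index K) * f K ^ (index H div index K)) = w H"
  have "\<exists>f. \<forall>H. ?P f H (f H)"
  proof (rule dependent_wf_choice[OF wf_above])
    fix f g :: "'a set \<Rightarrow> 'c" and H r
    assume "\<And>K. (K, H) \<in> {(K, T). T \<in> \<O> \<and> K \<in> above T \<and> K \<noteq> T} \<Longrightarrow> f K = g K"
    then have "f K = g K" if "H \<in> \<O>" "K \<in> above H - {H}" for K
      using that by auto
    then have "(\<Sum>K\<in>above H - {H}. of_nat (index K) * f K ^ (index H div index K))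
        = (\<Sum>K\<in>above H - {H}. of_nat (index K) * g K ^ (index H div index K))" if "H \<in> \<O>"
      using that by (intro sum.cong) auto
    then show "?P f H r = ?P g H r" by auto
  next
    fix H f assume IH: "\<And>K. (K, H) \<in> {(K, T). T \<in> \<O> \<and> K \<in> above T \<and> K \<noteq> T} \<Longrightarrow> ?P f K (f K)"
    show "\<exists>r. ?P f H r"
    proof (cases "H \<in> \<O>")
      case H: True
      define f' where "f' = f(H := 0)"
      have ghf: "ghost K f' = w K" if K: "K \<in> above H" "K \<noteq> H" for K
      proof -
        have "ghost K f' = ghost K f"
          using K by (intro ghost_cong) (auto simp: f'_def above_def)
        then show ?thesis
          using IH[of K] K H aboveD(1)[OF K(1)] ghost_leading[of K f] by auto
      qed
      have Hs: "subgroup H G" using H open_subgroupD by blast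
      interpret Q: comm_group "G Mod H" using Hs by (rule comm_group_Mod)
      have "dwork_cong \<phi> (\<lambda>K. w K - ghost K f') H"
        using dwork_cong_add[OF w[OF H] dwork_cong_uminus[OF dwork_cong_ghost[OF H, of f']]] by simp
      moreover have "(\<Sum>C\<in>rcosets H. (\<phi> ^^ multiplicity p (Q.ord C)) (w (cyclic_over H C) - ghost (cyclic_over H C) f'))
        = (\<Sum>C\<in>{H}. (\<phi> ^^ multiplicity p (Q.ord C)) (w (cyclic_over H C) - ghost (cyclic_over H C) f'))"
      proof (rule sum.mono_neutral_right)
        show "\<forall>C\<in>rcosets H - {H}. (\<phi> ^^ multiplicity p (Q.ord C)) (w (cyclic_over H C) - ghost (cyclic_over H C) f') = 0"
        proof
          fix C assume C: "C \<in> rcosets H - {H}"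
          then have "cyclic_over H C \<noteq> H" using cyclic_over_eq_self[OF Hs, of C] by blast
          then have "ghost (cyclic_over H C) f' = w (cyclic_over H C)"
            using C by (intro ghf cyclic_over_above H) auto
          then show "(\<phi> ^^ multiplicity p (Q.ord C)) (w (cyclic_over H C) - ghost (cyclic_over H C) f') = 0"
            by (simp add: ring_1_hom.hom_zero[OF funpow_hom])
        qed
      qed (use H Hs rcosets_one finite_rcosets in auto)
      moreover have "Q.ord H = 1" using Q.ord_id by simp
      ultimately have "of_nat (index H) dvd w H - ghost H f'"
        by (simp add: dwork_cong_def cyclic_over_self[OF Hs])
      then obtain r where r: "w H - ghost H f' = of_nat (index H) * r" by (rule dvdE)
      have "ghost H f' = (\<Sum>K\<in>above H - {H}. of_nat (index K) * f K ^ (index H div index K))"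
        using ghost_leading[OF H, of f'] by (simp add: f'_def)
      then have "?P f H r" using r by (simp add: algebra_simps)
      then show ?thesis ..
    qed simp
  qed
  then obtain f where "\<And>H. ?P f H (f H)" by blast
  then have "\<forall>H\<in>\<O>. ghost H f = w H" by (simp add: ghost_leading)
  then show ?thesis by blast
qed

end

end

section \<open>The ring axioms\<close>

lemma hom_mpoly_eval:
  assumes "ring_1_hom h"
  shows "h (mpoly_eval a P) = mpoly_eval (\<lambda>v. h (a v)) P"
proof -
  interpret ring_1_hom h by fact
  show ?thesis
    by (simp add: mpoly_eval_def hom_sum hom_mult hom_prod hom_power hom_of_int)
qed

lemma hom_case_sum: "h (case_sum a b v) = case_sum (\<lambda>K. h (a K)) (\<lambda>K. h (b K)) v"
  by (cases v) auto

lemma mpoly_eval_zero_one [simp]: "mpoly_eval a 0 = 0" "mpoly_eval a 1 = 1"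
  using ring_1_hom.hom_one[OF mpoly_eval_hom] by (auto simp: mpoly_eval_zero)

context abelian_pro_p
begin

lemma ghost_surj_polys:
  fixes w :: "'a set \<Rightarrow> 'v int_mpoly"
  assumes "\<And>\<phi> H. frobenius_lift \<phi> p \<Longrightarrow> H \<in> \<O> \<Longrightarrow> dwork_cong \<phi> w H"
  shows "\<exists>x. \<forall>H\<in>\<O>. ghost H x = w H"
  using frobenius_lift_int_mpoly[OF prime_p] assms by (intro dwork)

lemma ghost_witt_sum_polys:
  assumes "T \<in> \<O>"
  shows "ghost T (witt_sum_polys G \<tau>) = ghost T (\<lambda>U. mpoly_var (Inl U)) + ghost T (\<lambda>U. mpoly_var (Inr U))"
proof -
  have "\<exists>S :: 'a set \<Rightarrow> ('a set + 'a set) int_mpoly. \<forall>T\<in>\<O>. ghost T S = ghost T (\<lambda>U. mpoly_var (Inl U)) + ghost T (\<lambda>U. mpoly_var (Inr U))"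
    by (intro ghost_surj_polys dwork_cong_add dwork_cong_ghost)
  then obtain S :: "'a set \<Rightarrow> ('a set + 'a set) int_mpoly"
    where "\<forall>T\<in>\<O>. ghost T S = ghost T (\<lambda>U. mpoly_var (Inl U)) + ghost T (\<lambda>U. mpoly_var (Inr U))"
    by blast
  then have "\<forall>T\<in>\<O>. witt_poly G \<tau> T (\<lambda>U. mpoly_var (Inl U))
      + witt_poly G \<tau> T (\<lambda>U. mpoly_var (Inr U)) = witt_poly G \<tau> T S"
    by (simp add: witt_poly_eq_ghost)
  then have "\<exists>S::'a set \<Rightarrow> ('a set + 'a set) int_mpoly. \<forall>T\<in>\<O>. witt_poly G \<tau> T (\<lambda>U. mpoly_var (Inl U))
      + witt_poly G \<tau> T (\<lambda>U. mpoly_var (Inr U)) = witt_poly G \<tau> T S"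
    by blast
  then have "\<forall>T\<in>\<O>. witt_poly G \<tau> T (\<lambda>U. mpoly_var (Inl U))
      + witt_poly G \<tau> T (\<lambda>U. mpoly_var (Inr U)) = witt_poly G \<tau> T (witt_sum_polys G \<tau>)"
    unfolding witt_sum_polys_def by (rule someI_ex)
  then show ?thesis
    using assms by (simp add: witt_poly_eq_ghost)
qed

lemma ghost_witt_prod_polys:
  assumes "T \<in> \<O>"
  shows "ghost T (witt_prod_polys G \<tau>) = ghost T (\<lambda>U. mpoly_var (Inl U)) * ghost T (\<lambda>U. mpoly_var (Inr U))"
proof -
  have "\<exists>M :: 'a set \<Rightarrow> ('a set + 'a set) int_mpoly. \<forall>T\<in>\<O>. ghost T M = ghost T (\<lambda>U. mpoly_var (Inl U)) * ghost T (\<lambda>U. mpoly_var (Inr U))"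
    by (intro ghost_surj_polys dwork_cong_ghost_mult)
  then obtain M :: "'a set \<Rightarrow> ('a set + 'a set) int_mpoly"
    where "\<forall>T\<in>\<O>. ghost T M = ghost T (\<lambda>U. mpoly_var (Inl U)) * ghost T (\<lambda>U. mpoly_var (Inr U))"
    by blast
  then have "\<forall>T\<in>\<O>. witt_poly G \<tau> T (\<lambda>U. mpoly_var (Inl U))
      * witt_poly G \<tau> T (\<lambda>U. mpoly_var (Inr U)) = witt_poly G \<tau> T M"
    by (simp add: witt_poly_eq_ghost)
  then have "\<exists>M::'a set \<Rightarrow> ('a set + 'a set) int_mpoly. \<forall>T\<in>\<O>. witt_poly G \<tau> T (\<lambda>U. mpoly_var (Inl U))
      * witt_poly G \<tau> T (\<lambda>U. mpoly_var (Inr U)) = witt_poly G \<tau> T M"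
    by blast
  then have "\<forall>T\<in>\<O>. witt_poly G \<tau> T (\<lambda>U. mpoly_var (Inl U))
      * witt_poly G \<tau> T (\<lambda>U. mpoly_var (Inr U)) = witt_poly G \<tau> T (witt_prod_polys G \<tau>)"
    unfolding witt_prod_polys_def by (rule someI_ex)
  then show ?thesis
    using assms by (simp add: witt_poly_eq_ghost)
qed

lemma ex_witt_neg_polys:
  "\<exists>N :: 'a set \<Rightarrow> 'a set int_mpoly. \<forall>T\<in>\<O>. ghost T N = - ghost T mpoly_var"
  by (intro ghost_surj_polys dwork_cong_uminus dwork_cong_ghost)

text \<open>
  Only the existence of additive inverses is wanted; any polynomials with this property will do.
\<close>

definition witt_neg_polys :: "'a set \<Rightarrow> 'a set int_mpoly" where
  "witt_neg_polys = (SOME N. \<forall>T\<in>\<O>. ghost T N = - ghost T mpoly_var)"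

definition wadd :: "('a set \<Rightarrow> 'c::comm_ring_1) \<Rightarrow> ('a set \<Rightarrow> 'c) \<Rightarrow> 'a set \<Rightarrow> 'c" where
  "wadd a b T = mpoly_eval (case_sum a b) (witt_sum_polys G \<tau> T)"

definition wmul :: "('a set \<Rightarrow> 'c::comm_ring_1) \<Rightarrow> ('a set \<Rightarrow> 'c) \<Rightarrow> 'a set \<Rightarrow> 'c" where
  "wmul a b T = mpoly_eval (case_sum a b) (witt_prod_polys G \<tau> T)"

definition wneg :: "('a set \<Rightarrow> 'c::comm_ring_1) \<Rightarrow> 'a set \<Rightarrow> 'c" where
  "wneg a T = mpoly_eval a (witt_neg_polys T)"

definition wone :: "'a set \<Rightarrow> 'c::comm_ring_1" where
  "wone T = (if T = carrier G then 1 else 0)"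

lemma ghost_mpoly_eval: "ghost T (\<lambda>K. mpoly_eval a (P K)) = mpoly_eval a (ghost T P)"
  by (rule ghost_hom[OF mpoly_eval_hom, symmetric])

lemma ghost_wadd: "T \<in> \<O> \<Longrightarrow> ghost T (wadd a b) = ghost T a + ghost T b"
  using ghost_mpoly_eval[of T "case_sum a b" "witt_sum_polys G \<tau>"]
    ghost_mpoly_eval[of T "case_sum a b" "\<lambda>U. mpoly_var (Inl U)"]
    ghost_mpoly_eval[of T "case_sum a b" "\<lambda>U. mpoly_var (Inr U)"]
  by (simp add: wadd_def[abs_def] ghost_witt_sum_polys mpoly_eval_add)

lemma ghost_wmul: "T \<in> \<O> \<Longrightarrow> ghost T (wmul a b) = ghost T a * ghost T b"
  using ghost_mpoly_eval[of T "case_sum a b" "witt_prod_polys G \<tau>"]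
    ghost_mpoly_eval[of T "case_sum a b" "\<lambda>U. mpoly_var (Inl U)"]
    ghost_mpoly_eval[of T "case_sum a b" "\<lambda>U. mpoly_var (Inr U)"]
  by (simp add: wmul_def[abs_def] ghost_witt_prod_polys mpoly_eval_mult)

lemma ghost_wneg: "T \<in> \<O> \<Longrightarrow> ghost T (wneg a) = - ghost T a"
  using ghost_mpoly_eval[of T a witt_neg_polys] ghost_mpoly_eval[of T a mpoly_var]
    someI_ex[OF ex_witt_neg_polys, folded witt_neg_polys_def]
  by (simp add: wneg_def[abs_def] ring_1_hom.hom_uminus[OF mpoly_eval_hom])

lemma exponent_pos: "T \<in> \<O> \<Longrightarrow> K \<in> above T \<Longrightarrow> index T div index K > 0"
  using index_above(2,3)[of T K] by simp

lemma ghost_zero: "T \<in> \<O> \<Longrightarrow> ghost T (\<lambda>_. 0) = 0"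
  unfolding ghost_def by (intro sum.neutral) (simp add: zero_power[OF exponent_pos])

lemma carrier_above: "T \<in> \<O> \<Longrightarrow> carrier G \<in> above T"
  using carrier_mem open_subgroupD[of T] subgroup.subset[of T G] by (auto simp: above_def)

lemma index_carrier: "index (carrier G) = 1"
proof -
  have "rcosets (carrier G) = {carrier G}"
    using coset_join2[OF _ subgroup_self] by (auto simp: RCOSETS_def)
  then show ?thesis by (simp add: index_def)
qed

lemma ghost_wone:
  assumes "T \<in> \<O>"
  shows "ghost T wone = 1"
proof -
  have "ghost T wone = (\<Sum>K\<in>{carrier G}. of_nat (index K) * wone K ^ (index T div index K))"
    unfolding ghost_def using assms
    by (intro sum.mono_neutral_right finite_above)
       (auto simp: wone_def carrier_above zero_power[OF exponent_pos])
  then show ?thesis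
    by (simp add: wone_def index_carrier)
qed

lemma hom_wadd: "ring_1_hom h \<Longrightarrow> h (wadd a b T) = wadd (\<lambda>K. h (a K)) (\<lambda>K. h (b K)) T"
  by (simp add: wadd_def hom_mpoly_eval hom_case_sum[abs_def])

lemma hom_wmul: "ring_1_hom h \<Longrightarrow> h (wmul a b T) = wmul (\<lambda>K. h (a K)) (\<lambda>K. h (b K)) T"
  by (simp add: wmul_def hom_mpoly_eval hom_case_sum[abs_def])

lemma hom_wneg: "ring_1_hom h \<Longrightarrow> h (wneg a T) = wneg (\<lambda>K. h (a K)) T"
  by (simp add: wneg_def hom_mpoly_eval)

lemma hom_wone: "ring_1_hom h \<Longrightarrow> h (wone T) = wone T"
  by (simp add: wone_def ring_1_hom.hom_one ring_1_hom.hom_zero)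

text \<open>
  The ring axioms are proved for points whose coordinates are independent variables, where \<open>ghost_inj\<close>
  applies, and are then transported to given points by specializing the variables. The family
  \<open>generic i\<close> is the \<open>i\<close>-th such point.
\<close>

abbreviation (input) generic :: "nat \<Rightarrow> 'a set \<Rightarrow> (nat \<times> 'a set) int_mpoly" where
  "generic i K \<equiv> mpoly_var (i, K)"

abbreviation (input) specialize ::
    "('a set \<Rightarrow> 'c) list \<Rightarrow> (nat \<times> 'a set) int_mpoly \<Rightarrow> 'c::comm_ring_1" where
  "specialize as \<equiv> mpoly_eval (\<lambda>(i, K). (as ! i) K)"

lemmas ghost_inj_int_mpoly = ghost_inj[OF nat_torsion_free_int_mpoly]
lemmas ghost_ops = ghost_wadd ghost_wmul ghost_wneg ghost_wone ghost_zero aboveD(1)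
lemmas hom_ops = hom_wadd[OF mpoly_eval_hom] hom_wmul[OF mpoly_eval_hom]
  hom_wneg[OF mpoly_eval_hom] hom_wone[OF mpoly_eval_hom]

lemma wadd_assoc:
  assumes "T \<in> \<O>"
  shows "wadd (wadd a b) c T = wadd a (wadd b c) T"
proof -
  have "wadd (wadd (generic 0) (generic 1)) (generic 2) T = wadd (generic 0) (wadd (generic 1) (generic 2)) T"
    by (rule ghost_inj_int_mpoly[OF assms]) (simp add: ghost_ops add_ac)
  from arg_cong[OF this, of "specialize [a, b, c]"] show ?thesis
    by (simp add: hom_ops)
qed

lemma wadd_commute:
  assumes "T \<in> \<O>"
  shows "wadd a b T = wadd b a T"
proof -
  have "wadd (generic 0) (generic 1) T = wadd (generic 1) (generic 0) T"
    by (rule ghost_inj_int_mpoly[OF assms]) (simp add: ghost_ops add_ac)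
  from arg_cong[OF this, of "specialize [a, b]"] show ?thesis
    by (simp add: hom_ops)
qed

lemma wadd_zero:
  assumes "T \<in> \<O>"
  shows "wadd (\<lambda>_. 0) a T = a T"
proof -
  have "wadd (\<lambda>_. 0) (generic 0) T = generic 0 T"
    by (rule ghost_inj_int_mpoly[OF assms]) (simp add: ghost_ops)
  from arg_cong[OF this, of "specialize [a]"] show ?thesis
    by (simp add: hom_ops)
qed

lemma wadd_wneg:
  assumes "T \<in> \<O>"
  shows "wadd (wneg a) a T = 0"
proof -
  have "wadd (wneg (generic 0)) (generic 0) T = (\<lambda>_. 0) T"
    by (rule ghost_inj_int_mpoly[OF assms]) (simp add: ghost_ops)
  from arg_cong[OF this, of "specialize [a]"] show ?thesis
    by (simp add: hom_ops)
qed

lemma wmul_assoc: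
  assumes "T \<in> \<O>"
  shows "wmul (wmul a b) c T = wmul a (wmul b c) T"
proof -
  have "wmul (wmul (generic 0) (generic 1)) (generic 2) T = wmul (generic 0) (wmul (generic 1) (generic 2)) T"
    by (rule ghost_inj_int_mpoly[OF assms]) (simp add: ghost_ops mult_ac)
  from arg_cong[OF this, of "specialize [a, b, c]"] show ?thesis
    by (simp add: hom_ops)
qed

lemma wmul_commute:
  assumes "T \<in> \<O>"
  shows "wmul a b T = wmul b a T"
proof -
  have "wmul (generic 0) (generic 1) T = wmul (generic 1) (generic 0) T"
    by (rule ghost_inj_int_mpoly[OF assms]) (simp add: ghost_ops mult_ac)
  from arg_cong[OF this, of "specialize [a, b]"] show ?thesis
    by (simp add: hom_ops)
qed

lemma wmul_one:
  assumes "T \<in> \<O>"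
  shows "wmul wone a T = a T"
proof -
  have "wmul wone (generic 0) T = generic 0 T"
    by (rule ghost_inj_int_mpoly[OF assms]) (simp add: ghost_ops)
  from arg_cong[OF this, of "specialize [a]"] show ?thesis
    by (simp add: hom_ops)
qed

lemma wmul_wadd_distrib:
  assumes "T \<in> \<O>"
  shows "wmul (wadd a b) c T = wadd (wmul a c) (wmul b c) T"
proof -
  have "wmul (wadd (generic 0) (generic 1)) (generic 2) T
      = wadd (wmul (generic 0) (generic 2)) (wmul (generic 1) (generic 2)) T"
    by (rule ghost_inj_int_mpoly[OF assms]) (simp add: ghost_ops algebra_simps)
  from arg_cong[OF this, of "specialize [a, b, c]"] show ?thesis
    by (simp add: hom_ops)
qed

text \<open>
  The coordinate at \<open>T\<close> of a sum or product depends on the coordinates above \<open>T\<close> only. The generic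
  form compares points that are given by one set of variables above \<open>T\<close> and by a second set elsewhere.
\<close>

lemma
  assumes T: "T \<in> \<O>" and eq: "\<And>K. K \<in> above T \<Longrightarrow> a K = a' K" "\<And>K. K \<in> above T \<Longrightarrow> b K = b' K"
  shows wadd_local: "wadd a b T = wadd a' b' T" and wmul_local: "wmul a b T = wmul a' b' T"
proof -
  let ?g = "\<lambda>i j K. if K \<in> above T then generic i K else generic j K"
  have glue: "(\<lambda>K. if K \<in> above T then a K else a' K) = a'"
      "(\<lambda>K. if K \<in> above T then b K else b' K) = b'"
    using eq by auto
  have *: "ghost K (?g i j) = ghost K (generic i)" if "K \<in> above T" for i j K
    using that by (intro ghost_cong) (auto simp: above_mono)
  have "wadd (?g 0 2) (?g 1 3) T = wadd (generic 0) (generic 1) T"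
    by (rule ghost_inj_int_mpoly[OF T]) (simp add: ghost_ops *)
  from arg_cong[OF this, of "specialize [a, b, a', b']"]
  show "wadd a b T = wadd a' b' T"
    by (simp add: hom_ops if_distrib[of "specialize _"] glue cong: if_cong)
  have "wmul (?g 0 2) (?g 1 3) T = wmul (generic 0) (generic 1) T"
    by (rule ghost_inj_int_mpoly[OF T]) (simp add: ghost_ops *)
  from arg_cong[OF this, of "specialize [a, b, a', b']"]
  show "wmul a b T = wmul a' b' T"
    by (simp add: hom_ops if_distrib[of "specialize _"] glue cong: if_cong)
qed

end

context abelian_pro_p
begin

lemma witt_burnside_ring_simps:
  fixes a b :: "'a set \<Rightarrow> 'c::comm_ring_1"
  shows "carrier (witt_burnside_ring G \<tau> :: ('a set \<Rightarrow> 'c) ring) = \<O> \<rightarrow>\<^sub>E UNIV"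
    "a \<oplus>\<^bsub>witt_burnside_ring G \<tau>\<^esub> b = restrict (wadd a b) \<O>"
    "a \<otimes>\<^bsub>witt_burnside_ring G \<tau>\<^esub> b = restrict (wmul a b) \<O>"
    "\<one>\<^bsub>(witt_burnside_ring G \<tau> :: ('a set \<Rightarrow> 'c) ring)\<^esub> = restrict wone \<O>"
    "\<zero>\<^bsub>(witt_burnside_ring G \<tau> :: ('a set \<Rightarrow> 'c) ring)\<^esub> = restrict (\<lambda>_. 0) \<O>"
  by (auto simp: witt_burnside_ring_def wadd_def wmul_def wone_def)

lemma restrict_wadd [simp]:
  assumes "T \<in> \<O>"
  shows "wadd (restrict a \<O>) b T = wadd a b T" "wadd a (restrict b \<O>) T = wadd a b T"
  using aboveD(1) by (auto intro!: wadd_local[OF assms])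

lemma restrict_wmul [simp]:
  assumes "T \<in> \<O>"
  shows "wmul (restrict a \<O>) b T = wmul a b T" "wmul a (restrict b \<O>) T = wmul a b T"
  using aboveD(1) by (auto intro!: wmul_local[OF assms])

lemma extensional_eqI:
  assumes "x \<in> \<O> \<rightarrow>\<^sub>E UNIV" "y \<in> \<O> \<rightarrow>\<^sub>E UNIV" "\<And>T. T \<in> \<O> \<Longrightarrow> x T = y T"
  shows "x = y"
  using assms by (rule PiE_ext)

theorem cring_witt_burnside_ring:
  "cring (witt_burnside_ring G \<tau> :: ('a set \<Rightarrow> 'c::comm_ring_1) ring)" (is "cring ?R")
proof (rule cringI)
  show "abelian_group ?R"
  proof (rule abelian_groupI)
    fix a :: "'a set \<Rightarrow> 'c" assume a: "a \<in> carrier ?R"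
    show "\<exists>b\<in>carrier ?R. b \<oplus>\<^bsub>?R\<^esub> a = \<zero>\<^bsub>?R\<^esub>"
      by (rule bexI[of _ "restrict (wneg a) \<O>"])
         (auto simp: witt_burnside_ring_simps wadd_wneg intro!: restrict_ext)
    show "\<zero>\<^bsub>?R\<^esub> \<oplus>\<^bsub>?R\<^esub> a = a"
      using a by (intro extensional_eqI) (auto simp: witt_burnside_ring_simps wadd_zero)
  qed (auto simp: witt_burnside_ring_simps wadd_assoc intro!: restrict_ext wadd_commute)
  show "comm_monoid ?R"
  proof (rule comm_monoidI)
    fix a :: "'a set \<Rightarrow> 'c" assume a: "a \<in> carrier ?R"
    show "\<one>\<^bsub>?R\<^esub> \<otimes>\<^bsub>?R\<^esub> a = a"
      using a by (intro extensional_eqI) (auto simp: witt_burnside_ring_simps wmul_one)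
  qed (auto simp: witt_burnside_ring_simps wmul_assoc intro!: restrict_ext wmul_commute)
  show "(a \<oplus>\<^bsub>?R\<^esub> b) \<otimes>\<^bsub>?R\<^esub> c = a \<otimes>\<^bsub>?R\<^esub> c \<oplus>\<^bsub>?R\<^esub> b \<otimes>\<^bsub>?R\<^esub> c" for a b c
    by (auto simp: witt_burnside_ring_simps wmul_wadd_distrib intro!: restrict_ext)
qed

text \<open>
  Both directions come from \<open>wadd_local\<close>, via \<open>a = (a - b) + b\<close> and \<open>a - b = a + (- b)\<close>.
\<close>

lemma minus_vanishes_above_iff:
  fixes a b :: "'a set \<Rightarrow> 'c::comm_ring_1"
  assumes T: "T \<in> \<O>" and a: "a \<in> \<O> \<rightarrow>\<^sub>E UNIV" and b: "b \<in> \<O> \<rightarrow>\<^sub>E UNIV"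
  shows "(\<forall>K\<in>above T. (a \<ominus>\<^bsub>witt_burnside_ring G \<tau>\<^esub> b) K = 0) \<longleftrightarrow> (\<forall>K\<in>above T. a K = b K)"
proof -
  let ?R = "witt_burnside_ring G \<tau> :: ('a set \<Rightarrow> 'c) ring"
  interpret R: cring ?R by (rule cring_witt_burnside_ring)
  have ab: "a \<in> carrier ?R" "b \<in> carrier ?R" using a b by (auto simp: witt_burnside_ring_simps)
  have local: "(x \<oplus>\<^bsub>?R\<^esub> y) K = (x' \<oplus>\<^bsub>?R\<^esub> y) K"
    if "\<forall>K\<in>above T. x K = x' K" "K \<in> above T" for x x' y K
    using that above_mono[OF that(2)] aboveD(1)[OF that(2)]
    by (auto simp: witt_burnside_ring_simps intro!: wadd_local)
  show ?thesis
  proof safe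
    fix K assume *: "\<forall>K\<in>above T. (a \<ominus>\<^bsub>?R\<^esub> b) K = 0" and K: "K \<in> above T"
    have "a K = ((a \<ominus>\<^bsub>?R\<^esub> b) \<oplus>\<^bsub>?R\<^esub> b) K"
      using ab by (simp add: R.minus_eq R.a_assoc R.l_neg)
    also have "\<dots> = (\<zero>\<^bsub>?R\<^esub> \<oplus>\<^bsub>?R\<^esub> b) K"
      using * K aboveD(1) by (intro local) (auto simp: witt_burnside_ring_simps)
    also have "\<dots> = b K" using ab by simp
    finally show "a K = b K" .
  next
    fix K assume *: "\<forall>K\<in>above T. a K = b K" and K: "K \<in> above T"
    have "(a \<ominus>\<^bsub>?R\<^esub> b) K = (b \<oplus>\<^bsub>?R\<^esub> (\<ominus>\<^bsub>?R\<^esub> b)) K"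
      using * K unfolding R.minus_eq by (intro local) auto
    also have "\<dots> = \<zero>\<^bsub>?R\<^esub> K" using ab by (simp add: R.r_neg)
    finally show "(a \<ominus>\<^bsub>?R\<^esub> b) K = 0"
      using aboveD(1)[OF K] by (simp add: witt_burnside_ring_simps)
  qed
qed

end

text \<open>
  The model is a quotient group \<open>G'\<close> of \<open>G\<close>, with \<open>\<psi>\<close> taking inverse images of subgroups; only the
  order relations and the indices enter the Witt polynomials, so the quotient map itself is not mentioned.
\<close>

locale pro_p_pullback =
  A: abelian_pro_p G \<tau> p + B: abelian_pro_p G' \<tau>' p
  for G :: "('a, 'm) monoid_scheme" (structure) and \<tau> p
    and G' :: "('b, 'n) monoid_scheme" and \<tau>' +
  fixes \<psi> :: "'b set \<Rightarrow> 'a set"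
  assumes mem: "T \<in> open_subgroups G' \<tau>' \<Longrightarrow> \<psi> T \<in> open_subgroups G \<tau>"
    and above_image: "T \<in> open_subgroups G' \<tau>' \<Longrightarrow> A.above (\<psi> T) = \<psi> ` B.above T"
    and inj: "inj_on \<psi> (open_subgroups G' \<tau>')"
    and index_eq: "T \<in> open_subgroups G' \<tau>' \<Longrightarrow> A.index (\<psi> T) = B.index T"
begin

lemma ghost_pullback:
  assumes T: "T \<in> open_subgroups G' \<tau>'"
  shows "B.ghost T (\<lambda>K. a (\<psi> K)) = A.ghost (\<psi> T) a"
proof -
  have "inj_on \<psi> (B.above T)"
    using inj by (rule inj_on_subset) (auto dest: B.aboveD)
  then show ?thesis
    unfolding A.ghost_def B.ghost_def above_image[OF T] using T
    by (simp add: sum.reindex index_eq B.aboveD)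
qed

lemma
  assumes T: "T \<in> open_subgroups G' \<tau>'"
  shows wadd_pullback: "A.wadd a b (\<psi> T) = B.wadd (\<lambda>K. a (\<psi> K)) (\<lambda>K. b (\<psi> K)) T"
    and wmul_pullback: "A.wmul a b (\<psi> T) = B.wmul (\<lambda>K. a (\<psi> K)) (\<lambda>K. b (\<psi> K)) T"
proof -
  note ghosts = ghost_pullback A.ghost_ops B.ghost_ops mem
  have "A.wadd (A.generic 0) (A.generic 1) (\<psi> T)
      = B.wadd (\<lambda>K. A.generic 0 (\<psi> K)) (\<lambda>K. A.generic 1 (\<psi> K)) T"
    by (rule B.ghost_inj_int_mpoly[OF T, where x = "\<lambda>K. A.wadd _ _ (\<psi> K)"]) (simp add: ghosts, simp add: B.aboveD flip: ghost_pullback)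
  from arg_cong[OF this, of "A.specialize [a, b]"]
  show "A.wadd a b (\<psi> T) = B.wadd (\<lambda>K. a (\<psi> K)) (\<lambda>K. b (\<psi> K)) T"
    by (simp add: A.hom_ops B.hom_ops)
  have "A.wmul (A.generic 0) (A.generic 1) (\<psi> T)
      = B.wmul (\<lambda>K. A.generic 0 (\<psi> K)) (\<lambda>K. A.generic 1 (\<psi> K)) T"
    by (rule B.ghost_inj_int_mpoly[OF T, where x = "\<lambda>K. A.wmul _ _ (\<psi> K)"]) (simp add: ghosts, simp add: B.aboveD flip: ghost_pullback)
  from arg_cong[OF this, of "A.specialize [a, b]"]
  show "A.wmul a b (\<psi> T) = B.wmul (\<lambda>K. a (\<psi> K)) (\<lambda>K. b (\<psi> K)) T"
    by (simp add: A.hom_ops B.hom_ops)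
qed

lemma carrier_pullback: "\<psi> (carrier G') = carrier G"
proof -
  have "A.index (\<psi> (carrier G')) = 1"
    using index_eq[OF B.carrier_mem] by (simp add: B.index_carrier)
  moreover have "subgroup (\<psi> (carrier G')) G"
    by (intro A.open_subgroupD mem B.carrier_mem)
  ultimately show ?thesis
    by (intro A.index_antisym A.subgroup_self subgroup.subset) (simp_all add: A.index_carrier)
qed

lemma pullback_ring_hom:
  "(\<lambda>a. \<lambda>T\<in>open_subgroups G' \<tau>'. a (\<psi> T))
     \<in> ring_hom (witt_burnside_ring G \<tau>) (witt_burnside_ring G' \<tau>' :: ('b set \<Rightarrow> 'c::comm_ring_1) ring)"
    (is "?h \<in> _")
proof (rule ring_hom_memI)
  show "?h \<one>\<^bsub>witt_burnside_ring G \<tau>\<^esub> = \<one>\<^bsub>witt_burnside_ring G' \<tau>'\<^esub>"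
  proof -
    have "\<psi> T = carrier G \<longleftrightarrow> T = carrier G'" if "T \<in> open_subgroups G' \<tau>'" for T
      using inj_onD[OF inj _ that B.carrier_mem] carrier_pullback by auto
    then show ?thesis
      by (auto simp: A.witt_burnside_ring_simps B.witt_burnside_ring_simps A.wone_def B.wone_def mem
          intro!: restrict_ext)
  qed
qed (auto simp: A.witt_burnside_ring_simps B.witt_burnside_ring_simps mem wadd_pullback wmul_pullback
       intro!: restrict_ext B.wadd_local B.wmul_local dest: B.aboveD)

end

section \<open>Cyclic quotients\<close>

text \<open>
  Let \<open>\<gamma>\<close> represent a generator of \<open>G/H\<close>. For \<open>K \<supseteq> H\<close> its image generates \<open>G/K\<close>, so it has order
  \<open>index K\<close> there; for infinite index both sides say \<open>i = 0\<close>.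
\<close>

lemma (in comm_group) cyclic_quotient_generator:
  assumes H: "subgroup H G" and cyc: "cyclic_group (G Mod H)"
  obtains \<gamma> where "\<gamma> \<in> carrier G"
    and "\<And>x. x \<in> carrier G \<Longrightarrow> \<exists>i::int. x \<in> H #> \<gamma> [^] i"
    and "\<And>K i. subgroup K G \<Longrightarrow> H \<subseteq> K \<Longrightarrow> \<gamma> [^] (i::int) \<in> K \<longleftrightarrow> int (index K) dvd i"
proof -
  interpret Q: comm_group "G Mod H" using H by (rule comm_group_Mod)
  interpret H: normal H G using H by (rule subgroup_imp_normal)
  obtain C where C: "C \<in> carrier (G Mod H)" "carrier (G Mod H) = range (\<lambda>n::int. C [^]\<^bsub>G Mod H\<^esub> n)"
    using cyc Q.cyclic_group by blast
  from C(1) obtain \<gamma> where \<gamma>: "\<gamma> \<in> carrier G" "C = H #> \<gamma>"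
    by (auto simp: carrier_FactGroup)
  have pow: "C [^]\<^bsub>G Mod H\<^esub> i = H #> \<gamma> [^] i" for i :: int
    using \<gamma> H.FactGroup_int_pow[of \<gamma> i] by simp
  have gen: "\<exists>i::int. x \<in> H #> \<gamma> [^] i" if x: "x \<in> carrier G" for x
  proof -
    have "H #> x \<in> carrier (G Mod H)" using x by (auto simp: carrier_FactGroup)
    then obtain i :: int where "H #> x = H #> \<gamma> [^] i" using C(2) pow by auto
    then show ?thesis using rcos_self[OF x H] by auto
  qed
  have "\<gamma> [^] i \<in> K \<longleftrightarrow> int (index K) dvd i" if K: "subgroup K G" "H \<subseteq> K" for K and i :: int
  proof -
    interpret QK: comm_group "G Mod K" using K(1) by (rule comm_group_Mod)
    interpret K: normal K G using K(1) by (rule subgroup_imp_normal)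
    define D where "D = K #> \<gamma>"
    have D: "D \<in> carrier (G Mod K)" using \<gamma> by (auto simp: D_def carrier_FactGroup)
    have powD: "D [^]\<^bsub>G Mod K\<^esub> i = K #> \<gamma> [^] i" for i :: int
      using \<gamma> K.FactGroup_int_pow[of \<gamma> i] by (simp add: D_def)
    have "carrier (G Mod K) \<subseteq> generate (G Mod K) {D}"
    proof
      fix E assume "E \<in> carrier (G Mod K)"
      then obtain x where x: "x \<in> carrier G" "E = K #> x" by (auto simp: carrier_FactGroup)
      obtain i :: int where "x \<in> H #> \<gamma> [^] i" using gen x by blast
      then have "x \<in> K #> \<gamma> [^] i" using K(2) by (auto simp: r_coset_def)
      then have "E = D [^]\<^bsub>G Mod K\<^esub> i"
        unfolding powD x(2) using repr_independence[of x K "\<gamma> [^] i"] \<gamma> K(1) by simp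
      then show "E \<in> generate (G Mod K) {D}"
        using QK.generate_pow[OF D] by blast
    qed
    then have "generate (G Mod K) {D} = carrier (G Mod K)"
      using QK.generate_incl[of "{D}"] D by auto
    then have "QK.ord D = index K"
      using QK.generate_pow_card[OF D] by (simp add: index_def FactGroup_def)
    then have "int (index K) dvd i \<longleftrightarrow> K #> \<gamma> [^] i = K"
      using QK.int_pow_eq_id[OF D, of i] powD[of i] by simp
    also have "\<dots> \<longleftrightarrow> \<gamma> [^] i \<in> K"
      using coset_join1[of K "\<gamma> [^] i"] coset_join2[of "\<gamma> [^] i" K] \<gamma> K(1)
      by (meson int_pow_closed subgroup.subset)
    finally show ?thesis by simp
  qed
  with \<gamma>(1) gen that show thesis by blast
qed

lemma (in comm_group) subgroup_above_cyclic_unique: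
  assumes H: "subgroup H G" and cyc: "cyclic_group (G Mod H)"
    and K: "subgroup K G" "H \<subseteq> K" and K': "subgroup K' G" "H \<subseteq> K'" and eq: "index K = index K'"
  shows "K = K'"
proof -
  obtain \<gamma> where \<gamma>: "\<gamma> \<in> carrier G"
    and gen: "\<And>x. x \<in> carrier G \<Longrightarrow> \<exists>i::int. x \<in> H #> \<gamma> [^] i"
    and mem: "\<And>K i. subgroup K G \<Longrightarrow> H \<subseteq> K \<Longrightarrow> \<gamma> [^] (i::int) \<in> K \<longleftrightarrow> int (index K) dvd i"
    by (rule cyclic_quotient_generator[OF H cyc]) blast
  have *: "x \<in> L \<longleftrightarrow> \<gamma> [^] i \<in> L"
    if "subgroup L G" "H \<subseteq> L" "x \<in> carrier G" "x \<in> H #> \<gamma> [^] i" for L x and i :: int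
  proof -
    obtain h where h: "h \<in> H" "x = h \<otimes> \<gamma> [^] i" using \<open>x \<in> H #> \<gamma> [^] i\<close> by (auto simp: r_coset_def)
    have hL: "h \<in> L" "h \<in> carrier G" using h that H subgroup.subset by blast+
    show ?thesis
    proof
      show "x \<in> L" if "\<gamma> [^] i \<in> L"
        using subgroup.m_closed[OF \<open>subgroup L G\<close> hL(1) that] h by simp
      assume "x \<in> L"
      then have "inv h \<otimes> x \<in> L"
        using \<open>subgroup L G\<close> hL by (meson subgroup.m_closed subgroup.m_inv_closed)
      then show "\<gamma> [^] i \<in> L" using h hL \<gamma> by (simp flip: m_assoc)
    qed
  qed
  have "x \<in> K \<longleftrightarrow> x \<in> K'" if x: "x \<in> carrier G" for x
  proof -
    obtain i :: int where "x \<in> H #> \<gamma> [^] i" using gen[OF x] by blast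
    then show ?thesis
      using *[OF K x] *[OF K' x] mem[OF K, of i] mem[OF K', of i] eq by simp
  qed
  then show ?thesis using subgroup.subset[OF K(1)] subgroup.subset[OF K'(1)] by blast
qed

section \<open>Pro-p groups presented by a sequence of finite quotients\<close>

lemma (in group_hom) index_kernel:
  assumes "comm_group G" "h ` carrier G = carrier H"
  shows "comm_group.index G (kernel G H h) = card (carrier H)"
  using FactGroup_iso_set[OF assms(2)] comm_group.index_def[OF assms(1)]
  by (auto simp: iso_def FactGroup_def dest: bij_betw_same_card)

text \<open>
  A subgroup that contains the kernel is a union of fibres.
\<close>

lemma (in group_hom) fibre_in_subgroup:
  assumes K: "subgroup K G" "kernel G H h \<subseteq> K" and x: "x \<in> K" and y: "y \<in> carrier G" "h y = h x"
  shows "y \<in> K"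
proof -
  have xG: "x \<in> carrier G" using K x subgroup.subset by blast
  have "inv x \<otimes> y \<in> kernel G H h"
    using xG y by (simp add: kernel_def)
  then have "x \<otimes> (inv x \<otimes> y) \<in> K" using K x by (meson subgroup.m_closed subsetD)
  then show ?thesis using xG y by (simp flip: G.m_assoc)
qed

text \<open>
  The topology is described by a sequence of finite quotients \<open>h N : G \<longrightarrow> Q N\<close> whose fibres form a basis.
  Then a subgroup is open exactly when it contains the kernel of some \<open>h N\<close>, and its index divides the
  order of \<open>Q N\<close>.
\<close>

lemma abelian_pro_pI:
  fixes G (structure)
  assumes G: "comm_group G" and p: "prime p"
    and hom: "\<And>N. group_hom G (Q N) (h N)" and surj: "\<And>N. h N ` carrier G = carrier (Q N)"
    and order: "\<And>N. \<exists>k. card (carrier (Q N)) = p ^ k"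
    and top: "\<And>S. openin \<tau> S \<longleftrightarrow> S \<subseteq> carrier G \<and>
      (\<forall>x\<in>S. \<exists>N. \<forall>y\<in>carrier G. h N y = h N x \<longrightarrow> y \<in> S)"
  shows "abelian_pro_p G \<tau> p"
    and "H \<in> open_subgroups G \<tau> \<longleftrightarrow> subgroup H G \<and> (\<exists>N. kernel G (Q N) (h N) \<subseteq> H)"
proof -
  interpret comm_group G by (rule G)
  have ker: "\<exists>N. kernel G (Q N) (h N) \<subseteq> H" if H: "H \<in> open_subgroups G \<tau>" for H
  proof -
    have Hs: "subgroup H G" using H by (simp add: open_subgroups_def)
    have "\<one> \<in> H" using Hs by (rule subgroup.one_closed)
    moreover have "openin \<tau> H" using H by (simp add: open_subgroups_def)
    ultimately obtain N where N: "\<forall>y\<in>carrier G. h N y = h N \<one> \<longrightarrow> y \<in> H"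
      unfolding top by blast
    interpret group_hom G "Q N" "h N" by (rule hom)
    have "kernel G (Q N) (h N) \<subseteq> H" using N by (auto simp: kernel_def)
    then show ?thesis ..
  qed
  have opn: "openin \<tau> K" if K: "subgroup K G" "kernel G (Q N) (h N) \<subseteq> K" for K N
    unfolding top using subgroup.subset[OF K(1)] group_hom.fibre_in_subgroup[OF hom K] by blast
  show *: "H \<in> open_subgroups G \<tau> \<longleftrightarrow> subgroup H G \<and> (\<exists>N. kernel G (Q N) (h N) \<subseteq> H)" for H
    using ker opn by (auto simp: open_subgroups_def)
  show "abelian_pro_p G \<tau> p"
  proof
    show "prime p" by (rule p)
    show "openin \<tau> (carrier G)" unfolding top by auto
    show "openin \<tau> K" if "H \<in> open_subgroups G \<tau>" "subgroup K G" "H \<subseteq> K" for H K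
      using ker[OF that(1)] opn[OF that(2)] that(3) by blast
    show "\<exists>n. index H = p ^ n" if H: "H \<in> open_subgroups G \<tau>" for H
    proof -
      obtain N where N: "kernel G (Q N) (h N) \<subseteq> H" using ker H by blast
      interpret group_hom G "Q N" "h N" by (rule hom)
      obtain k where "index (kernel G (Q N) (h N)) = p ^ k"
        using index_kernel[OF G surj] order[of N] by auto
      then have "index H dvd p ^ k"
        using index_mult[OF subgroup_kernel _ N] H by (auto simp: open_subgroups_def)
      then show ?thesis using divides_primepow_nat[OF p] by blast
    qed
  qed
qed

section \<open>The p-adic integers\<close>

lemma carrier_Zp:
  assumes "p > 0"
  shows "x \<in> carrier (Zp p) \<longleftrightarrow>
    (\<forall>n. 0 \<le> x n \<and> x n < int p ^ n) \<and> (\<forall>n. x (Suc n) mod int p ^ n = x n)"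
  using assms by (auto simp: Zp_def Let_def carrier_integer_mod_group PiE_iff)

lemma mult_Zp: "x \<otimes>\<^bsub>Zp p\<^esub> y = (\<lambda>n. (x n + y n) mod int p ^ n)"
  by (simp add: Zp_def Let_def restrict_def)

lemma one_Zp: "\<one>\<^bsub>Zp p\<^esub> = (\<lambda>n. 0)"
  by (simp add: Zp_def Let_def restrict_def)

definition Zp_of_int :: "nat \<Rightarrow> int \<Rightarrow> nat \<Rightarrow> int" where
  "Zp_of_int p z n = z mod int p ^ n"

lemma mod_power_Suc_mod: "a mod int p ^ Suc n mod int p ^ n = a mod int p ^ n"
  by (simp add: mod_mod_cancel)

lemma Zp_of_int_mem: "p > 0 \<Longrightarrow> Zp_of_int p z \<in> carrier (Zp p)"
  unfolding carrier_Zp by (auto simp: Zp_of_int_def mod_power_Suc_mod simp del: power_Suc)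

lemma Zp_coherent:
  assumes p: "p > 0" and x: "x \<in> carrier (Zp p)" and mn: "m \<le> n"
  shows "x n mod int p ^ m = x m"
  using mn
proof (induction n rule: dec_induct)
  case base
  then show ?case using x p by (simp add: carrier_Zp)
next
  case (step n)
  have "x (Suc n) mod int p ^ m = x (Suc n) mod int p ^ n mod int p ^ m"
    using step(1) by (simp add: mod_mod_cancel le_imp_power_dvd)
  also have "x (Suc n) mod int p ^ n = x n" using x p carrier_Zp by blast
  finally show ?case using step.IH by simp
qed

lemma Zp_mod_self: "p > 0 \<Longrightarrow> x \<in> carrier (Zp p) \<Longrightarrow> x n mod int p ^ n = x n"
  by (rule Zp_coherent) auto

lemma comm_group_Zp:
  assumes p: "p > 0"
  shows "comm_group (Zp p)"
proof (rule comm_groupI)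
  fix x assume x: "x \<in> carrier (Zp p)"
  show "\<exists>y\<in>carrier (Zp p). y \<otimes>\<^bsub>Zp p\<^esub> x = \<one>\<^bsub>Zp p\<^esub>"
  proof
    have "x (Suc n) mod int p ^ n = x n" for n using x p carrier_Zp by blast
    then have "(- x (Suc n)) mod int p ^ Suc n mod int p ^ n = (- x n) mod int p ^ n" for n
      unfolding mod_power_Suc_mod by (metis mod_minus_eq)
    then show "(\<lambda>n. (- x n) mod int p ^ n) \<in> carrier (Zp p)"
      unfolding carrier_Zp[OF p] using p by auto
    show "(\<lambda>n. (- x n) mod int p ^ n) \<otimes>\<^bsub>Zp p\<^esub> x = \<one>\<^bsub>Zp p\<^esub>"
      by (simp add: mult_Zp one_Zp mod_add_left_eq)
  qed
  show "\<one>\<^bsub>Zp p\<^esub> \<otimes>\<^bsub>Zp p\<^esub> x = x"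
    using Zp_mod_self[OF p x] by (simp add: mult_Zp one_Zp)
  fix y assume y: "y \<in> carrier (Zp p)"
  show "x \<otimes>\<^bsub>Zp p\<^esub> y = y \<otimes>\<^bsub>Zp p\<^esub> x"
    by (simp add: mult_Zp add.commute)
  show "x \<otimes>\<^bsub>Zp p\<^esub> y \<in> carrier (Zp p)"
  proof -
    have "x (Suc n) mod int p ^ n = x n" "y (Suc n) mod int p ^ n = y n" for n
      using x y p carrier_Zp by blast+
    then have "(x (Suc n) + y (Suc n)) mod int p ^ Suc n mod int p ^ n = (x n + y n) mod int p ^ n" for n
      unfolding mod_power_Suc_mod by (metis mod_add_eq)
    then show ?thesis
      unfolding carrier_Zp[OF p] mult_Zp using p by auto
  qed
  fix z
  show "x \<otimes>\<^bsub>Zp p\<^esub> y \<otimes>\<^bsub>Zp p\<^esub> z = x \<otimes>\<^bsub>Zp p\<^esub> (y \<otimes>\<^bsub>Zp p\<^esub> z)"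
    by (simp add: mult_Zp mod_simps add.assoc)
next
  show "\<one>\<^bsub>Zp p\<^esub> \<in> carrier (Zp p)"
    using p by (simp add: one_Zp carrier_Zp)
qed

lemma pow_Zp:
  assumes p: "p > 0"
  shows "x [^]\<^bsub>Zp p\<^esub> (k::nat) = (\<lambda>n. (int k * x n) mod int p ^ n)"
proof -
  interpret comm_group "Zp p" using p by (rule comm_group_Zp)
  show ?thesis
    by (induction k) (auto simp: one_Zp mult_Zp mod_simps algebra_simps)
qed

lemma Zp_proj_hom:
  assumes p: "p > 0"
  shows "group_hom (Zp p) (integer_mod_group (p ^ n)) (\<lambda>x. x n)"
    and "(\<lambda>x. x n) ` carrier (Zp p) = carrier (integer_mod_group (p ^ n))"
proof -
  show "group_hom (Zp p) (integer_mod_group (p ^ n)) (\<lambda>x. x n)"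
    using comm_group_Zp[OF p] p
    by (auto simp: group_hom_def group_hom_axioms_def comm_group_def carrier_Zp
        carrier_integer_mod_group mult_Zp intro!: homI)
  show "(\<lambda>x. x n) ` carrier (Zp p) = carrier (integer_mod_group (p ^ n))"
  proof
    show "carrier (integer_mod_group (p ^ n)) \<subseteq> (\<lambda>x. x n) ` carrier (Zp p)"
    proof
      fix z assume "z \<in> carrier (integer_mod_group (p ^ n))"
      then have "z = Zp_of_int p z n"
        using p by (simp add: Zp_of_int_def carrier_integer_mod_group)
      then show "z \<in> (\<lambda>x. x n) ` carrier (Zp p)"
        using Zp_of_int_mem[OF p] by blast
    qed
  qed (use p in \<open>auto simp: carrier_Zp carrier_integer_mod_group\<close>)
qed

lemma card_integer_mod_group: "n > 0 \<Longrightarrow> card (carrier (integer_mod_group n)) = n"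
  by (simp add: carrier_integer_mod_group)

text \<open>
  A sequence \<open>x\<close> with \<open>x n = 0\<close> is divided by \<open>p ^ n\<close> by shifting it: the quotient has the entries
  \<open>x (m + n) div p ^ n\<close>.
\<close>

lemma pn_Zp_eq:
  assumes p: "p > 0"
  shows "pn_Zp p n = {x \<in> carrier (Zp p). x n = 0}"
proof
  interpret comm_group "Zp p" using p by (rule comm_group_Zp)
  show "pn_Zp p n \<subseteq> {x \<in> carrier (Zp p). x n = 0}"
  proof
    fix y assume "y \<in> pn_Zp p n"
    then obtain x where x: "x \<in> carrier (Zp p)" "y = x [^]\<^bsub>Zp p\<^esub> (p ^ n)" by (auto simp: pn_Zp_def)
    then have "y n = 0" by (simp add: pow_Zp[OF p])
    then show "y \<in> {x \<in> carrier (Zp p). x n = 0}" using x by simp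
  qed
  show "{x \<in> carrier (Zp p). x n = 0} \<subseteq> pn_Zp p n"
  proof
    fix x assume "x \<in> {x \<in> carrier (Zp p). x n = 0}"
    then have x: "x \<in> carrier (Zp p)" "x n = 0" by auto
    define y where "y m = x (m + n) div int p ^ n" for m
    have dvd: "int p ^ n dvd x (m + n)" for m
      using Zp_coherent[OF p x(1), of n "m + n"] x(2) by (simp add: dvd_eq_mod_eq_0)
    have bound: "0 \<le> x m" "x m < int p ^ m" for m using x(1) carrier_Zp[OF p] by blast+
    have xm: "x (m + n) = int p ^ n * y m" for m
      using dvd by (simp add: y_def)
    have pn: "int p ^ n > 0" using p by simp
    have "y \<in> carrier (Zp p)"
      unfolding carrier_Zp[OF p]
    proof (intro conjI allI)
      fix m
      show "0 \<le> y m" using bound[of "m + n"] p by (simp add: y_def pos_imp_zdiv_nonneg_iff)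
      have "int p ^ n * y m < int p ^ n * int p ^ m"
        using bound[of "m + n"] by (simp add: xm power_add mult.commute)
      then show "y m < int p ^ m" using pn by simp
      have "x (Suc m + n) mod int p ^ (m + n) = x (m + n)"
        by (rule Zp_coherent[OF p x(1)]) simp
      then have "(int p ^ n * y (Suc m)) mod (int p ^ n * int p ^ m) = int p ^ n * y m"
        unfolding xm by (simp add: power_add mult.commute)
      then show "y (Suc m) mod int p ^ m = y m"
        using p by (auto simp: mult_mod_right[symmetric])
    qed
    moreover have "x = y [^]\<^bsub>Zp p\<^esub> (p ^ n)"
    proof
      fix m
      have "x m = x (m + n) mod int p ^ m" using Zp_coherent[OF p x(1), of m "m + n"] by simp
      then show "x m = (y [^]\<^bsub>Zp p\<^esub> (p ^ n)) m" by (simp add: pow_Zp[OF p] xm)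
    qed
    ultimately show "x \<in> pn_Zp p n" by (auto simp: pn_Zp_def)
  qed
qed

lemma pn_Zp_kernel:
  "p > 0 \<Longrightarrow> pn_Zp p n = kernel (Zp p) (integer_mod_group (p ^ n)) (\<lambda>x. x n)"
  by (simp add: pn_Zp_eq kernel_def)

lemma topspace_Zp: "topspace (Zp_topology p) = carrier (Zp p)"
  by (auto simp: Zp_topology_def Zp_def Let_def)

lemma openin_Zp:
  assumes p: "p > 0"
  shows "openin (Zp_topology p) S \<longleftrightarrow> S \<subseteq> carrier (Zp p) \<and>
    (\<forall>x\<in>S. \<exists>N. \<forall>y\<in>carrier (Zp p). y N = x N \<longrightarrow> y \<in> S)"
proof -
  let ?X = "\<lambda>n. discrete_topology (carrier (integer_mod_group (p ^ n)))"
  let ?P = "product_topology ?X UNIV"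
  have sub: "carrier (Zp p) \<subseteq> topspace ?P" by (auto simp: Zp_def Let_def)
  show ?thesis
  proof
    assume S: "openin (Zp_topology p) S"
    then obtain T where T: "openin ?P T" "S = T \<inter> carrier (Zp p)"
      by (auto simp: Zp_topology_def openin_subtopology)
    have "\<exists>N. \<forall>y\<in>carrier (Zp p). y N = x N \<longrightarrow> y \<in> S" if x: "x \<in> S" for x
    proof -
      have "x \<in> T" using x T by simp
      then obtain U where U: "finite {i \<in> UNIV. U i \<noteq> topspace (?X i)}" "x \<in> Pi\<^sub>E UNIV U" "Pi\<^sub>E UNIV U \<subseteq> T"
        using T(1) unfolding openin_product_topology_alt by blast
      obtain N where N: "\<And>i. U i \<noteq> topspace (?X i) \<Longrightarrow> i \<le> N"
        using finite_nat_set_iff_bounded_le[THEN iffD1, OF U(1)] by auto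
      have "y \<in> S" if y: "y \<in> carrier (Zp p)" "y N = x N" for y
      proof -
        have "y i \<in> U i" for i
        proof (cases "U i = topspace (?X i)")
          case False
          then have "i \<le> N" by (rule N)
          then have "y i = x i"
            using Zp_coherent[OF p y(1)] Zp_coherent[OF p, of x i N] x T y(2) by (metis IntE)
          then show ?thesis using U(2) by auto
        next
          case True
          have "y \<in> topspace ?P" using y sub by blast
          then show ?thesis unfolding True by auto
        qed
        then show ?thesis using U(3) T y by auto
      qed
      then show ?thesis by blast
    qed
    then show "S \<subseteq> carrier (Zp p) \<and> (\<forall>x\<in>S. \<exists>N. \<forall>y\<in>carrier (Zp p). y N = x N \<longrightarrow> y \<in> S)"
      using T by auto
  next
    assume S: "S \<subseteq> carrier (Zp p) \<and> (\<forall>x\<in>S. \<exists>N. \<forall>y\<in>carrier (Zp p). y N = x N \<longrightarrow> y \<in> S)"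
    show "openin (Zp_topology p) S"
    proof (subst openin_subopen, intro ballI)
      fix x assume x: "x \<in> S"
      then obtain N where N: "\<forall>y\<in>carrier (Zp p). y N = x N \<longrightarrow> y \<in> S" using S by blast
      have xP: "x \<in> topspace ?P" using x S sub by blast
      let ?T = "{y \<in> topspace ?P. y N \<in> {x N}}"
      have "openin ?P ?T"
        by (rule openin_continuous_map_preimage[OF continuous_map_product_projection])
           (use xP in auto)
      then have "openin (Zp_topology p) (?T \<inter> carrier (Zp p))"
        by (auto simp: Zp_topology_def openin_subtopology)
      moreover have "x \<in> ?T \<inter> carrier (Zp p)" using x S xP by auto
      moreover have "?T \<inter> carrier (Zp p) \<subseteq> S" using N by auto
      ultimately show "\<exists>T. openin (Zp_topology p) T \<and> x \<in> T \<and> T \<subseteq> S" by blast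
    qed
  qed
qed

lemma Zp_cylinder_open:
  assumes p: "p > 0"
  shows "openin (Zp_topology p) {y \<in> carrier (Zp p). y N = c}"
  unfolding openin_Zp[OF p] by auto

section \<open>Open subgroups of the p-adic integers and of their square\<close>

text \<open>
  In a cyclic quotient a subgroup is determined by its index, so one subgroup for each possible index
  is a complete list.
\<close>

lemma (in abelian_pro_p) above_eq_chain:
  assumes H: "H \<in> \<O>" and cyc: "cyclic_group (G Mod H)" and index: "index H = p ^ n"
    and c: "\<And>i. i \<le> n \<Longrightarrow> c i \<in> above H" "\<And>i. i \<le> n \<Longrightarrow> index (c i) = p ^ i"
  shows "above H = c ` {..n}"
proof
  show "above H \<subseteq> c ` {..n}"
  proof
    fix K assume K: "K \<in> above H"
    have "index K dvd p ^ n" using index_dvd[OF H K] index by simp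
    then obtain i where i: "i \<le> n" "index K = p ^ i"
      using divides_primepow_nat[OF prime_p] by blast
    have "K = c i"
      using open_subgroupD[OF H] cyc aboveD(3)[OF K] aboveD(2)[OF K]
        aboveD(3)[OF c(1)[OF i(1)]] aboveD(2)[OF c(1)[OF i(1)]]
      by (rule subgroup_above_cyclic_unique) (simp add: i c(2))
    then show "K \<in> c ` {..n}" using i by auto
  qed
qed (use c in auto)

lemma (in comm_group) pow_index_mem:
  assumes H: "subgroup H G" and x: "x \<in> carrier G"
  shows "x [^] index H \<in> H"
proof -
  interpret Q: comm_group "G Mod H" using H by (rule comm_group_Mod)
  interpret H: normal H G using H by (rule subgroup_imp_normal)
  have "H #> x [^] index H = H"
  proof -
    have "order (G Mod H) = index H" by (simp add: order_def index_def FactGroup_def)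
    moreover have "H #> x \<in> carrier (G Mod H)" using x by (auto simp: carrier_FactGroup)
    ultimately show ?thesis
      using Q.pow_order_eq_1[of "H #> x"] H.FactGroup_pow[OF x, of "index H"] by simp
  qed
  then show ?thesis
    using coset_join1[OF _ _ H] x by simp
qed

lemma cyclic_integer_mod_group: "cyclic_group (integer_mod_group n)"
proof (cases "n = 0")
  case True
  then show ?thesis by (simp add: integer_mod_group_def)
next
  case False
  interpret Z: group integer_group by simp
  have "(\<lambda>x. x mod int n) \<in> epi integer_group (integer_mod_group n)"
  proof -
    have "(\<lambda>x. x mod int n) ` UNIV = {0..<int n}"
    proof
      show "{0..<int n} \<subseteq> (\<lambda>x. x mod int n) ` UNIV"
      proof
        fix z assume "z \<in> {0..<int n}"
        then have "z = z mod int n" by simp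
        then show "z \<in> (\<lambda>x. x mod int n) ` UNIV" by blast
      qed
    qed (use False in auto)
    then show ?thesis
      using False by (auto simp: epi_def carrier_integer_mod_group mod_simps intro!: homI)
  qed
  then show ?thesis
    by (rule Z.cyclic_group_epimorphic_image) auto
qed

lemma (in group_hom) cyclic_quotient_kernel:
  assumes "h ` carrier G = carrier H" "cyclic_group H"
  shows "cyclic_group (G Mod kernel G H h)"
  using isomorphic_group_cyclicity[OF FactGroup_iso[OF assms(1)] normal.factorgroup_is_group[OF normal_kernel]]
    assms(2) H.is_group by simp

lemma
  assumes p: "prime p"
  shows abelian_pro_p_Zp: "abelian_pro_p (Zp p) (Zp_topology p) p"
    and open_subgroups_Zp_iff: "H \<in> open_subgroups (Zp p) (Zp_topology p)
      \<longleftrightarrow> subgroup H (Zp p) \<and> (\<exists>N. pn_Zp p N \<subseteq> H)"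
proof -
  have p0: "p > 0" using p prime_gt_0_nat by blast
  note * = comm_group_Zp[OF p0] p Zp_proj_hom[OF p0] _ openin_Zp[OF p0]
  show "abelian_pro_p (Zp p) (Zp_topology p) p"
    by (rule abelian_pro_pI(1)[OF *]) (use p0 in \<open>auto simp: card_integer_mod_group\<close>)
  show "H \<in> open_subgroups (Zp p) (Zp_topology p)
      \<longleftrightarrow> subgroup H (Zp p) \<and> (\<exists>N. pn_Zp p N \<subseteq> H)"
    unfolding pn_Zp_kernel[OF p0]
    by (rule abelian_pro_pI(2)[OF *]) (use p0 in \<open>auto simp: card_integer_mod_group\<close>)
qed

locale p_adic =
  fixes p :: nat
  assumes prime: "prime p"
begin

lemma p_pos: "p > 0"
  using prime prime_gt_0_nat by blast

lemma p_gt_1: "p > 1"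
  using prime prime_gt_1_nat by blast

sublocale Z: abelian_pro_p "Zp p" "Zp_topology p" p
  using prime by (rule abelian_pro_p_Zp)

lemma pn_Zp_subgroup: "subgroup (pn_Zp p n) (Zp p)"
  unfolding pn_Zp_kernel[OF p_pos] by (rule group_hom.subgroup_kernel[OF Zp_proj_hom(1)[OF p_pos]])

lemma pn_Zp_mem: "pn_Zp p n \<in> Z.\<O>"
  using pn_Zp_subgroup by (auto simp: open_subgroups_Zp_iff[OF prime])

lemma index_pn_Zp: "Z.index (pn_Zp p n) = p ^ n"
  using group_hom.index_kernel[OF Zp_proj_hom(1)[OF p_pos] comm_group_Zp[OF p_pos] Zp_proj_hom(2)[OF p_pos]]
    p_pos by (simp add: pn_Zp_kernel card_integer_mod_group)

lemma inj_pn_Zp: "inj (pn_Zp p)"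
proof (rule injI)
  fix m n assume "pn_Zp p m = pn_Zp p n"
  then have "p ^ m = p ^ n" by (metis index_pn_Zp)
  then show "m = n" using p_gt_1 by simp
qed

lemma pn_Zp_antimono: "m \<le> n \<Longrightarrow> pn_Zp p n \<subseteq> pn_Zp p m"
  using Zp_coherent[OF p_pos] by (fastforce simp: pn_Zp_eq[OF p_pos])

lemma above_pn_Zp: "Z.above (pn_Zp p n) = pn_Zp p ` {..n}"
proof (rule Z.above_eq_chain[OF pn_Zp_mem _ index_pn_Zp])
  show "cyclic_group (Zp p Mod pn_Zp p n)"
    unfolding pn_Zp_kernel[OF p_pos]
    by (rule group_hom.cyclic_quotient_kernel[OF Zp_proj_hom(1)[OF p_pos] Zp_proj_hom(2)[OF p_pos]
        cyclic_integer_mod_group])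
qed (auto simp: index_pn_Zp intro: Z.aboveI[OF pn_Zp_mem pn_Zp_subgroup pn_Zp_antimono])

lemma open_subgroups_Zp: "Z.\<O> = range (pn_Zp p)"
proof
  show "Z.\<O> \<subseteq> range (pn_Zp p)"
  proof
    fix H assume H: "H \<in> Z.\<O>"
    then obtain N where "pn_Zp p N \<subseteq> H" by (auto simp: open_subgroups_Zp_iff[OF prime])
    then have "H \<in> Z.above (pn_Zp p N)"
      by (intro Z.aboveI pn_Zp_mem Z.open_subgroupD H)
    then show "H \<in> range (pn_Zp p)" by (auto simp: above_pn_Zp)
  qed
qed (use pn_Zp_mem in auto)

lemma carrier_Zp2: "carrier (Zp2 p) = carrier (Zp p) \<times> carrier (Zp p)"
  by (simp add: Zp2_def)

lemma mult_Zp2: "u \<otimes>\<^bsub>Zp2 p\<^esub> v = (fst u \<otimes>\<^bsub>Zp p\<^esub> fst v, snd u \<otimes>\<^bsub>Zp p\<^esub> snd v)"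
  by (simp add: Zp2_def mult_DirProd')

lemma comm_group_Zp2: "comm_group (Zp2 p)"
proof -
  interpret group "Zp2 p"
    unfolding Zp2_def by (intro DirProd_group Z.is_group)
  show ?thesis
    by (rule group_comm_groupI) (auto simp: mult_Zp2 carrier_Zp2 Z.m_comm)
qed

definition Zp2_proj :: "nat \<Rightarrow> (nat \<Rightarrow> int) \<times> (nat \<Rightarrow> int) \<Rightarrow> int \<times> int" where
  "Zp2_proj N = (\<lambda>(x, y). (x N, y N))"

lemma Zp2_proj_hom:
  "group_hom (Zp2 p) (integer_mod_group (p ^ N) \<times>\<times> integer_mod_group (p ^ N)) (Zp2_proj N)"
  "Zp2_proj N ` carrier (Zp2 p) = carrier (integer_mod_group (p ^ N) \<times>\<times> integer_mod_group (p ^ N))"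
proof -
  have "Zp2_proj N \<in> hom (Zp2 p) (integer_mod_group (p ^ N) \<times>\<times> integer_mod_group (p ^ N))"
    using carrier_Zp[OF p_pos] p_pos
    by (intro homI) (auto simp: Zp2_proj_def carrier_Zp2 mult_Zp2 mult_Zp carrier_integer_mod_group)
  then show "group_hom (Zp2 p) (integer_mod_group (p ^ N) \<times>\<times> integer_mod_group (p ^ N)) (Zp2_proj N)"
    using comm_group_Zp2 by (auto simp: group_hom_def group_hom_axioms_def comm_group_def DirProd_group)
  show "Zp2_proj N ` carrier (Zp2 p) = carrier (integer_mod_group (p ^ N) \<times>\<times> integer_mod_group (p ^ N))"
    unfolding carrier_Zp2 carrier_DirProd Zp_proj_hom(2)[OF p_pos, symmetric]
    by (auto simp: Zp2_proj_def image_def)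
qed

lemma openin_Zp2:
  "openin (Zp2_topology p) S \<longleftrightarrow> S \<subseteq> carrier (Zp2 p) \<and>
    (\<forall>u\<in>S. \<exists>N. \<forall>v\<in>carrier (Zp2 p). Zp2_proj N v = Zp2_proj N u \<longrightarrow> v \<in> S)"
proof
  assume S: "openin (Zp2_topology p) S"
  have "S \<subseteq> carrier (Zp2 p)"
    using openin_subset[OF S] by (simp add: Zp2_topology_def topspace_Zp carrier_Zp2)
  moreover have "\<exists>N. \<forall>v\<in>carrier (Zp2 p). Zp2_proj N v = Zp2_proj N u \<longrightarrow> v \<in> S" if u: "u \<in> S" for u
  proof -
    obtain x y where xy: "u = (x, y)" by (cases u)
    obtain U V where UV: "openin (Zp_topology p) U" "openin (Zp_topology p) V"
      "x \<in> U" "y \<in> V" "U \<times> V \<subseteq> S"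
      using S[unfolded Zp2_topology_def openin_prod_topology_alt, rule_format, OF u[unfolded xy]]
      by blast
    obtain M where M: "\<forall>x'\<in>carrier (Zp p). x' M = x M \<longrightarrow> x' \<in> U"
      using openin_Zp[OF p_pos, THEN iffD1, OF UV(1)] UV(3) by blast
    obtain N where N: "\<forall>y'\<in>carrier (Zp p). y' N = y N \<longrightarrow> y' \<in> V"
      using openin_Zp[OF p_pos, THEN iffD1, OF UV(2)] UV(4) by blast
    have xyc: "x \<in> carrier (Zp p)" "y \<in> carrier (Zp p)"
      using UV openin_subset[OF UV(1)] openin_subset[OF UV(2)] by (auto simp: topspace_Zp)
    have "v \<in> S" if v: "v \<in> carrier (Zp2 p)" "Zp2_proj (max M N) v = Zp2_proj (max M N) u" for v
    proof -
      obtain x' y' where v': "v = (x', y')" "x' \<in> carrier (Zp p)" "y' \<in> carrier (Zp p)"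
        using v(1) by (auto simp: carrier_Zp2)
      have "x' (max M N) = x (max M N)" "y' (max M N) = y (max M N)"
        using v(2) by (auto simp: Zp2_proj_def v' xy)
      then have "x' M = x M" "y' N = y N"
        using Zp_coherent[OF p_pos v'(2), of M "max M N"] Zp_coherent[OF p_pos xyc(1), of M "max M N"]
          Zp_coherent[OF p_pos v'(3), of N "max M N"] Zp_coherent[OF p_pos xyc(2), of N "max M N"]
        by simp_all
      then show ?thesis using M N v' UV(5) by blast
    qed
    then show ?thesis by blast
  qed
  ultimately show "S \<subseteq> carrier (Zp2 p) \<and>
    (\<forall>u\<in>S. \<exists>N. \<forall>v\<in>carrier (Zp2 p). Zp2_proj N v = Zp2_proj N u \<longrightarrow> v \<in> S)" by blast
next
  assume S: "S \<subseteq> carrier (Zp2 p) \<and>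
    (\<forall>u\<in>S. \<exists>N. \<forall>v\<in>carrier (Zp2 p). Zp2_proj N v = Zp2_proj N u \<longrightarrow> v \<in> S)"
  show "openin (Zp2_topology p) S"
    unfolding Zp2_topology_def openin_prod_topology_alt
  proof (intro allI impI)
    fix x y assume xy: "(x, y) \<in> S"
    then obtain N where N: "\<forall>v\<in>carrier (Zp2 p). Zp2_proj N v = Zp2_proj N (x, y) \<longrightarrow> v \<in> S"
      using S by blast
    let ?C = "\<lambda>z. {z' \<in> carrier (Zp p). z' N = z N}"
    have "x \<in> ?C x" "y \<in> ?C y" using xy S by (auto simp: carrier_Zp2)
    moreover have "?C x \<times> ?C y \<subseteq> S" using N by (auto simp: carrier_Zp2 Zp2_proj_def)
    ultimately show "\<exists>U V. openin (Zp_topology p) U \<and> openin (Zp_topology p) V \<and> x \<in> U \<and> y \<in> V \<and> U \<times> V \<subseteq> S"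
      using Zp_cylinder_open[OF p_pos] by blast
  qed
qed

lemma card_DirProd_integer_mod_group:
  "\<exists>k. card (carrier (integer_mod_group (p ^ N) \<times>\<times> integer_mod_group (p ^ N))) = p ^ k"
  using p_pos by (auto simp: card_cartesian_product card_integer_mod_group simp flip: power_add)

lemmas Zp2_presentation = comm_group_Zp2 prime Zp2_proj_hom card_DirProd_integer_mod_group openin_Zp2

sublocale Z2: abelian_pro_p "Zp2 p" "Zp2_topology p" p
  by (rule abelian_pro_pI(1)[OF Zp2_presentation])

lemma kernel_Zp2_proj:
  "kernel (Zp2 p) (integer_mod_group (p ^ N) \<times>\<times> integer_mod_group (p ^ N)) (Zp2_proj N)
      = pn_Zp p N \<times> pn_Zp p N"
  by (auto simp: kernel_def carrier_Zp2 Zp2_proj_def pn_Zp_eq[OF p_pos])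

lemma open_subgroups_Zp2_iff:
  "H \<in> Z2.\<O> \<longleftrightarrow> subgroup H (Zp2 p) \<and> (\<exists>N. pn_Zp p N \<times> pn_Zp p N \<subseteq> H)"
  using abelian_pro_pI(2)[OF Zp2_presentation, of H] by (simp add: kernel_Zp2_proj)

lemma pow_Zp2: "u [^]\<^bsub>Zp2 p\<^esub> (k::nat) = (fst u [^]\<^bsub>Zp p\<^esub> k, snd u [^]\<^bsub>Zp p\<^esub> k)"
proof -
  have "\<one>\<^bsub>Zp2 p\<^esub> = (\<one>\<^bsub>Zp p\<^esub>, \<one>\<^bsub>Zp p\<^esub>)" by (simp add: Zp2_def)
  then show ?thesis by (induction k) (auto simp: mult_Zp2)
qed

lemma power_subset_subgroup:
  assumes H: "subgroup H (Zp2 p)" and n: "Z2.index H = p ^ n"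
  shows "pn_Zp p n \<times> pn_Zp p n \<subseteq> H"
proof
  fix w assume "w \<in> pn_Zp p n \<times> pn_Zp p n"
  then obtain s t where st: "s \<in> carrier (Zp p)" "t \<in> carrier (Zp p)"
    "w = (s [^]\<^bsub>Zp p\<^esub> (p ^ n), t [^]\<^bsub>Zp p\<^esub> (p ^ n))"
    by (auto simp: pn_Zp_def)
  then have "w = (s, t) [^]\<^bsub>Zp2 p\<^esub> (p ^ n)" by (simp add: pow_Zp2)
  then show "w \<in> H"
    using Z2.pow_index_mem[OF H, of "(s, t)"] st n by (simp add: carrier_Zp2)
qed

section \<open>Lines in the square of the p-adic integers\<close>

definition line_form :: "int \<Rightarrow> int \<Rightarrow> nat \<Rightarrow> (nat \<Rightarrow> int) \<times> (nat \<Rightarrow> int) \<Rightarrow> int" where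
  "line_form a b n = (\<lambda>(x, y). (a * x n + b * y n) mod int p ^ n)"

text \<open>
  The subgroup cut out by the congruence \<open>a * x + b * y = 0\<close> modulo \<open>p ^ n\<close>. For fixed \<open>a\<close>, \<open>b\<close> and
  growing \<open>n\<close> these subgroups shrink to the line \<open>a * x + b * y = 0\<close> in \<open>\<int>\<^sub>p\<^sup>2\<close>.
\<close>

definition line :: "int \<Rightarrow> int \<Rightarrow> nat \<Rightarrow> zp2_subgroup" where
  "line a b n = kernel (Zp2 p) (integer_mod_group (p ^ n)) (line_form a b n)"

lemma mem_line_iff:
  "(x, y) \<in> line a b n \<longleftrightarrow>
    x \<in> carrier (Zp p) \<and> y \<in> carrier (Zp p) \<and> int p ^ n dvd a * x n + b * y n"
  by (auto simp: line_def kernel_def carrier_Zp2 line_form_def dvd_eq_mod_eq_0)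

lemma mod_linear: "(a * (x mod m) + b * (y mod m)) mod m = (a * x + b * y) mod (m :: int)"
  by (metis mod_add_eq mod_mult_right_eq)

lemma line_form_hom: "group_hom (Zp2 p) (integer_mod_group (p ^ n)) (line_form a b n)"
proof -
  have "line_form a b n \<in> hom (Zp2 p) (integer_mod_group (p ^ n))"
  proof (rule homI)
    show "line_form a b n u \<in> carrier (integer_mod_group (p ^ n))" for u
      using p_pos by (auto simp: line_form_def carrier_integer_mod_group split: prod.split)
    show "line_form a b n (u \<otimes>\<^bsub>Zp2 p\<^esub> v)
        = line_form a b n u \<otimes>\<^bsub>integer_mod_group (p ^ n)\<^esub> line_form a b n v" for u v
    proof (cases u; cases v)
      fix x y x' y' assume [simp]: "u = (x, y)" "v = (x', y')"
      show ?thesis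
        by (simp add: line_form_def mult_Zp2 mult_Zp mod_linear mod_add_eq) (simp add: algebra_simps)
    qed
  qed
  then show ?thesis
    using comm_group_Zp2 by (auto simp: group_hom_def group_hom_axioms_def comm_group_def)
qed

lemma line_form_surj:
  assumes ab: "\<not> (int p dvd a \<and> int p dvd b)"
  shows "line_form a b n ` carrier (Zp2 p) = carrier (integer_mod_group (p ^ n))"
proof
  interpret group_hom "Zp2 p" "integer_mod_group (p ^ n)" "line_form a b n"
    by (rule line_form_hom)
  show "line_form a b n ` carrier (Zp2 p) \<subseteq> carrier (integer_mod_group (p ^ n))" by auto
  show "carrier (integer_mod_group (p ^ n)) \<subseteq> line_form a b n ` carrier (Zp2 p)"
  proof
    fix z assume z: "z \<in> carrier (integer_mod_group (p ^ n))"
    have unit: "\<exists>c'. (c * c') mod int p ^ n = 1 mod int p ^ n" if "\<not> int p dvd c" for c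
    proof -
      have "coprime c (int p ^ n)"
        using prime that by (metis coprime_commute coprime_power_left_iff prime_imp_coprime prime_int_nat_transfer prime_nat_int_transfer)
      then obtain u v where "u * c + v * int p ^ n = 1"
        using bezout_int[of c "int p ^ n"] by (metis coprime_imp_gcd_eq_1)
      then have "(c * u) mod int p ^ n = 1 mod int p ^ n"
        by (metis mod_mult_self1 mult.commute mult.assoc add.commute)
      then show ?thesis ..
    qed
    obtain s t where st: "(a * s + b * t) mod int p ^ n = 1 mod int p ^ n"
    proof (cases "int p dvd a")
      case False
      then obtain s where "(a * s) mod int p ^ n = 1 mod int p ^ n" using unit by blast
      then show thesis using that[of s 0] by simp
    next
      case True
      then obtain t where "(b * t) mod int p ^ n = 1 mod int p ^ n" using unit ab by blast
      then show thesis using that[of 0 t] by simp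
    qed
    let ?u = "(Zp_of_int p (s * z), Zp_of_int p (t * z))"
    have "line_form a b n ?u = (a * (s * z) + b * (t * z)) mod int p ^ n"
      by (simp add: line_form_def Zp_of_int_def mod_linear)
    also have "\<dots> = ((a * s + b * t) mod int p ^ n * z) mod int p ^ n"
      by (simp add: mod_simps algebra_simps)
    also have "\<dots> = z mod int p ^ n" unfolding st by (simp add: mod_simps)
    also have "\<dots> = z" using z p_pos by (simp add: carrier_integer_mod_group)
    finally show "z \<in> line_form a b n ` carrier (Zp2 p)"
      using Zp_of_int_mem[OF p_pos] by (metis carrier_Zp2 SigmaI imageI)
  qed
qed

lemma line_subgroup: "subgroup (line a b n) (Zp2 p)"
  unfolding line_def by (rule group_hom.subgroup_kernel[OF line_form_hom])

lemma line_mem: "line a b n \<in> Z2.\<O>"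
proof -
  have "pn_Zp p n \<times> pn_Zp p n \<subseteq> line a b n"
    by (auto simp: mem_line_iff pn_Zp_eq[OF p_pos])
  then show ?thesis using line_subgroup open_subgroups_Zp2_iff by blast
qed

lemma
  assumes "\<not> (int p dvd a \<and> int p dvd b)"
  shows index_line: "Z2.index (line a b n) = p ^ n"
    and cyclic_line: "cyclic_group (Zp2 p Mod line a b n)"
  unfolding line_def
  using group_hom.index_kernel[OF line_form_hom comm_group_Zp2 line_form_surj[OF assms]]
    group_hom.cyclic_quotient_kernel[OF line_form_hom line_form_surj[OF assms] cyclic_integer_mod_group]
    p_pos by (simp_all add: card_integer_mod_group)

lemma line_Suc_subset: "line a b (Suc n) \<subseteq> line a b n"
proof
  fix u assume u: "u \<in> line a b (Suc n)"
  obtain x y where [simp]: "u = (x, y)" by (cases u)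
  have xy: "x \<in> carrier (Zp p)" "y \<in> carrier (Zp p)" "int p ^ Suc n dvd a * x (Suc n) + b * y (Suc n)"
    using u by (auto simp: mem_line_iff)
  have "(a * x n + b * y n) mod int p ^ n = (a * x (Suc n) + b * y (Suc n)) mod int p ^ n"
    using Zp_coherent[OF p_pos xy(1), of n "Suc n"] Zp_coherent[OF p_pos xy(2), of n "Suc n"]
    by (metis le_add2 mod_add_eq mod_mult_right_eq plus_1_eq_Suc)
  also have "\<dots> = 0"
    using xy(3) by (metis dvd_eq_mod_eq_0 dvd_mult_right power_Suc)
  finally show "u \<in> line a b n" using xy by (simp add: mem_line_iff dvd_eq_mod_eq_0)
qed

text \<open>
  Let \<open>\<gamma>\<close> represent a generator of the quotient, of order \<open>p ^ n\<close>, and let \<open>a\<close> and \<open>b\<close> be the exponents of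
  \<open>\<gamma>\<close> that represent the two unit vectors. As \<open>H\<close> contains \<open>p ^ n\<close> times the whole group, the coset of
  \<open>(x, y)\<close> is that of \<open>\<gamma>\<close> to the power \<open>a * x n + b * y n\<close>. Applied to \<open>\<gamma>\<close> itself, this shows that some
  \<open>a * s + b * t\<close> is 1 modulo \<open>p ^ n\<close>. For \<open>n = 0\<close> this says nothing, and \<open>a = 1\<close>, \<open>b = 0\<close> is chosen.
\<close>

lemma cyclic_subgroup_eq_line:
  assumes H: "H \<in> Z2.\<O>" and cyc: "cyclic_group (Zp2 p Mod H)"
  obtains a b n where "\<not> (int p dvd a \<and> int p dvd b)" "H = line a b n"
proof -
  have Hs: "subgroup H (Zp2 p)" using H by (rule Z2.open_subgroupD)
  obtain \<gamma> where \<gamma>: "\<gamma> \<in> carrier (Zp2 p)"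
    and gen: "\<And>x. x \<in> carrier (Zp2 p) \<Longrightarrow> \<exists>i::int. x \<in> H #>\<^bsub>Zp2 p\<^esub> \<gamma> [^]\<^bsub>Zp2 p\<^esub> i"
    and mem: "\<And>K i. subgroup K (Zp2 p) \<Longrightarrow> H \<subseteq> K \<Longrightarrow> \<gamma> [^]\<^bsub>Zp2 p\<^esub> (i::int) \<in> K \<longleftrightarrow> int (Z2.index K) dvd i"
    by (rule Z2.cyclic_quotient_generator[OF Hs cyc]) blast
  obtain n where n: "Z2.index H = p ^ n" using Z2.index_prime_power[OF H] by blast
  show thesis
  proof (cases "n = 0")
    case True
    have "\<not> int p dvd 1" using p_gt_1 by simp
    moreover have "H = carrier (Zp2 p)"
      using Z2.index_antisym[OF Hs Z2.subgroup_self subgroup.subset[OF Hs]] n True Z2.index_carrier by simp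
    moreover have "line 1 0 0 = carrier (Zp2 p)"
      by (auto simp: mem_line_iff carrier_Zp2)
    ultimately show thesis using that[of 1 0 0] by blast
  next
    case False
    \<comment> \<open>The unit vectors; the exponents \<open>a\<close>, \<open>b\<close> below are the coefficients of the line.\<close>
    define e1 where "e1 = (Zp_of_int p 1, Zp_of_int p 0)"
    define e2 where "e2 = (Zp_of_int p 0, Zp_of_int p 1)"
    have e: "e1 \<in> carrier (Zp2 p)" "e2 \<in> carrier (Zp2 p)"
      using Zp_of_int_mem[OF p_pos] by (auto simp: e1_def e2_def carrier_Zp2)
    obtain a :: int where a: "e1 \<in> H #>\<^bsub>Zp2 p\<^esub> \<gamma> [^]\<^bsub>Zp2 p\<^esub> a" using gen e by blast
    obtain b :: int where b: "e2 \<in> H #>\<^bsub>Zp2 p\<^esub> \<gamma> [^]\<^bsub>Zp2 p\<^esub> b" using gen e by blast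
    have coset: "H #>\<^bsub>Zp2 p\<^esub> u = H #>\<^bsub>Zp2 p\<^esub> \<gamma> [^]\<^bsub>Zp2 p\<^esub> (a * fst u n + b * snd u n)"
      if u: "u \<in> carrier (Zp2 p)" for u
    proof -
      interpret H: normal H "Zp2 p" using Hs by (rule Z2.subgroup_imp_normal)
      interpret pr: group_hom "Zp2 p" "integer_mod_group (p ^ n) \<times>\<times> integer_mod_group (p ^ n)" "Zp2_proj n"
        by (rule Zp2_proj_hom)
      obtain x y where xy: "u = (x, y)" "x \<in> carrier (Zp p)" "y \<in> carrier (Zp p)"
        using u by (auto simp: carrier_Zp2)
      define k l where "k = nat (x n)" and "l = nat (y n)"
      have kl: "int k = x n" "int l = y n" "int k < int p ^ n" "int l < int p ^ n"
        using xy carrier_Zp[OF p_pos] by (auto simp: k_def l_def)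
      define v where "v = e1 [^]\<^bsub>Zp2 p\<^esub> k \<otimes>\<^bsub>Zp2 p\<^esub> e2 [^]\<^bsub>Zp2 p\<^esub> l"
      have v: "v \<in> carrier (Zp2 p)" using e by (simp add: v_def)
      have "Zp2_proj n v = Zp2_proj n u"
        using kl by (simp add: v_def e1_def e2_def pow_Zp2 mult_Zp2 mult_Zp pow_Zp[OF p_pos] Zp2_proj_def
            Zp_of_int_def xy mod_mult_right_eq)
      then have "u \<otimes>\<^bsub>Zp2 p\<^esub> inv\<^bsub>Zp2 p\<^esub> v \<in> kernel (Zp2 p) (integer_mod_group (p ^ n) \<times>\<times> integer_mod_group (p ^ n)) (Zp2_proj n)"
        using u v pr.H.r_inv[OF pr.hom_closed[OF u]] by (simp add: kernel_def del: one_DirProd)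
      then have "u \<otimes>\<^bsub>Zp2 p\<^esub> inv\<^bsub>Zp2 p\<^esub> v \<in> H"
        using kernel_Zp2_proj power_subset_subgroup[OF Hs n] by blast
      then have "u \<in> H #>\<^bsub>Zp2 p\<^esub> v"
        using subgroup.rcos_module[OF Hs Z2.is_group v u] by simp
      then have "H #>\<^bsub>Zp2 p\<^esub> u = H #>\<^bsub>Zp2 p\<^esub> v"
        using Z2.repr_independence[OF _ v Hs] by simp
      also have "\<dots> = (H #>\<^bsub>Zp2 p\<^esub> e1) [^]\<^bsub>Zp2 p Mod H\<^esub> k \<otimes>\<^bsub>Zp2 p Mod H\<^esub> (H #>\<^bsub>Zp2 p\<^esub> e2) [^]\<^bsub>Zp2 p Mod H\<^esub> l"
        using e by (simp add: v_def H.FactGroup_pow H.rcos_sum)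
      also have "H #>\<^bsub>Zp2 p\<^esub> e1 = H #>\<^bsub>Zp2 p\<^esub> \<gamma> [^]\<^bsub>Zp2 p\<^esub> a"
        using Z2.repr_independence[OF a _ Hs] \<gamma> by simp
      also have "H #>\<^bsub>Zp2 p\<^esub> e2 = H #>\<^bsub>Zp2 p\<^esub> \<gamma> [^]\<^bsub>Zp2 p\<^esub> b"
        using Z2.repr_independence[OF b _ Hs] \<gamma> by simp
      also have "(H #>\<^bsub>Zp2 p\<^esub> \<gamma> [^]\<^bsub>Zp2 p\<^esub> a) [^]\<^bsub>Zp2 p Mod H\<^esub> k \<otimes>\<^bsub>Zp2 p Mod H\<^esub> (H #>\<^bsub>Zp2 p\<^esub> \<gamma> [^]\<^bsub>Zp2 p\<^esub> b) [^]\<^bsub>Zp2 p Mod H\<^esub> l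
          = H #>\<^bsub>Zp2 p\<^esub> ((\<gamma> [^]\<^bsub>Zp2 p\<^esub> a) [^]\<^bsub>Zp2 p\<^esub> k \<otimes>\<^bsub>Zp2 p\<^esub> (\<gamma> [^]\<^bsub>Zp2 p\<^esub> b) [^]\<^bsub>Zp2 p\<^esub> l)"
        using \<gamma> by (simp add: H.FactGroup_pow H.rcos_sum)
      also have "(\<gamma> [^]\<^bsub>Zp2 p\<^esub> a) [^]\<^bsub>Zp2 p\<^esub> k \<otimes>\<^bsub>Zp2 p\<^esub> (\<gamma> [^]\<^bsub>Zp2 p\<^esub> b) [^]\<^bsub>Zp2 p\<^esub> l
          = \<gamma> [^]\<^bsub>Zp2 p\<^esub> (a * int k + b * int l)"
        using \<gamma> by (simp add: Z2.int_pow_mult Z2.int_pow_pow flip: int_pow_int)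
      finally show ?thesis by (simp add: kl xy)
    qed
    have in_H: "H #>\<^bsub>Zp2 p\<^esub> u = H \<longleftrightarrow> u \<in> H" if "u \<in> carrier (Zp2 p)" for u
      using Z2.coset_join1[of H u] Z2.coset_join2[of u H] Hs that subgroup.subset[OF Hs] by blast
    have "u \<in> H \<longleftrightarrow> u \<in> line a b n" if u: "u \<in> carrier (Zp2 p)" for u
    proof -
      have "u \<in> H \<longleftrightarrow> \<gamma> [^]\<^bsub>Zp2 p\<^esub> (a * fst u n + b * snd u n) \<in> H"
        using in_H[OF u] in_H[of "\<gamma> [^]\<^bsub>Zp2 p\<^esub> (a * fst u n + b * snd u n)"] coset[OF u] \<gamma> by simp
      also have "\<dots> \<longleftrightarrow> int p ^ n dvd a * fst u n + b * snd u n"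
        using mem[OF Hs subset_refl] n by simp
      also have "\<dots> \<longleftrightarrow> u \<in> line a b n"
        using u by (cases u) (simp add: mem_line_iff carrier_Zp2)
      finally show ?thesis .
    qed
    then have "H = line a b n"
      using subgroup.subset[OF Hs] subgroup.subset[OF line_subgroup] by blast
    moreover have "\<not> (int p dvd a \<and> int p dvd b)"
    proof
      assume ab: "int p dvd a \<and> int p dvd b"
      define m where "m = a * fst \<gamma> n + b * snd \<gamma> n"
      have "\<gamma> \<in> H #>\<^bsub>Zp2 p\<^esub> \<gamma> [^]\<^bsub>Zp2 p\<^esub> m"
        using coset[OF \<gamma>] Z2.rcos_self[OF \<gamma> Hs] by (simp add: m_def)
      then have "\<gamma> \<otimes>\<^bsub>Zp2 p\<^esub> inv\<^bsub>Zp2 p\<^esub> (\<gamma> [^]\<^bsub>Zp2 p\<^esub> m) \<in> H"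
        using subgroup.rcos_module[OF Hs Z2.is_group _ \<gamma>] \<gamma> by simp
      then have "\<gamma> [^]\<^bsub>Zp2 p\<^esub> (1 - m) \<in> H"
        using \<gamma> by (simp add: Z2.int_pow_diff Z2.int_pow_1)
      then have "int p ^ n dvd 1 - m" using mem[OF Hs subset_refl] n by simp
      then have "int p dvd 1 - m" using False by (meson dvd_power dvd_trans not_gr_zero)
      moreover have "int p dvd m" using ab by (auto simp: m_def)
      ultimately have "int p dvd 1" by (metis diff_add_cancel dvd_add)
      then show False using p_gt_1 by simp
    qed
    ultimately show thesis using that by blast
  qed
qed

end

section \<open>Paths in the tree\<close>

context p_adic
begin

lemma tree_vertexD:
  assumes "H \<in> tree_vertices p"
  shows "H \<in> Z2.\<O>" "subgroup H (Zp2 p)" "cyclic_group (Zp2 p Mod H)"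
  using assms Z2.open_subgroupD by (auto simp: tree_vertices_def)

lemma tree_adj_iff:
  "tree_adj p U T \<longleftrightarrow> U \<in> tree_vertices p \<and> T \<in> tree_vertices p \<and>
    (T \<subseteq> U \<and> Z2.index T = p * Z2.index U \<or> U \<subseteq> T \<and> Z2.index U = p * Z2.index T)"
  using tree_vertexD(2)
  by (auto simp: tree_adj_def Z2.G_set_le_iff Z2.G_set_card_eq_index)

lemma path_vertex: "x \<in> P1_Qp p \<Longrightarrow> x n \<in> tree_vertices p"
  by (auto simp: P1_Qp_def tree_adj_iff)

text \<open>
  A path moves away from the root in each step. Otherwise let \<open>x (Suc (Suc n))\<close> be the first vertex
  that lies above its predecessor; then it has the same index as \<open>x n\<close>, and both lie above
  \<open>x (Suc n)\<close>, so they are equal because the quotient by \<open>x (Suc n)\<close> is cyclic.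
\<close>

lemma path_descends:
  assumes x: "x \<in> P1_Qp p"
  shows "Z2.index (x n) = p ^ n \<and> Z2.index (x (Suc n)) = p ^ Suc n \<and> x (Suc n) \<subseteq> x n"
proof (induction n)
  case 0
  have "x 0 = carrier (Zp2 p)" "tree_adj p (x 0) (x (Suc 0))" using x unfolding P1_Qp_def by blast+
  then show ?case using p_gt_1 by (auto simp: tree_adj_iff Z2.index_carrier)
next
  case (Suc n)
  have adj: "tree_adj p (x (Suc n)) (x (Suc (Suc n)))" and no_return: "x (Suc (Suc n)) \<noteq> x n"
    using x by (auto simp: P1_Qp_def)
  have False if up: "x (Suc n) \<subseteq> x (Suc (Suc n))" "Z2.index (x (Suc n)) = p * Z2.index (x (Suc (Suc n)))"
  proof -
    have "Z2.index (x (Suc (Suc n))) = Z2.index (x n)" using up(2) Suc p_pos by simp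
    then have "x (Suc (Suc n)) = x n"
      using Z2.subgroup_above_cyclic_unique[of "x (Suc n)" "x (Suc (Suc n))" "x n"]
        tree_vertexD[OF path_vertex[OF x, of "Suc n"]] tree_vertexD[OF path_vertex[OF x, of "Suc (Suc n)"]]
        tree_vertexD[OF path_vertex[OF x, of n]] up(1) Suc by blast
    then show False using no_return by blast
  qed
  then show ?case using adj Suc by (auto simp: tree_adj_iff)
qed

lemma path_index: "x \<in> P1_Qp p \<Longrightarrow> Z2.index (x n) = p ^ n"
  using path_descends by blast

lemma path_mem: "x \<in> P1_Qp p \<Longrightarrow> x n \<in> Z2.\<O>"
  using path_vertex tree_vertexD(1) by blast

lemma path_antimono: "x \<in> P1_Qp p \<Longrightarrow> i \<le> n \<Longrightarrow> x n \<subseteq> x i"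
  by (rule lift_Suc_antimono_le[of x]) (use path_descends in blast)+

lemma path_above:
  assumes x: "x \<in> P1_Qp p"
  shows "Z2.above (x n) = x ` {..n}"
proof (rule Z2.above_eq_chain)
  show "x i \<in> Z2.above (x n)" if "i \<le> n" for i
    using path_antimono[OF x that] path_mem[OF x] by (intro Z2.aboveI Z2.open_subgroupD)
qed (use x path_mem path_index tree_vertexD(3)[OF path_vertex] in auto)

lemma path_index_inj:
  assumes "x \<in> P1_Qp p" "y \<in> P1_Qp p" "x i = y j"
  shows "i = j"
proof -
  have "p ^ i = p ^ j" using path_index assms by metis
  then show ?thesis using p_gt_1 by simp
qed

lemma path_agree_below:
  assumes x: "x \<in> P1_Qp p" and y: "y \<in> P1_Qp p" and eq: "x n = y n" and i: "i \<le> n"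
  shows "x i = y i"
proof -
  have "x i \<in> y ` {..n}" using path_above[OF x, of n] path_above[OF y, of n] eq i by auto
  then obtain j where "x i = y j" by blast
  then show ?thesis using path_index_inj[OF x y] by metis
qed

lemma line_in_P1:
  assumes ab: "\<not> (int p dvd a \<and> int p dvd b)"
  shows "line a b \<in> P1_Qp p"
proof -
  have v: "line a b n \<in> tree_vertices p" for n
    using line_mem cyclic_line[OF ab] by (simp add: tree_vertices_def)
  have "line a b 0 = carrier (Zp2 p)" by (auto simp: mem_line_iff carrier_Zp2)
  moreover have "tree_adj p (line a b n) (line a b (Suc n))" for n
    using v line_Suc_subset by (simp add: tree_adj_iff index_line[OF ab])
  moreover have "line a b (Suc (Suc n)) \<noteq> line a b n" for n
  proof
    assume "line a b (Suc (Suc n)) = line a b n"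
    then have "p ^ Suc (Suc n) = p ^ n" using index_line[OF ab] by metis
    then show False using p_gt_1 power_inject_exp[of p "Suc (Suc n)" n] by simp
  qed
  ultimately show ?thesis by (simp add: P1_Qp_def)
qed

lemma vertex_on_path:
  assumes "H \<in> tree_vertices p"
  obtains x n where "x \<in> P1_Qp p" "x n = H"
proof -
  obtain a b n where "\<not> (int p dvd a \<and> int p dvd b)" "H = line a b n"
    using cyclic_subgroup_eq_line tree_vertexD(1,3)[OF assms] by blast
  then show thesis using that line_in_P1 by blast
qed

text \<open>
  The two paths agree up to some vertex \<open>n\<close> and are disjoint afterwards, so their common edges are the
  first \<open>n\<close>. An edge of one path cannot be an edge of the other traversed backwards, since the index
  grows along both.
\<close>

lemma P1_dist_eq:
  assumes x: "x \<in> P1_Qp p" and y: "y \<in> P1_Qp p" and "x \<noteq> y"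
  obtains n where "\<And>i. x i = y i \<longleftrightarrow> i \<le> n" "P1_dist p x y = 1 / real p ^ n"
proof -
  have ex: "\<exists>m. x m \<noteq> y m" using \<open>x \<noteq> y\<close> by auto
  define m where "m = (LEAST m. x m \<noteq> y m)"
  have m: "x m \<noteq> y m" unfolding m_def using ex by (rule LeastI_ex)
  have "x 0 = y 0" using x y by (simp add: P1_Qp_def)
  then obtain n where n: "m = Suc n" using m by (cases m) auto
  have agree: "x i = y i \<longleftrightarrow> i \<le> n" for i
  proof
    show "i \<le> n" if "x i = y i"
      using path_agree_below[OF x y that, of m] m n by (metis not_less_eq_eq)
    show "x i = y i" if "i \<le> n"
      using that not_less_Least[of i "\<lambda>m. x m \<noteq> y m"] n by (auto simp: m_def)
  qed
  have "path_edges x \<inter> path_edges y = (\<lambda>i. {x i, x (Suc i)}) ` {..<n}"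
  proof (intro equalityI subsetI)
    fix e assume "e \<in> path_edges x \<inter> path_edges y"
    then obtain i j where e: "e = {x i, x (Suc i)}" "{x i, x (Suc i)} = {y j, y (Suc j)}"
      by (auto simp: path_edges_def)
    have "x i = y j \<and> x (Suc i) = y (Suc j)"
    proof (rule ccontr)
      assume "\<not> ?thesis"
      then have "x i = y (Suc j)" "x (Suc i) = y j" using e(2) by (auto simp: doubleton_eq_iff)
      then show False using path_index_inj[OF x y, of i "Suc j"] path_index_inj[OF x y, of "Suc i" j] by simp
    qed
    then have "x (Suc i) = y (Suc i)" using path_index_inj[OF x y] by blast
    then have "Suc i \<le> n" using agree by blast
    then show "e \<in> (\<lambda>i. {x i, x (Suc i)}) ` {..<n}" unfolding e(1) by (intro imageI) simp
  next
    fix e assume "e \<in> (\<lambda>i. {x i, x (Suc i)}) ` {..<n}"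
    then obtain i where i: "i < n" "e = {x i, x (Suc i)}" by blast
    have "x i = y i" "x (Suc i) = y (Suc i)" unfolding agree using i by auto
    then show "e \<in> path_edges x \<inter> path_edges y" using i(2) by (auto simp: path_edges_def)
  qed
  moreover have "inj_on (\<lambda>i. {x i, x (Suc i)}) {..<n}"
  proof (rule inj_onI)
    fix i j assume "{x i, x (Suc i)} = {x j, x (Suc j)}"
    then have "x i = x j \<or> x i = x (Suc j) \<and> x (Suc i) = x j" by (auto simp: doubleton_eq_iff)
    then show "i = j"
      using path_index_inj[OF x x, of i j] path_index_inj[OF x x, of i "Suc j"]
        path_index_inj[OF x x, of "Suc i" j] by auto
  qed
  ultimately have "card (path_edges x \<inter> path_edges y) = n"
    by (simp add: card_image)
  then show thesis using that[OF agree] \<open>x \<noteq> y\<close> by (simp add: P1_dist_def)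
qed

section \<open>Lipschitz functions on the boundary\<close>

lemma witt_vectors_eq: "witt_vectors p = witt_burnside_ring (Zp p) (Zp_topology p)"
  by (simp add: witt_vectors_def)

lemma witt_norm_le_iff:
  assumes w: "w \<in> carrier (witt_vectors p)"
  shows "witt_norm p w \<le> 1 / real p ^ Suc n \<longleftrightarrow> (\<forall>i\<le>n. w (pn_Zp p i) = 0)"
proof (cases "w = \<zero>\<^bsub>witt_vectors p\<^esub>")
  case True
  then show ?thesis
    using pn_Zp_mem by (simp add: witt_norm_def witt_vectors_eq Z.witt_burnside_ring_simps)
next
  case False
  have "\<exists>m. w (pn_Zp p m) \<noteq> 0"
  proof (rule ccontr)
    assume "\<not> ?thesis"
    then have "w = \<zero>\<^bsub>witt_vectors p\<^esub>"
      using w open_subgroups_Zp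
      by (intro Z.extensional_eqI) (auto simp: witt_vectors_eq Z.witt_burnside_ring_simps)
    then show False using False by blast
  qed
  define m where "m = (LEAST m. w (pn_Zp p m) \<noteq> 0)"
  have m: "w (pn_Zp p m) \<noteq> 0"
    unfolding m_def using \<open>\<exists>m. w (pn_Zp p m) \<noteq> 0\<close> by (rule LeastI_ex)
  have "witt_norm p w \<le> 1 / real p ^ Suc n \<longleftrightarrow> real p ^ Suc n \<le> real p ^ m"
    using False p_pos by (simp add: witt_norm_def m_def divide_simps del: power_Suc)
  also have "\<dots> \<longleftrightarrow> Suc n \<le> m"
    using p_gt_1 by (simp del: power_Suc)
  also have "\<dots> \<longleftrightarrow> (\<forall>i\<le>n. w (pn_Zp p i) = 0)"
    using m not_less_Least[of _ "\<lambda>m. w (pn_Zp p m) \<noteq> 0"]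
    by (metis le_imp_less_Suc less_le_trans m_def not_less_eq_eq)
  finally show ?thesis .
qed

text \<open>
  For paths that agree exactly in the vertices \<open>0, ..., n\<close>, the Lipschitz bound is \<open>1 / p ^ Suc n\<close>. By
  \<open>witt_norm_le_iff\<close> and \<open>minus_vanishes_above_iff\<close> it says that the values agree in the components
  \<open>0, ..., n\<close>.
\<close>

lemma Lip_ring_carrier_iff:
  fixes f :: "(nat \<Rightarrow> zp2_subgroup) \<Rightarrow> (nat \<Rightarrow> int) set \<Rightarrow> 'k::comm_ring_1"
  shows "f \<in> carrier (Lip_ring p (1 / real p)) \<longleftrightarrow>
    f \<in> P1_Qp p \<rightarrow>\<^sub>E carrier (witt_vectors p) \<and>
    (\<forall>x\<in>P1_Qp p. \<forall>y\<in>P1_Qp p. \<forall>n. x n = y n \<longrightarrow> f x (pn_Zp p n) = f y (pn_Zp p n))"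
proof -
  let ?W = "witt_vectors p :: ((nat \<Rightarrow> int) set \<Rightarrow> 'k) ring"
  interpret W: cring ?W
    unfolding witt_vectors_eq by (rule Z.cring_witt_burnside_ring)
  have key: "witt_norm p (f x \<ominus>\<^bsub>?W\<^esub> f y) \<le> 1 / real p * P1_dist p x y \<longleftrightarrow>
      (\<forall>n. x n = y n \<longrightarrow> f x (pn_Zp p n) = f y (pn_Zp p n))"
    if f: "f \<in> P1_Qp p \<rightarrow>\<^sub>E carrier ?W" and x: "x \<in> P1_Qp p" and y: "y \<in> P1_Qp p" for x y
  proof (cases "x = y")
    case True
    have "f y \<in> carrier ?W" using f y by auto
    then have "f y \<ominus>\<^bsub>?W\<^esub> f y = \<zero>\<^bsub>?W\<^esub>" by (simp add: W.minus_eq W.r_neg)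
    then show ?thesis using True by (simp add: witt_norm_def P1_dist_def)
  next
    case False
    have fxy: "f x \<in> carrier ?W" "f y \<in> carrier ?W" using f x y by auto
    obtain n where n: "\<And>i. x i = y i \<longleftrightarrow> i \<le> n" "P1_dist p x y = 1 / real p ^ n"
      using P1_dist_eq[OF x y False] by blast
    have "witt_norm p (f x \<ominus>\<^bsub>?W\<^esub> f y) \<le> 1 / real p * P1_dist p x y
        \<longleftrightarrow> witt_norm p (f x \<ominus>\<^bsub>?W\<^esub> f y) \<le> 1 / real p ^ Suc n"
      by (simp add: n)
    also have "\<dots> \<longleftrightarrow> (\<forall>i\<le>n. (f x \<ominus>\<^bsub>?W\<^esub> f y) (pn_Zp p i) = 0)"
      using fxy by (intro witt_norm_le_iff W.minus_closed)
    also have "\<dots> \<longleftrightarrow> (\<forall>i\<le>n. f x (pn_Zp p i) = f y (pn_Zp p i))"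
      using Z.minus_vanishes_above_iff[OF pn_Zp_mem, of "f x" "f y" n] fxy
      unfolding above_pn_Zp by (simp add: witt_vectors_eq Z.witt_burnside_ring_simps) (simp add: Ball_def)
    finally show ?thesis unfolding n(1) .
  qed
  have "f \<in> carrier (Lip_ring p (1 / real p)) \<longleftrightarrow> f \<in> P1_Qp p \<rightarrow>\<^sub>E carrier ?W \<and>
      (\<forall>x\<in>P1_Qp p. \<forall>y\<in>P1_Qp p. witt_norm p (f x \<ominus>\<^bsub>?W\<^esub> f y) \<le> 1 / real p * P1_dist p x y)"
    by (simp add: Lip_ring_def)
  also have "\<dots> \<longleftrightarrow> f \<in> P1_Qp p \<rightarrow>\<^sub>E carrier ?W \<and>
      (\<forall>x\<in>P1_Qp p. \<forall>y\<in>P1_Qp p. \<forall>n. x n = y n \<longrightarrow> f x (pn_Zp p n) = f y (pn_Zp p n))"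
    by (intro conj_cong ball_cong refl key)
  finally show ?thesis .
qed

section \<open>Restriction to the paths\<close>

text \<open>
  The map \<open>\<psi>\<close> of \<open>pro_p_pullback\<close> that belongs to a path: it sends \<open>p ^ n \<int>\<^sub>p\<close> to the \<open>n\<close>-th vertex.
\<close>

definition on_path :: "(nat \<Rightarrow> zp2_subgroup) \<Rightarrow> (nat \<Rightarrow> int) set \<Rightarrow> zp2_subgroup" where
  "on_path x T = x (inv_into UNIV (pn_Zp p) T)"

lemma on_path_pn_Zp [simp]: "on_path x (pn_Zp p n) = x n"
  by (simp add: on_path_def inv_f_f[OF inj_pn_Zp])

lemma pullback_on_path:
  assumes x: "x \<in> P1_Qp p"
  shows "pro_p_pullback (Zp2 p) (Zp2_topology p) p (Zp p) (Zp_topology p) (on_path x)"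
proof (unfold_locales)
  show "on_path x T \<in> Z2.\<O>" if "T \<in> Z.\<O>" for T
    using that path_mem[OF x] by (auto simp: open_subgroups_Zp)
  show "Z2.above (on_path x T) = on_path x ` Z.above T" if "T \<in> Z.\<O>" for T
    using that path_above[OF x] by (auto simp: open_subgroups_Zp above_pn_Zp image_image)
  show "inj_on (on_path x) Z.\<O>"
    by (rule inj_onI) (auto simp: open_subgroups_Zp dest!: path_index_inj[OF x x])
  show "Z2.index (on_path x T) = Z.index T" if "T \<in> Z.\<O>" for T
    using that path_index[OF x] by (auto simp: open_subgroups_Zp index_pn_Zp)
qed

definition boundary_map ::
    "(zp2_subgroup \<Rightarrow> 'k) \<Rightarrow> (nat \<Rightarrow> zp2_subgroup) \<Rightarrow> (nat \<Rightarrow> int) set \<Rightarrow> 'k" where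
  "boundary_map a = (\<lambda>x\<in>P1_Qp p. \<lambda>T\<in>Z.\<O>. a (on_path x T))"

lemma boundary_map_apply: "x \<in> P1_Qp p \<Longrightarrow> boundary_map a x (pn_Zp p n) = a (x n)"
  using pn_Zp_mem by (simp add: boundary_map_def)

lemma boundary_map_hom:
  "boundary_map \<in> ring_hom (W_Zp2 p :: (zp2_subgroup \<Rightarrow> 'k::comm_ring_1) ring) (Lip_ring p (1 / real p))"
proof (rule ring_hom_memI)
  note hom = pro_p_pullback.pullback_ring_hom[OF pullback_on_path, where ?'c = 'k]
  fix a b :: "zp2_subgroup \<Rightarrow> 'k"
  assume a: "a \<in> carrier (W_Zp2 p)"
  show "boundary_map a \<in> carrier (Lip_ring p (1 / real p))"
    unfolding Lip_ring_carrier_iff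
    by (auto simp: boundary_map_apply)
       (auto simp: boundary_map_def witt_vectors_eq Z.witt_burnside_ring_simps)
  assume b: "b \<in> carrier (W_Zp2 p)"
  show "boundary_map (a \<otimes>\<^bsub>W_Zp2 p\<^esub> b) = boundary_map a \<otimes>\<^bsub>Lip_ring p (1 / real p)\<^esub> boundary_map b"
    using ring_hom_mult[OF hom] a b
    by (auto simp: boundary_map_def Lip_ring_def W_Zp2_def witt_vectors_eq intro!: restrict_ext)
  show "boundary_map (a \<oplus>\<^bsub>W_Zp2 p\<^esub> b) = boundary_map a \<oplus>\<^bsub>Lip_ring p (1 / real p)\<^esub> boundary_map b"
    using ring_hom_add[OF hom] a b
    by (auto simp: boundary_map_def Lip_ring_def W_Zp2_def witt_vectors_eq intro!: restrict_ext)
next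
  show "boundary_map \<one>\<^bsub>(W_Zp2 p :: (zp2_subgroup \<Rightarrow> 'k) ring)\<^esub> = \<one>\<^bsub>Lip_ring p (1 / real p)\<^esub>"
    using ring_hom_one[OF pro_p_pullback.pullback_ring_hom[OF pullback_on_path, where ?'c = 'k]]
    by (auto simp: boundary_map_def Lip_ring_def W_Zp2_def witt_vectors_eq intro!: restrict_ext)
qed

lemma boundary_map_zero:
  "boundary_map \<zero>\<^bsub>(W_Zp2 p :: (zp2_subgroup \<Rightarrow> 'k::comm_ring_1) ring)\<^esub> = \<zero>\<^bsub>Lip_ring p (1 / real p)\<^esub>"
  using pro_p_pullback.mem[OF pullback_on_path]
  by (auto simp: boundary_map_def Lip_ring_def W_Zp2_def witt_vectors_eq
      Z.witt_burnside_ring_simps Z2.witt_burnside_ring_simps intro!: restrict_ext)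

text \<open>
  A Lipschitz function \<open>f\<close> prescribes the coordinate at \<open>x n\<close> as the \<open>n\<close>-th component of \<open>f x\<close>. The Lipschitz
  condition says that this does not depend on the path through the vertex.
\<close>

lemma boundary_map_surj:
  "boundary_map ` carrier (W_Zp2 p) = carrier (Lip_ring p (1 / real p) ::
     ((nat \<Rightarrow> zp2_subgroup) \<Rightarrow> (nat \<Rightarrow> int) set \<Rightarrow> 'k::comm_ring_1) ring)"
proof
  show "boundary_map ` carrier (W_Zp2 p) \<subseteq> carrier (Lip_ring p (1 / real p) ::
     ((nat \<Rightarrow> zp2_subgroup) \<Rightarrow> (nat \<Rightarrow> int) set \<Rightarrow> 'k) ring)"
    using ring_hom_closed[OF boundary_map_hom] by blast
next
  show "carrier (Lip_ring p (1 / real p) :: ((nat \<Rightarrow> zp2_subgroup) \<Rightarrow> (nat \<Rightarrow> int) set \<Rightarrow> 'k) ring)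
    \<subseteq> boundary_map ` carrier (W_Zp2 p)"
  proof
    fix f :: "(nat \<Rightarrow> zp2_subgroup) \<Rightarrow> (nat \<Rightarrow> int) set \<Rightarrow> 'k"
    assume "f \<in> carrier (Lip_ring p (1 / real p))"
    then have f: "f \<in> P1_Qp p \<rightarrow>\<^sub>E carrier (witt_vectors p)"
      and agree: "\<And>x y n. x \<in> P1_Qp p \<Longrightarrow> y \<in> P1_Qp p \<Longrightarrow> x n = y n \<Longrightarrow> f x (pn_Zp p n) = f y (pn_Zp p n)"
      unfolding Lip_ring_carrier_iff by blast+
    define g where "g T = (SOME c. \<exists>x\<in>P1_Qp p. \<exists>n. x n = T \<and> c = f x (pn_Zp p n))" for T
    have g: "g (x n) = f x (pn_Zp p n)" if x: "x \<in> P1_Qp p" for x n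
      unfolding g_def
    proof (rule some_equality)
      show "\<exists>y\<in>P1_Qp p. \<exists>m. y m = x n \<and> f x (pn_Zp p n) = f y (pn_Zp p m)" using x by blast
      fix c assume "\<exists>y\<in>P1_Qp p. \<exists>m. y m = x n \<and> c = f y (pn_Zp p m)"
      then obtain y m where y: "y \<in> P1_Qp p" "y m = x n" "c = f y (pn_Zp p m)" by blast
      then have "m = n" using path_index_inj[OF y(1) x] by blast
      then show "c = f x (pn_Zp p n)" using agree[OF y(1) x] y by simp
    qed
    let ?a = "restrict g Z2.\<O>"
    have "boundary_map ?a x = f x" if x: "x \<in> P1_Qp p" for x
    proof (rule Z.extensional_eqI)
      show "boundary_map ?a x \<in> Z.\<O> \<rightarrow>\<^sub>E UNIV" using x by (simp add: boundary_map_def)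
      show "f x \<in> Z.\<O> \<rightarrow>\<^sub>E UNIV"
        using f x by (auto simp: witt_vectors_eq Z.witt_burnside_ring_simps)
      fix T assume "T \<in> Z.\<O>"
      then obtain n where "T = pn_Zp p n" by (auto simp: open_subgroups_Zp)
      then show "boundary_map ?a x T = f x T"
        using path_mem[OF x] by (simp add: boundary_map_apply[OF x] g[OF x])
    qed
    then have "boundary_map ?a = f"
      using f by (intro extensionalityI[of _ "P1_Qp p"]) (auto simp: boundary_map_def PiE_def)
    moreover have "?a \<in> carrier (W_Zp2 p)"
      by (simp add: W_Zp2_def Z2.witt_burnside_ring_simps)
    ultimately show "f \<in> boundary_map ` carrier (W_Zp2 p)" by blast
  qed
qed

lemma boundary_map_kernel:
  "a_kernel (W_Zp2 p) (Lip_ring p (1 / real p)) boundary_map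
    = (cyclic_vanishing p :: (zp2_subgroup \<Rightarrow> 'k::comm_ring_1) set)"
proof -
  have "boundary_map a = \<zero>\<^bsub>Lip_ring p (1 / real p)\<^esub> \<longleftrightarrow> (\<forall>T\<in>tree_vertices p. a T = 0)"
    for a :: "zp2_subgroup \<Rightarrow> 'k"
  proof
    assume eq: "boundary_map a = \<zero>\<^bsub>Lip_ring p (1 / real p)\<^esub>"
    show "\<forall>T\<in>tree_vertices p. a T = 0"
    proof
      fix T assume "T \<in> tree_vertices p"
      then obtain x n where x: "x \<in> P1_Qp p" "x n = T" by (rule vertex_on_path)
      have "boundary_map a x (pn_Zp p n) = 0"
        using eq x pn_Zp_mem by (simp add: Lip_ring_def witt_vectors_eq Z.witt_burnside_ring_simps)
      then show "a T = 0" using boundary_map_apply[OF x(1)] x(2) by metis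
    qed
  next
    assume "\<forall>T\<in>tree_vertices p. a T = 0"
    then have "a (on_path x T) = 0" if "x \<in> P1_Qp p" "T \<in> Z.\<O>" for x T
      using that path_vertex by (auto simp: on_path_def)
    then show "boundary_map a = \<zero>\<^bsub>Lip_ring p (1 / real p)\<^esub>"
      by (auto simp: boundary_map_def Lip_ring_def witt_vectors_eq Z.witt_burnside_ring_simps
          intro!: restrict_ext)
  qed
  then show ?thesis
    by (auto simp: a_kernel_def' cyclic_vanishing_def)
qed

end

theorem theorem5p10:
  fixes p :: nat
  assumes "prime p"
    and "CHAR('k::field) = p"
  shows "ideal (cyclic_vanishing p) (W_Zp2 p :: (zp2_subgroup \<Rightarrow> 'k) ring)
    \<and> cring (Lip_ring p (1 / real p) ::
        ((nat \<Rightarrow> zp2_subgroup) \<Rightarrow> (nat \<Rightarrow> int) set \<Rightarrow> 'k) ring)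
    \<and> (W_Zp2 p :: (zp2_subgroup \<Rightarrow> 'k) ring) Quot (cyclic_vanishing p)
      \<simeq> (Lip_ring p (1 / real p) ::
        ((nat \<Rightarrow> zp2_subgroup) \<Rightarrow> (nat \<Rightarrow> int) set \<Rightarrow> 'k) ring)"
proof -
  interpret p_adic p using assms(1) by unfold_locales
  let ?R = "W_Zp2 p :: (zp2_subgroup \<Rightarrow> 'k) ring"
  let ?L = "Lip_ring p (1 / real p) :: ((nat \<Rightarrow> zp2_subgroup) \<Rightarrow> (nat \<Rightarrow> int) set \<Rightarrow> 'k) ring"
  interpret R: cring ?R
    unfolding W_Zp2_def by (rule Z2.cring_witt_burnside_ring)
  have "ring (?L\<lparr>carrier := boundary_map ` carrier ?R, zero := boundary_map \<zero>\<^bsub>?R\<^esub>\<rparr>)"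
    by (rule R.ring_hom_imp_img_ring[OF boundary_map_hom])
  then have ring: "ring ?L"
    unfolding boundary_map_surj boundary_map_zero by simp
  interpret h: ring_hom_ring ?R ?L boundary_map
    by (intro ring_hom_ringI2 R.ring_axioms ring boundary_map_hom)
  have "cring ?L"
  proof (intro cring.intro ring monoid.monoid_comm_monoidI)
    show "monoid ?L" using ring by (rule ring.axioms(2))
    fix f g assume "f \<in> carrier ?L" "g \<in> carrier ?L"
    then obtain a b where "a \<in> carrier ?R" "b \<in> carrier ?R" "f = boundary_map a" "g = boundary_map b"
      unfolding boundary_map_surj[symmetric] by blast
    then show "f \<otimes>\<^bsub>?L\<^esub> g = g \<otimes>\<^bsub>?L\<^esub> f"
      using R.m_comm by (metis h.hom_mult)
  qed
  moreover have "ideal (cyclic_vanishing p) ?R"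
    using h.kernel_is_ideal unfolding boundary_map_kernel .
  moreover have "?R Quot (cyclic_vanishing p) \<simeq> ?L"
    using h.FactRing_iso[OF boundary_map_surj] unfolding boundary_map_kernel .
  ultimately show ?thesis by blast
qed

end
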